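(* Let $k\geq 1$. There is a picture language definable by a $\Sigma^{\mathrm{mon}}_{k+1}$-formula but not by an $\mathrm{FO}(\Sigma^{\mathrm{mon}}_k)$-formula. In particular, there is a picture language definable by an $\mathrm{FO}(\Sigma^{\mathrm{mon}}_{k+1})$-formula but not by an $\mathrm{FO}(\Sigma^{\mathrm{mon}}_k)$-formula.
   Context: **Pictures.** A (non-empty) picture of size $(m,n)$, $m,n\ge1$, over a finite alphabet $\Gamma$ is an $m\times n$-matrix over $\Gamma$; $\mathrm{dom}(p)=\{1,\dots,m\}\times\{1,\dots,n\}$, and $p\langle i,j\rangle$ is the entry in row $i$, column $j$. A picture language is a set of non-empty pictures. Alphabets are of the form $\{0,1\}^J$ for a finite set $J$ of attributes ($\{0,1\}^\emptyset$ is a singleton alphabet). **Logic.** Formulas use first-order variables $x_\nu$ and set variables $X_\mu$, atomic formulas $X_\mu x_\nu$, $S_1x_\mu x_\nu$, $S_2x_\mu x_\nu$, $x_\mu=x_\nu$, Boolean connectives, and first-order and set quantification. A picture $p$ over $\{0,1\}^J$ gives the structure with universe $\mathrm{dom}(p)$, $S_1$ the vertical successor relation ($(i,j)\mapsto(i+1,j)$), $S_2$ the horizontal successor relation ($(i,j)\mapsto(i,j+1)$), and $X_\mu$ (for $\mu\in J$) interpreted as $\{(i,j):p\langle i,j\rangle(\mu)=1\}$. A formula $\varphi$ without free first-order variables and with free set variables among $(X_\mu)_{\mu\in J}$ defines the language of all non-empty pictures $p$ over $\{0,1\}^J$ with $p\models\varphi$. Two formulas are equivalent iff they are satisfied by the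 same pictures-with-assignments. **Formula classes.** $\mathrm{FO}$ is the class of formulas without set quantifiers. For a formula class $\mathcal F$: $\mathrm B(\mathcal F)$ is the closure of $\mathcal F$ under Boolean combinations; $\Sigma^{\mathrm{mon}}_1(\mathcal F)$ is the closure of $\mathcal F$ under existential set quantification and positive Boolean combinations; $\mathrm{FO}(\mathcal F)$ is the closure of $\mathcal F$ under first-order quantifications and Boolean combinations. $\Sigma^{\mathrm{mon}}_0(\mathcal F)=\mathcal F$, $\Sigma^{\mathrm{mon}}_{k+1}(\mathcal F)=\Sigma^{\mathrm{mon}}_1(\mathrm B(\Sigma^{\mathrm{mon}}_k(\mathcal F)))$, and $\Sigma^{\mathrm{mon}}_k=\Sigma^{\mathrm{mon}}_k(\mathrm{FO})$. Formulas equivalent to a formula in $\mathcal F$ are also counted as $\mathcal F$-formulas. *)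

theory Defs
  imports "Jordan_Normal_Form.Matrix"
begin

text \<open>Pictures are matrices. The library indexes matrices from 0, whereas positions of a
  picture are counted from 1, so \<open>entry\<close> shifts the indices.\<close>

type_synonym attr = nat
type_synonym letter = "attr \<Rightarrow> nat"
type_synonym picture = "letter mat"
type_synonym pos = "nat \<times> nat"

definition alphabet :: "attr set \<Rightarrow> letter set" where
  "alphabet J = J \<rightarrow>\<^sub>E {0, 1}"

definition pictures :: "attr set \<Rightarrow> picture set" where
  "pictures J = {p. 1 \<le> dim_row p \<and> 1 \<le> dim_col p \<and> elements_mat p \<subseteq> alphabet J}"

definition pdom :: "picture \<Rightarrow> pos set" where
  "pdom p = {1..dim_row p} \<times> {1..dim_col p}"

definition entry :: "picture \<Rightarrow> pos \<Rightarrow> letter" where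
  "entry p = (\<lambda>(i, j). p $$ (i - 1, j - 1))"

text \<open>The two sorts of variables are indexed by natural numbers. An attribute \<open>\<mu>\<close> of a picture
  and the set variable with index \<open>\<mu>\<close> are identified.\<close>

datatype fm =
    Mem nat nat  \<comment> \<open>\<open>Mem \<mu> \<nu>\<close> is the atomic formula \<open>X\<^sub>\<mu> x\<^sub>\<nu>\<close>\<close>
  | S1 nat nat
  | S2 nat nat
  | Eq nat nat
  | Neg fm
  | Conj fm fm
  | Disj fm fm
  | ExF nat fm   \<comment> \<open>first-order quantifiers\<close>
  | AllF nat fm
  | ExS nat fm   \<comment> \<open>set quantifiers\<close>
  | AllS nat fm

primrec free_fo :: "fm \<Rightarrow> nat set" where
  "free_fo (Mem X x) = {x}"
| "free_fo (S1 x y) = {x, y}"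
| "free_fo (S2 x y) = {x, y}"
| "free_fo (Eq x y) = {x, y}"
| "free_fo (Neg f) = free_fo f"
| "free_fo (Conj f g) = free_fo f \<union> free_fo g"
| "free_fo (Disj f g) = free_fo f \<union> free_fo g"
| "free_fo (ExF x f) = free_fo f - {x}"
| "free_fo (AllF x f) = free_fo f - {x}"
| "free_fo (ExS X f) = free_fo f"
| "free_fo (AllS X f) = free_fo f"

primrec free_set :: "fm \<Rightarrow> nat set" where
  "free_set (Mem X x) = {X}"
| "free_set (S1 x y) = {}"
| "free_set (S2 x y) = {}"
| "free_set (Eq x y) = {}"
| "free_set (Neg f) = free_set f"
| "free_set (Conj f g) = free_set f \<union> free_set g"
| "free_set (Disj f g) = free_set f \<union> free_set g"
| "free_set (ExF x f) = free_set f"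
| "free_set (AllF x f) = free_set f"
| "free_set (ExS X f) = free_set f - {X}"
| "free_set (AllS X f) = free_set f - {X}"

primrec no_set_quant :: "fm \<Rightarrow> bool" where
  "no_set_quant (Mem X x) = True"
| "no_set_quant (S1 x y) = True"
| "no_set_quant (S2 x y) = True"
| "no_set_quant (Eq x y) = True"
| "no_set_quant (Neg f) = no_set_quant f"
| "no_set_quant (Conj f g) = (no_set_quant f \<and> no_set_quant g)"
| "no_set_quant (Disj f g) = (no_set_quant f \<and> no_set_quant g)"
| "no_set_quant (ExF x f) = no_set_quant f"
| "no_set_quant (AllF x f) = no_set_quant f"
| "no_set_quant (ExS X f) = False"
| "no_set_quant (AllS X f) = False"

text \<open>\<open>D\<close> is the universe; \<open>a\<close> and \<open>A\<close> assign values to all first-order and all set variables.\<close>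

primrec sat :: "pos set \<Rightarrow> (nat \<Rightarrow> pos) \<Rightarrow> (nat \<Rightarrow> pos set) \<Rightarrow> fm \<Rightarrow> bool" where
  "sat D a A (Mem X x) = (a x \<in> A X)"
| "sat D a A (S1 x y) = (a y = (fst (a x) + 1, snd (a x)))"
| "sat D a A (S2 x y) = (a y = (fst (a x), snd (a x) + 1))"
| "sat D a A (Eq x y) = (a x = a y)"
| "sat D a A (Neg f) = (\<not> sat D a A f)"
| "sat D a A (Conj f g) = (sat D a A f \<and> sat D a A g)"
| "sat D a A (Disj f g) = (sat D a A f \<or> sat D a A g)"
| "sat D a A (ExF x f) = (\<exists>d\<in>D. sat D (a(x := d)) A f)"
| "sat D a A (AllF x f) = (\<forall>d\<in>D. sat D (a(x := d)) A f)"
| "sat D a A (ExS X f) = (\<exists>M\<subseteq>D. sat D a (A(X := M)) f)"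
| "sat D a A (AllS X f) = (\<forall>M\<subseteq>D. sat D a (A(X := M)) f)"

definition assignments :: "picture \<Rightarrow> ((nat \<Rightarrow> pos) \<times> (nat \<Rightarrow> pos set)) set" where
  "assignments p = {(a, A). (\<forall>x. a x \<in> pdom p) \<and> (\<forall>X. A X \<subseteq> pdom p)}"

text \<open>Set variables with index in \<open>J\<close> are interpreted by the picture over \<open>{0,1}\<^sup>J\<close>, all other
  ones by the assignment \<open>A\<close>.\<close>

definition pic_sat :: "attr set \<Rightarrow> picture \<Rightarrow> (nat \<Rightarrow> pos) \<Rightarrow> (nat \<Rightarrow> pos set) \<Rightarrow> fm \<Rightarrow> bool" where
  "pic_sat J p a A f \<longleftrightarrow>
     sat (pdom p) a (\<lambda>\<mu>. if \<mu> \<in> J then {d \<in> pdom p. entry p d \<mu> = 1} else A \<mu>) f"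

definition fm_equiv :: "fm \<Rightarrow> fm \<Rightarrow> bool" where
  "fm_equiv f g \<longleftrightarrow> (\<forall>J p a A. finite J \<longrightarrow> p \<in> pictures J \<longrightarrow> (a, A) \<in> assignments p \<longrightarrow>
     (pic_sat J p a A f \<longleftrightarrow> pic_sat J p a A g))"

text \<open>Only used for formulas without free first-order variables and with free set variables
  in \<open>J\<close>; for these, satisfaction does not depend on the assignment.\<close>

definition language :: "attr set \<Rightarrow> fm \<Rightarrow> picture set" where
  "language J f = {p \<in> pictures J. \<forall>(a, A) \<in> assignments p. pic_sat J p a A f}"

text \<open>Every formula class is closed under equivalence: a formula equivalent to a formula
  of the class counts as a member.\<close>

definition FO :: "fm set" where
  "FO = {f. \<exists>g. no_set_quant g \<and> fm_equiv f g}"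

inductive_set Bool_cl :: "fm set \<Rightarrow> fm set" for F :: "fm set" where
  base: "f \<in> F \<Longrightarrow> f \<in> Bool_cl F"
| neg: "f \<in> Bool_cl F \<Longrightarrow> Neg f \<in> Bool_cl F"
| conj: "f \<in> Bool_cl F \<Longrightarrow> g \<in> Bool_cl F \<Longrightarrow> Conj f g \<in> Bool_cl F"
| disj: "f \<in> Bool_cl F \<Longrightarrow> g \<in> Bool_cl F \<Longrightarrow> Disj f g \<in> Bool_cl F"
| equiv: "g \<in> Bool_cl F \<Longrightarrow> fm_equiv f g \<Longrightarrow> f \<in> Bool_cl F"

inductive_set Sigma1_mon :: "fm set \<Rightarrow> fm set" for F :: "fm set" where
  base: "f \<in> F \<Longrightarrow> f \<in> Sigma1_mon F"
| exS: "f \<in> Sigma1_mon F \<Longrightarrow> ExS X f \<in> Sigma1_mon F"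
| conj: "f \<in> Sigma1_mon F \<Longrightarrow> g \<in> Sigma1_mon F \<Longrightarrow> Conj f g \<in> Sigma1_mon F"
| disj: "f \<in> Sigma1_mon F \<Longrightarrow> g \<in> Sigma1_mon F \<Longrightarrow> Disj f g \<in> Sigma1_mon F"
| equiv: "g \<in> Sigma1_mon F \<Longrightarrow> fm_equiv f g \<Longrightarrow> f \<in> Sigma1_mon F"

inductive_set FO_cl :: "fm set \<Rightarrow> fm set" for F :: "fm set" where
  base: "f \<in> F \<Longrightarrow> f \<in> FO_cl F"
| neg: "f \<in> FO_cl F \<Longrightarrow> Neg f \<in> FO_cl F"
| conj: "f \<in> FO_cl F \<Longrightarrow> g \<in> FO_cl F \<Longrightarrow> Conj f g \<in> FO_cl F"
| disj: "f \<in> FO_cl F \<Longrightarrow> g \<in> FO_cl F \<Longrightarrow> Disj f g \<in> FO_cl F"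
| exF: "f \<in> FO_cl F \<Longrightarrow> ExF x f \<in> FO_cl F"
| allF: "f \<in> FO_cl F \<Longrightarrow> AllF x f \<in> FO_cl F"
| equiv: "g \<in> FO_cl F \<Longrightarrow> fm_equiv f g \<Longrightarrow> f \<in> FO_cl F"

primrec Sigma_mon_over :: "fm set \<Rightarrow> nat \<Rightarrow> fm set" where
  "Sigma_mon_over F 0 = F"
| "Sigma_mon_over F (Suc k) = Sigma1_mon (Bool_cl (Sigma_mon_over F k))"

definition Sigma_mon :: "nat \<Rightarrow> fm set" where
  "Sigma_mon k = Sigma_mon_over FO k"

definition definable :: "fm set \<Rightarrow> attr set \<Rightarrow> picture set \<Rightarrow> bool" where
  "definable F J L \<longleftrightarrow>
     (\<exists>f\<in>F. free_fo f = {} \<and> free_set f \<subseteq> J \<and> L = language J f)"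

end

theory Submission
  imports Defs "HOL-Library.Product_Plus"
begin

text \<open>For a fixed height \<open>m\<close>, a picture is a word of columns. By Hanf locality, first-order
  formulas are recognised by deterministic automata with \<open>2\<^sup>O\<^sup>(\<^sup>m\<^sup>)\<close> states; positive connectives and set
  projections act on nondeterministic automata and complementation costs one exponential. So
  every \<open>\<Sigma>\<^sub>k\<close>-formula has automata whose number \<open>N\<close> of states is \<open>k\<close>-fold exponential in \<open>O(m)\<close>.
  Powers of a relation on \<open>N\<close> states are eventually periodic, and every common
  multiple \<open>P\<close> of \<open>1, \<dots>, N\<close> is a period. An Ehrenfeucht-Fraisse argument extends this to first-order
  closures: whether a sufficiently wide unlabelled picture satisfies an \<open>FO(\<Sigma>\<^sub>k)\<close>-formula is not
  affected by the insertion of \<open>P\<close> columns. It is the period that separates the classes here, not the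
  growth rate: an \<open>FO(\<Sigma>\<^sub>k)\<close>-formula can define \<open>(k+1)\<close>-fold exponential widths.

  Conversely, nested binary counters define in \<open>\<Sigma>\<^sub>k\<close> the strips whose width is a \<open>k\<close>-fold
  exponential number \<open>F\<^sub>k(m)\<close>, and in \<open>\<Sigma>\<^sub>k\<^sub>+\<^sub>1\<close> the pictures whose width is divisible by \<open>F\<^sub>k(m)\<close> times 2 to
  the power \<open>F\<^sub>k(m)\<close>. This power of 2 exceeds \<open>N\<close> for suitable \<open>m\<close>, so some common multiple \<open>P\<close>
  of \<open>1, \<dots>, N\<close> is not divisible by it, and \<open>P\<close> would be a period of the divisibility language if that
  language were \<open>FO(\<Sigma>\<^sub>k)\<close>-definable.\<close>

section \<open>Hanf locality on grids\<close>

text \<open>The obstacle is the first-order closure on top of a level. On automata every negation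
  would be paid for by a determinisation, so alternating quantifiers would raise the tower. Hence
  automata are used below the first-order closure only; what passes through it is invariance under
  insertion, with a fixed period and a growing margin. The bound of O(m) in the exponent has a
  simple origin: a prefix must remember its last few columns, which take O(m) bits, and truncated
  counts of windows, whose number is independent of m. On the definability side an exponential must
  cost a single level. A counter with F-bit numbers compares cells at distance F, which no fixed
  formula can measure as m grows; a quantified strip of length F serves as ruler. Correctness at all
  placements of the ruler is a negated existential statement, hence still in the Boolean closure of
  the ruler's level. The numbers lie side by side, so lengths follow F * 2 ^ F. The two bounds need
  not meet closely: constants in the argument of a tower are beaten by choosing m with C * m < 2 ^
  m.\<close>

definition window :: "nat \<Rightarrow> (int \<times> int \<Rightarrow> 'c option) \<Rightarrow> int \<times> int \<Rightarrow> int \<times> int \<Rightarrow> 'c option" where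
  "window r c p = (\<lambda>d. if \<bar>fst d\<bar> \<le> int r \<and> \<bar>snd d\<bar> \<le> int r then c (p + d) else None)"

definition near :: "nat \<Rightarrow> int \<times> int \<Rightarrow> bool" where
  "near r d \<longleftrightarrow> \<bar>fst d\<bar> \<le> int r \<and> \<bar>snd d\<bar> \<le> int r"

lemma near_uminus [simp]: "near r (- d) \<longleftrightarrow> near r d"
  by (simp add: near_def)

lemma near_minus_commute: "near r (p - q) \<longleftrightarrow> near r (q - p)"
  by (auto simp: near_def)

lemma near_add: "near r d \<Longrightarrow> near s e \<Longrightarrow> near (r + s) (d + e)"
  by (auto simp: near_def)

lemma near_mono: "near r d \<Longrightarrow> r \<le> s \<Longrightarrow> near s d"
  by (auto simp: near_def)

lemma finite_near: "finite {d. near r d}" and card_near: "card {d. near r d} = (2 * r + 1)\<^sup>2"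
proof -
  have "{d. near r d} = {- int r..int r} \<times> {- int r..int r}"
    by (auto simp: near_def)
  then show "finite {d. near r d}" "card {d. near r d} = (2 * r + 1)\<^sup>2"
    by (simp_all add: card_cartesian_product power2_eq_square nat_add_distrib nat_mult_distrib
        algebra_simps)
qed

lemma window_eqD:
  assumes "window r c p = window r c' p'" "near r d"
  shows "c (p + d) = c' (p' + d)"
  using fun_cong[OF assms(1), of d] assms(2) by (simp add: window_def near_def)

lemma window_shift:
  assumes w: "window s c p = window s c' p'" and d: "near e d" and le: "r + e \<le> s"
  shows "window r c (p + d) = window r c' (p' + d)"
proof
  fix x
  show "window r c (p + d) x = window r c' (p' + d) x"
  proof (cases "near r x")
    case True
    then have "near s (d + x)"
      using near_mono[OF near_add[OF d True]] le by simp
    with window_eqD[OF w] have "c (p + (d + x)) = c' (p' + (d + x))" by blast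
    then show ?thesis by (simp add: window_def add.assoc)
  qed (auto simp: window_def near_def)
qed

lemma window_mono: "window s c p = window s c' p' \<Longrightarrow> r \<le> s \<Longrightarrow> window r c p = window r c' p'"
  using window_shift[of s c p c' p' 0 0 r] by (simp add: near_def)

text \<open>The invariant of the game. Windows read \<open>None\<close> outside the picture, so they
  record its borders. Displacements are compared only for pairs that are close on at least one side;
  pebbles far apart on both sides may lie anywhere, and this is the freedom that the answering
  player needs.\<close>

definition pebbles_match ::
  "'x set \<Rightarrow> nat \<Rightarrow> (int \<times> int \<Rightarrow> 'c option) \<Rightarrow> ('x \<Rightarrow> int \<times> int) \<Rightarrow>
   (int \<times> int \<Rightarrow> 'c option) \<Rightarrow> ('x \<Rightarrow> int \<times> int) \<Rightarrow> bool" where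
  "pebbles_match U r c \<alpha> c' \<alpha>' \<longleftrightarrow>
     (\<forall>x\<in>U. window r c (\<alpha> x) = window r c' (\<alpha>' x)) \<and>
     (\<forall>x\<in>U. \<forall>y\<in>U. near r (\<alpha> x - \<alpha> y) \<or> near r (\<alpha>' x - \<alpha>' y) \<longrightarrow> \<alpha> x - \<alpha> y = \<alpha>' x - \<alpha>' y)"

lemma pebbles_match_sym: "pebbles_match U r c \<alpha> c' \<alpha>' \<Longrightarrow> pebbles_match U r c' \<alpha>' c \<alpha>"
  unfolding pebbles_match_def by metis

lemma pebbles_match_mono:
  "pebbles_match U s c \<alpha> c' \<alpha>' \<Longrightarrow> r \<le> s \<Longrightarrow> pebbles_match U r c \<alpha> c' \<alpha>'"
  unfolding pebbles_match_def by (meson near_mono window_mono)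

text \<open>The counting condition of Hanf's theorem, up to a threshold. The game uses a smaller
  radius in each round, hence the quantification over all \<open>r \<le> R\<close>.\<close>

definition same_counts ::
  "nat \<Rightarrow> nat \<Rightarrow> (int \<times> int \<Rightarrow> 'c option) \<Rightarrow> (int \<times> int \<Rightarrow> 'c option) \<Rightarrow> bool" where
  "same_counts t R c c' \<longleftrightarrow> (\<forall>r\<le>R. \<forall>\<tau>.
     min t (card {q \<in> dom c. window r c q = \<tau>}) = min t (card {q \<in> dom c'. window r c' q = \<tau>}))"

lemma same_counts_sym: "same_counts t R c c' \<Longrightarrow> same_counts t R c' c"
  by (simp add: same_counts_def)

text \<open>A position near a pebble is transported to the other side with the same offset from that
  pebble. If two images coincide, their pebbles are within \<open>2 * r\<close> of each other there,
  so the match at radius \<open>2 * r\<close> gives them the same displacement on both sides, and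
  the two positions coincide.\<close>

lemma card_near_pebbles_le:
  fixes c c' :: "int \<times> int \<Rightarrow> 'c option"
  assumes U: "finite U" and fin: "finite (dom c')"
    and m: "pebbles_match U (2 * r) c \<alpha> c' \<alpha>'"
  shows "card {q \<in> dom c. window r c q = \<tau> \<and> (\<exists>y\<in>U. near r (q - \<alpha> y))}
       \<le> card {q \<in> dom c'. window r c' q = \<tau> \<and> (\<exists>y\<in>U. near r (q - \<alpha>' y))}"
    (is "card ?N \<le> card ?N'")
proof -
  have "\<forall>q\<in>?N. \<exists>y. y \<in> U \<and> near r (q - \<alpha> y)" by auto
  from bchoice[OF this] obtain Y where Y: "\<And>q. q \<in> ?N \<Longrightarrow> Y q \<in> U \<and> near r (q - \<alpha> (Y q))"
    by blast
  define g where "g q = \<alpha>' (Y q) + (q - \<alpha> (Y q))" for q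
  have win: "window r c (\<alpha> y + d) = window r c' (\<alpha>' y + d)" if "y \<in> U" "near r d" for y d
    using m that window_shift[of "2 * r" c "\<alpha> y" c' "\<alpha>' y" r d r]
    by (auto simp: pebbles_match_def)
  have col: "c (\<alpha> y + d) = c' (\<alpha>' y + d)" if "y \<in> U" "near r d" for y d
    using window_eqD[OF win[OF that], of 0] by (simp add: near_def)
  have "inj_on g ?N"
  proof (rule inj_onI)
    fix p q assume p: "p \<in> ?N" and q: "q \<in> ?N" and eq: "g p = g q"
    let ?dp = "p - \<alpha> (Y p)" and ?dq = "q - \<alpha> (Y q)"
    have "\<alpha>' (Y p) - \<alpha>' (Y q) = ?dq - ?dp" using eq by (simp add: g_def algebra_simps)
    moreover have "near (r + r) (?dq + (- ?dp))"
      by (rule near_add) (use Y[OF p] Y[OF q] near_uminus in blast)+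
    ultimately have "near (2 * r) (\<alpha>' (Y p) - \<alpha>' (Y q))" by (simp add: mult_2 del: minus_diff_eq)
    with m Y[OF p] Y[OF q] have "\<alpha> (Y p) - \<alpha> (Y q) = \<alpha>' (Y p) - \<alpha>' (Y q)"
      unfolding pebbles_match_def by blast
    with eq show "p = q" by (simp add: g_def algebra_simps)
  qed
  moreover have "g ` ?N \<subseteq> ?N'"
  proof
    fix z assume "z \<in> g ` ?N"
    then obtain q where q: "q \<in> ?N" and z: "z = g q" by blast
    let ?d = "q - \<alpha> (Y q)"
    have eq: "q = \<alpha> (Y q) + ?d" by simp
    have "window r c' (g q) = \<tau>"
      using win[of "Y q" ?d] Y[OF q] q by (simp add: g_def)
    moreover have "c' (g q) = c q" using col[of "Y q" ?d] Y[OF q] by (simp add: g_def)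
    moreover have "near r (g q - \<alpha>' (Y q))" using Y[OF q] by (simp add: g_def)
    ultimately show "z \<in> ?N'" using q Y[OF q] z by auto
  qed
  ultimately show ?thesis
    using fin by (intro card_inj_on_le[of g]) auto
qed

text \<open>One round of the game. A position near an old pebble is answered with the same offset. A
  position far from all pebbles is answered by a far one with the same window: the pebbles cover no
  more positions of this type on the other side than here, while here at least one is
  uncovered.\<close>

lemma pebbles_match_extend:
  fixes c c' :: "int \<times> int \<Rightarrow> 'c option"
  assumes U: "finite U" and fin: "finite (dom c)" "finite (dom c')"
    and m: "pebbles_match U (2 * r) c \<alpha> c' \<alpha>'"
    and cnt: "same_counts t R c c'" and rR: "r \<le> R"
    and t: "t > card U * (2 * R + 1)\<^sup>2"
    and p: "p \<in> dom c"
  obtains p' where "p' \<in> dom c'" "pebbles_match U r c (\<alpha>(x := p)) c' (\<alpha>'(x := p'))"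
proof -
  have m': "pebbles_match U r c \<alpha> c' \<alpha>'" using m by (rule pebbles_match_mono) simp
  have update: "pebbles_match U r c (\<alpha>(x := p)) c' (\<alpha>'(x := p'))"
    if w: "window r c p = window r c' p'"
      and d: "\<And>y. y \<in> U \<Longrightarrow> near r (p - \<alpha> y) \<or> near r (p' - \<alpha>' y) \<Longrightarrow> p - \<alpha> y = p' - \<alpha>' y"
    for p'
  proof -
    have "\<alpha> y - p = \<alpha>' y - p'" if "y \<in> U" "near r (\<alpha> y - p) \<or> near r (\<alpha>' y - p')" for y
      using d[OF that(1)] that(2) by (metis near_minus_commute minus_diff_eq)
    note update_sym = this
    show ?thesis
      unfolding pebbles_match_def
    proof (intro conjI ballI impI)
      fix z assume "z \<in> U"
      then show "window r c ((\<alpha>(x := p)) z) = window r c' ((\<alpha>'(x := p')) z)"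
        using m' w by (simp add: pebbles_match_def)
    next
      fix y z assume yz: "y \<in> U" "z \<in> U"
        and n: "near r ((\<alpha>(x := p)) y - (\<alpha>(x := p)) z) \<or> near r ((\<alpha>'(x := p')) y - (\<alpha>'(x := p')) z)"
      consider "y = x" "z = x" | "y = x" "z \<noteq> x" | "y \<noteq> x" "z = x" | "y \<noteq> x" "z \<noteq> x" by blast
      then show "(\<alpha>(x := p)) y - (\<alpha>(x := p)) z = (\<alpha>'(x := p')) y - (\<alpha>'(x := p')) z"
      proof cases
        case 4
        then show ?thesis using m' n yz unfolding pebbles_match_def by fastforce
      qed (use n yz d[of z] update_sym[of y] in simp_all)
    qed
  qed
  show thesis
  proof (cases "\<exists>y\<in>U. near r (p - \<alpha> y)")
    case True
    then obtain y where y: "y \<in> U" "near r (p - \<alpha> y)" by blast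
    define p' where "p' = \<alpha>' y + (p - \<alpha> y)"
    have "window (2 * r) c (\<alpha> y) = window (2 * r) c' (\<alpha>' y)"
      using m y by (simp add: pebbles_match_def)
    then have "window r c (\<alpha> y + (p - \<alpha> y)) = window r c' p'"
      unfolding p'_def using y by (rule_tac window_shift[of "2 * r" _ _ _ _ r]) auto
    then have w: "window r c p = window r c' p'" by simp
    have "p' \<in> dom c'"
      using window_eqD[OF w, of 0] p by (simp add: near_def dom_def)
    moreover have "p - \<alpha> z = p' - \<alpha>' z"
      if "z \<in> U" and n: "near r (p - \<alpha> z) \<or> near r (p' - \<alpha>' z)" for z
    proof -
      have "near (2 * r) (\<alpha> y - \<alpha> z) \<or> near (2 * r) (\<alpha>' y - \<alpha>' z)"
        using n
      proof
        assume "near r (p - \<alpha> z)"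
        from near_add[OF this, of r "- (p - \<alpha> y)"] y show ?thesis
          by (simp add: mult_2 del: minus_diff_eq)
      next
        assume "near r (p' - \<alpha>' z)"
        from near_add[OF this, of r "- (p - \<alpha> y)"] y show ?thesis
          by (simp add: mult_2 p'_def del: minus_diff_eq)
      qed
      with m y that have "\<alpha> y - \<alpha> z = \<alpha>' y - \<alpha>' z"
        unfolding pebbles_match_def by blast
      then show ?thesis by (simp add: p'_def algebra_simps)
    qed
    ultimately show thesis using that update[OF w] by blast
  next
    case far: False
    define \<tau> where "\<tau> = window r c p"
    let ?C = "{q \<in> dom c. window r c q = \<tau>}" and ?C' = "{q \<in> dom c'. window r c' q = \<tau>}"
    let ?N = "{q \<in> dom c. window r c q = \<tau> \<and> (\<exists>y\<in>U. near r (q - \<alpha> y))}"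
    let ?N' = "{q \<in> dom c'. window r c' q = \<tau> \<and> (\<exists>y\<in>U. near r (q - \<alpha>' y))}"
    have "card ?N' \<le> card ?N"
      by (rule card_near_pebbles_le[OF U fin(1) pebbles_match_sym[OF m]])
    moreover have "card ?N < card ?C"
      using far p fin by (intro psubset_card_mono) (auto simp: \<tau>_def)
    \<comment> \<open>This bound lies below \<open>t\<close>, so truncating the counts at
      \<open>t\<close> cannot hide an uncovered position.\<close>
    moreover have "card ?N' \<le> card U * (2 * R + 1)\<^sup>2"
    proof -
      have "?N' \<subseteq> (\<lambda>(y, d). \<alpha>' y + d) ` (U \<times> {d. near R d})"
      proof
        fix q assume "q \<in> ?N'"
        then obtain y where "y \<in> U" "near r (q - \<alpha>' y)" by auto
        then have "(y, q - \<alpha>' y) \<in> U \<times> {d. near R d}" using near_mono rR by auto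
        then show "q \<in> (\<lambda>(y, d). \<alpha>' y + d) ` (U \<times> {d. near R d})" by force
      qed
      then have "card ?N' \<le> card (U \<times> {d. near R d})"
        using U finite_near by (meson finite_SigmaI surj_card_le)
      then show ?thesis by (simp add: card_cartesian_product card_near)
    qed
    moreover have "min t (card ?C) = min t (card ?C')"
      using cnt rR by (simp add: same_counts_def)
    ultimately have "card ?N' < card ?C'" using t by linarith
    then have "\<not> ?C' \<subseteq> ?N'" using fin(2) card_mono[of ?N' ?C'] by fastforce
    then obtain p' where p': "p' \<in> dom c'" "window r c' p' = \<tau>" "\<forall>y\<in>U. \<not> near r (p' - \<alpha>' y)"
      by auto
    show thesis
      by (rule that[OF p'(1)], rule update) (use p' far \<tau>_def in auto)
  qed
qed

section \<open>The back-and-forth game for first-order formulas\<close>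

primrec qdepth :: "fm \<Rightarrow> nat" where
  "qdepth (Mem X x) = 0"
| "qdepth (S1 x y) = 0"
| "qdepth (S2 x y) = 0"
| "qdepth (Eq x y) = 0"
| "qdepth (Neg f) = qdepth f"
| "qdepth (Conj f g) = max (qdepth f) (qdepth g)"
| "qdepth (Disj f g) = max (qdepth f) (qdepth g)"
| "qdepth (ExF x f) = Suc (qdepth f)"
| "qdepth (AllF x f) = Suc (qdepth f)"
| "qdepth (ExS X f) = qdepth f"
| "qdepth (AllS X f) = qdepth f"

primrec fo_vars :: "fm \<Rightarrow> nat set" where
  "fo_vars (Mem X x) = {x}"
| "fo_vars (S1 x y) = {x, y}"
| "fo_vars (S2 x y) = {x, y}"
| "fo_vars (Eq x y) = {x, y}"
| "fo_vars (Neg f) = fo_vars f"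
| "fo_vars (Conj f g) = fo_vars f \<union> fo_vars g"
| "fo_vars (Disj f g) = fo_vars f \<union> fo_vars g"
| "fo_vars (ExF x f) = insert x (fo_vars f)"
| "fo_vars (AllF x f) = insert x (fo_vars f)"
| "fo_vars (ExS X f) = fo_vars f"
| "fo_vars (AllS X f) = fo_vars f"

lemma finite_fo_vars [simp]: "finite (fo_vars f)"
  by (induction f) auto

lemma finite_free_set [simp]: "finite (free_set f)"
  by (induction f) auto

abbreviation ipos :: "pos \<Rightarrow> int \<times> int" where
  "ipos \<equiv> map_prod int int"

lemma ipos_fun_upd: "ipos \<circ> a(x := d) = (ipos \<circ> a)(x := ipos d)"
  by auto

lemma pebbles_match_nearD:
  assumes "pebbles_match U (2 ^ j) c (ipos \<circ> a) c' (ipos \<circ> a')" "x \<in> U" "y \<in> U"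
    and "near 1 (ipos (a y) - ipos (a x)) \<or> near 1 (ipos (a' y) - ipos (a' x))"
  shows "ipos (a y) - ipos (a x) = ipos (a' y) - ipos (a' x)"
proof -
  have "(1::nat) \<le> 2 ^ j" by simp
  with assms near_mono[OF _ this] show ?thesis unfolding pebbles_match_def comp_def by blast
qed

text \<open>With \<open>j\<close> quantifiers left the pebbles match at radius \<open>2 ^ j\<close>.
  Each round halves the radius, and the final radius 1 is what successor and equality atoms can see.
  A round consults \<open>same_counts\<close> at half the current radius, whence
  \<open>2 ^ j \<le> 2 * R\<close>. Set membership is decided by the colour of a position.\<close>

lemma hanf:
  fixes c c' :: "int \<times> int \<Rightarrow> 'c option"
  assumes fin: "finite D" "finite D'" "finite U"
    and D: "dom c = ipos ` D" "dom c' = ipos ` D'"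
    and cnt: "same_counts t R c c'"
    and t: "t > card U * (2 * R + 1)\<^sup>2"
    and X: "\<And>X p p'. X \<in> W \<Longrightarrow> p \<in> D \<Longrightarrow> p' \<in> D' \<Longrightarrow> c (ipos p) = c' (ipos p') \<Longrightarrow>
              p \<in> A X \<longleftrightarrow> p' \<in> A' X"
  shows "no_set_quant f \<Longrightarrow> fo_vars f \<subseteq> U \<Longrightarrow> free_set f \<subseteq> W \<Longrightarrow> qdepth f \<le> j \<Longrightarrow> 2 ^ j \<le> 2 * R \<Longrightarrow>
    (\<forall>x\<in>U. a x \<in> D) \<Longrightarrow> (\<forall>x\<in>U. a' x \<in> D') \<Longrightarrow>
    pebbles_match U (2 ^ j) c (ipos \<circ> a) c' (ipos \<circ> a') \<Longrightarrow>
    sat D a A f \<longleftrightarrow> sat D' a' A' f"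
proof (induction f arbitrary: a a' j)
  case (Mem Y x)
  then have "window (2 ^ j) c (ipos (a x)) = window (2 ^ j) c' (ipos (a' x))"
    by (simp add: pebbles_match_def)
  from window_eqD[OF this, of 0] have "c (ipos (a x)) = c' (ipos (a' x))"
    by (simp add: near_def)
  with Mem X show ?case by auto
next
  case (S1 x y)
    have eq: "sat D a A (S1 x y) \<longleftrightarrow> ipos (a y) - ipos (a x) = (1, 0)" for D a A
    by (cases "a x"; cases "a y") auto
  have "near 1 (1, 0)" by (simp add: near_def)
  then show ?case
    using pebbles_match_nearD[OF S1(8), of x y] S1(2) unfolding eq by fastforce
next
  case (S2 x y)
    have eq: "sat D a A (S2 x y) \<longleftrightarrow> ipos (a y) - ipos (a x) = (0, 1)" for D a A
    by (cases "a x"; cases "a y") auto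
  have "near 1 (0, 1)" by (simp add: near_def)
  then show ?case
    using pebbles_match_nearD[OF S2(8), of x y] S2(2) unfolding eq by fastforce
next
  case (Eq x y)
    have eq: "sat D a A (Eq x y) \<longleftrightarrow> ipos (a y) - ipos (a x) = (0, 0)" for D a A
    by (cases "a x"; cases "a y") auto
  have "near 1 (0, 0)" by (simp add: near_def)
  then show ?case
    using pebbles_match_nearD[OF Eq(8), of x y] Eq(2) unfolding eq by fastforce
next
  case (ExF x f)
  then obtain i where j: "j = Suc i" by (cases j) auto
  have m: "pebbles_match U (2 * 2 ^ i) c (ipos \<circ> a) c' (ipos \<circ> a')" and iR: "2 ^ i \<le> R"
    using ExF.prems(5,8) unfolding j by (simp_all add: comp_def)
  have IH: "sat D (a(x := d)) A f \<longleftrightarrow> sat D' (a'(x := d')) A' f"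
    if "d \<in> D" "d' \<in> D'" "pebbles_match U (2 ^ i) c ((ipos \<circ> a)(x := ipos d)) c' ((ipos \<circ> a')(x := ipos d'))" for d d'
  proof (rule ExF.IH[where j = i])
    show "pebbles_match U (2 ^ i) c (ipos \<circ> a(x := d)) c' (ipos \<circ> a'(x := d'))"
      unfolding ipos_fun_upd by (fact that(3))
  qed (use ExF.prems(1-7) j that(1,2) iR in auto)
  have forth: "\<exists>d'\<in>D'. sat D (a(x := d)) A f \<longleftrightarrow> sat D' (a'(x := d')) A' f" if d: "d \<in> D" for d
  proof -
    from d have "ipos d \<in> dom c" unfolding D by (rule imageI)
    from pebbles_match_extend[OF fin(3) _ _ m cnt iR t this, of x]
    obtain p' where p': "p' \<in> dom c'"
      "pebbles_match U (2 ^ i) c ((ipos \<circ> a)(x := ipos d)) c' ((ipos \<circ> a')(x := p'))"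
      using fin D by auto
    from p'(1) obtain d' where "p' = ipos d'" "d' \<in> D'"
      unfolding D by (rule imageE)
    then show ?thesis using IH[OF d] p'(2) by blast
  qed
  have back_forth: "\<exists>d\<in>D. sat D (a(x := d)) A f \<longleftrightarrow> sat D' (a'(x := d')) A' f" if d': "d' \<in> D'" for d'
  proof -
    from d' have "ipos d' \<in> dom c'" unfolding D by (rule imageI)
    from pebbles_match_extend[OF fin(3) _ _ pebbles_match_sym[OF m] same_counts_sym[OF cnt] iR t this, of x]
    obtain p where p: "p \<in> dom c"
      "pebbles_match U (2 ^ i) c' ((ipos \<circ> a')(x := ipos d')) c ((ipos \<circ> a)(x := p))"
      using fin D by auto
    from p(1) obtain d where "p = ipos d" "d \<in> D"
      unfolding D by (rule imageE)
    then show ?thesis using IH[OF _ d'] pebbles_match_sym[OF p(2)] by blast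
  qed
  show ?case
    unfolding sat.simps using forth back_forth by blast
next
  case (AllF x f)
  then obtain i where j: "j = Suc i" by (cases j) auto
  have m: "pebbles_match U (2 * 2 ^ i) c (ipos \<circ> a) c' (ipos \<circ> a')" and iR: "2 ^ i \<le> R"
    using AllF.prems(5,8) unfolding j by (simp_all add: comp_def)
  have IH: "sat D (a(x := d)) A f \<longleftrightarrow> sat D' (a'(x := d')) A' f"
    if "d \<in> D" "d' \<in> D'" "pebbles_match U (2 ^ i) c ((ipos \<circ> a)(x := ipos d)) c' ((ipos \<circ> a')(x := ipos d'))" for d d'
  proof (rule AllF.IH[where j = i])
    show "pebbles_match U (2 ^ i) c (ipos \<circ> a(x := d)) c' (ipos \<circ> a'(x := d'))"
      unfolding ipos_fun_upd by (fact that(3))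
  qed (use AllF.prems(1-7) j that(1,2) iR in auto)
  have forth: "\<exists>d'\<in>D'. sat D (a(x := d)) A f \<longleftrightarrow> sat D' (a'(x := d')) A' f" if d: "d \<in> D" for d
  proof -
    from d have "ipos d \<in> dom c" unfolding D by (rule imageI)
    from pebbles_match_extend[OF fin(3) _ _ m cnt iR t this, of x]
    obtain p' where p': "p' \<in> dom c'"
      "pebbles_match U (2 ^ i) c ((ipos \<circ> a)(x := ipos d)) c' ((ipos \<circ> a')(x := p'))"
      using fin D by auto
    from p'(1) obtain d' where "p' = ipos d'" "d' \<in> D'"
      unfolding D by (rule imageE)
    then show ?thesis using IH[OF d] p'(2) by blast
  qed
  have back_forth: "\<exists>d\<in>D. sat D (a(x := d)) A f \<longleftrightarrow> sat D' (a'(x := d')) A' f" if d': "d' \<in> D'" for d'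
  proof -
    from d' have "ipos d' \<in> dom c'" unfolding D by (rule imageI)
    from pebbles_match_extend[OF fin(3) _ _ pebbles_match_sym[OF m] same_counts_sym[OF cnt] iR t this, of x]
    obtain p where p: "p \<in> dom c"
      "pebbles_match U (2 ^ i) c' ((ipos \<circ> a')(x := ipos d')) c ((ipos \<circ> a)(x := p))"
      using fin D by auto
    from p(1) obtain d where "p = ipos d" "d \<in> D"
      unfolding D by (rule imageE)
    then show ?thesis using IH[OF _ d'] pebbles_match_sym[OF p(2)] by blast
  qed
  show ?case
    unfolding sat.simps using forth back_forth by blast
next
  case (Conj f g)
  then show ?case by (auto simp del: fun_upd_apply)
next
  case (Disj f g)
  then show ?case by auto
next
  case (Neg f)
  from Neg.IH[of j a a'] Neg.prems show ?case by simp
qed simp_all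

section \<open>First-order formulas as languages of column words\<close>

definition grid :: "nat \<Rightarrow> nat \<Rightarrow> pos set" where
  "grid m n = {1..m} \<times> {1..n}"

definition valid :: "nat \<Rightarrow> nat \<Rightarrow> (nat \<Rightarrow> pos) \<Rightarrow> (nat \<Rightarrow> pos set) \<Rightarrow> bool" where
  "valid m n a A \<longleftrightarrow> (\<forall>x. a x \<in> grid m n) \<and> (\<forall>X. A X \<subseteq> grid m n)"

type_synonym column = "nat + nat \<Rightarrow> nat set"

text \<open>First-order variables become tracks with a single entry, so that one word carries sets
  and pebbles alike. An arbitrary word of columns may contain a pebble several times or not at
  all.\<close>

definition vset :: "(nat \<Rightarrow> pos) \<Rightarrow> (nat \<Rightarrow> pos set) \<Rightarrow> nat + nat \<Rightarrow> pos set" where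
  "vset a A v = (case v of Inl X \<Rightarrow> A X | Inr x \<Rightarrow> {a x})"

definition word :: "nat \<Rightarrow> (nat \<Rightarrow> pos) \<Rightarrow> (nat \<Rightarrow> pos set) \<Rightarrow> column list" where
  "word n a A = map (\<lambda>j v. {i. (i, j) \<in> vset a A v}) [1..<Suc n]"

lemma vset_simps [simp]: "vset a A (Inl X) = A X" "vset a A (Inr x) = {a x}"
  by (simp_all add: vset_def)

lemma length_word [simp]: "length (word n a A) = n"
  by (simp add: word_def)

lemma nth_word [simp]: "j < n \<Longrightarrow> word n a A ! j = (\<lambda>v. {i. (i, Suc j) \<in> vset a A v})"
  by (simp add: word_def nth_append del: upt_Suc)

text \<open>Recording only the variables in \<open>V\<close> leaves finitely many colours and window
  types for finite \<open>V\<close>, although there are infinitely many columns.\<close>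

definition colouring :: "nat \<Rightarrow> (nat + nat) set \<Rightarrow> column list \<Rightarrow> int \<times> int \<Rightarrow> (nat + nat) set option" where
  "colouring m V w = (\<lambda>(i, j). if 1 \<le> i \<and> i \<le> int m \<and> 1 \<le> j \<and> j \<le> int (length w)
     then Some {v \<in> V. nat i \<in> (w ! (nat j - 1)) v} else None)"

lemma dom_colouring: "dom (colouring m V w) = ipos ` grid m (length w)"
proof -
  have "(i, j) \<in> ipos ` grid m n" if "1 \<le> i" "i \<le> int m" "1 \<le> j" "j \<le> int n" for i j n
    using that by (intro image_eqI[of _ _ "(nat i, nat j)"]) (auto simp: grid_def)
  then show ?thesis
    by (auto simp: colouring_def grid_def dom_def split: if_splits)
qed

lemma finite_grid [simp]: "finite (grid m n)"
  by (simp add: grid_def)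

lemma finite_dom_colouring [simp]: "finite (dom (colouring m V w))"
  by (simp add: dom_colouring)

lemma colouring_word:
  "p \<in> grid m n \<Longrightarrow> colouring m V (word n a A) (ipos p) = Some {v \<in> V. p \<in> vset a A v}"
  by (cases p) (auto simp: colouring_def grid_def)

lemma colouring_word_pebble:
  assumes "Some C = colouring m V (word n a A) q" "Inr x \<in> C"
  shows "q = ipos (a x)"
proof -
  have "q \<in> dom (colouring m V (word n a A))" by (rule domI) (rule assms(1)[symmetric])
  then obtain p where p: "q = ipos p" "p \<in> grid m n"
    unfolding dom_colouring length_word by (rule imageE)
  with assms colouring_word[of p m n V a A] show ?thesis by auto
qed

text \<open>Pebbles are part of the colours. Since \<open>t > 0\<close>, the window around
  \<open>a x\<close> also occurs in the other colouring, and its centre bears the mark of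
  \<open>x\<close>, so it is the window around \<open>a' x\<close>. Finding the mark of
  \<open>x\<close> inside the window around \<open>a y\<close> transfers displacements.\<close>

lemma same_counts_imp_pebbles_match:
  assumes v: "valid m n a A" "valid m n' a' A'" and U: "Inr ` U \<subseteq> V" and t: "t > 0"
    and cnt: "same_counts t R (colouring m V (word n a A)) (colouring m V (word n' a' A'))"
    and r: "r \<le> R"
  shows "pebbles_match U r (colouring m V (word n a A)) (ipos \<circ> a)
    (colouring m V (word n' a' A')) (ipos \<circ> a')"
proof -
  let ?c = "colouring m V (word n a A)" and ?c' = "colouring m V (word n' a' A')"
  have col: "?c (ipos (a x)) = Some {v \<in> V. a x \<in> vset a A v}"
    "?c' (ipos (a' x)) = Some {v \<in> V. a' x \<in> vset a' A' v}" for x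
    using v by (auto simp: valid_def colouring_word)
  have mem: "Inr x \<in> {v \<in> V. a x \<in> vset a A v}" "Inr x \<in> {v \<in> V. a' x \<in> vset a' A' v}"
    if "x \<in> U" for x
    using that U by auto
  have win: "window r ?c (ipos (a x)) = window r ?c' (ipos (a' x))" if x: "x \<in> U" for x
  proof -
    let ?\<tau> = "window r ?c (ipos (a x))"
    let ?C = "{q \<in> dom ?c. window r ?c q = ?\<tau>}" and ?C' = "{q \<in> dom ?c'. window r ?c' q = ?\<tau>}"
    have "ipos (a x) \<in> ?C" using col(1) by (simp add: domIff)
    moreover have "finite ?C" by (rule finite_subset[of _ "dom ?c"]) auto
    ultimately have "card ?C > 0" by (subst card_gt_0_iff) blast
    moreover have "min t (card ?C) = min t (card ?C')"
      using cnt r by (simp add: same_counts_def)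
    ultimately have "card ?C' > 0" using t by linarith
    then have "?C' \<noteq> {}" by (metis card.empty less_irrefl)
    then obtain q where q: "window r ?c' q = ?\<tau>" by auto
    from window_eqD[OF q, of 0] have "?c' q = ?c (ipos (a x))" by (simp add: near_def)
    then have "Some {v \<in> V. a x \<in> vset a A v} = ?c' q" using col(1) by simp
    from colouring_word_pebble[OF this mem(1)[OF x]] q show ?thesis by simp
  qed
  have "ipos (a x) - ipos (a y) = ipos (a' x) - ipos (a' y)"
    if x: "x \<in> U" and y: "y \<in> U"
      and n: "near r (ipos (a x) - ipos (a y)) \<or> near r (ipos (a' x) - ipos (a' y))" for x y
    using n
  proof
    assume "near r (ipos (a x) - ipos (a y))"
    from window_eqD[OF win[OF y] this]
    have "Some {v \<in> V. a x \<in> vset a A v} = ?c' (ipos (a' y) + (ipos (a x) - ipos (a y)))"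
      using col(1) by simp
    from colouring_word_pebble[OF this mem(1)[OF x]] show ?thesis by (simp add: algebra_simps)
  next
    assume "near r (ipos (a' x) - ipos (a' y))"
    from window_eqD[OF win[OF y] this]
    have "Some {v \<in> V. a' x \<in> vset a' A' v} = ?c (ipos (a y) + (ipos (a' x) - ipos (a' y)))"
      using col(2) by simp
    from colouring_word_pebble[OF this mem(2)[OF x]] show ?thesis by (simp add: algebra_simps)
  qed
  with win show ?thesis
    unfolding pebbles_match_def comp_def by blast
qed

text \<open>The initial match is wanted at radius \<open>2 ^ qdepth f\<close>, which fixes
  \<open>R\<close>; \<open>t\<close> is one more than the number of cells that the pebbles can cover
  with squares of radius \<open>R\<close>.\<close>

lemma same_counts_imp_sat_iff:
  assumes f: "no_set_quant f" and v: "valid m n a A" "valid m n' a' A'"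
    and V: "V = Inl ` free_set f \<union> Inr ` fo_vars f" and R: "R = 2 ^ qdepth f"
    and t: "t = Suc (card (fo_vars f) * (2 * R + 1)\<^sup>2)"
    and cnt: "same_counts t R (colouring m V (word n a A)) (colouring m V (word n' a' A'))"
  shows "sat (grid m n) a A f \<longleftrightarrow> sat (grid m n') a' A' f"
proof (rule hanf[where W = "free_set f" and U = "fo_vars f" and j = "qdepth f", OF _ _ _ _ _ cnt])
  show "pebbles_match (fo_vars f) (2 ^ qdepth f) (colouring m V (word n a A)) (ipos \<circ> a)
    (colouring m V (word n' a' A')) (ipos \<circ> a')"
    by (rule same_counts_imp_pebbles_match[OF v _ _ cnt]) (auto simp: V t R)
next
  fix X p p'
  assume X: "X \<in> free_set f" and p: "p \<in> grid m n" "p' \<in> grid m n'"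
    and eq: "colouring m V (word n a A) (ipos p) = colouring m V (word n' a' A') (ipos p')"
  have "Inl X \<in> V" using X V by simp
  moreover have "{v \<in> V. p \<in> vset a A v} = {v \<in> V. p' \<in> vset a' A' v}"
    using eq p by (simp add: colouring_word)
  ultimately have "Inl X \<in> {v \<in> V. p \<in> vset a A v} \<longleftrightarrow> Inl X \<in> {v \<in> V. p' \<in> vset a' A' v}"
    "Inl X \<in> V" by simp_all
  then show "p \<in> A X \<longleftrightarrow> p' \<in> A' X" by simp
qed (use f v in \<open>simp_all add: dom_colouring t R valid_def\<close>)

section \<open>Residuals and a finite invariant of prefixes\<close>

definition residual :: "'b list set \<Rightarrow> 'b list \<Rightarrow> 'b list set" where
  "residual K u = {v. u @ v \<in> K}"

text \<open>Residuals are the states of the minimal deterministic automaton (Myhill-Nerode). An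
  invariant of prefixes that decides all continuations refines the Nerode congruence, so it has at
  least as many values as there are residuals.\<close>

lemma card_residual_le:
  assumes "\<And>u u' v. \<sigma> u = \<sigma> u' \<Longrightarrow> u @ v \<in> K \<longleftrightarrow> u' @ v \<in> K"
    and "range \<sigma> \<subseteq> S" "finite S" "card S \<le> N"
  shows "finite (range (residual K)) \<and> card (range (residual K)) \<le> N"
proof -
  define g where "g s = residual K (SOME u. \<sigma> u = s)" for s
  have "residual K u = g (\<sigma> u)" for u
    unfolding g_def residual_def using assms(1) someI[of "\<lambda>u'. \<sigma> u' = \<sigma> u" u] by blast
  then have sub: "range (residual K) \<subseteq> g ` S" using assms(2) by auto
  then have "card (range (residual K)) \<le> card S"
    using assms(3) by (meson card_image_le card_mono finite_imageI le_trans)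
  with sub assms show ?thesis by (meson finite_imageI finite_subset le_trans)
qed

text \<open>\<open>K\<close> is constrained on words of valid assignments only. Its behaviour on
  malformed words can be chosen so as to keep the number of residuals small.\<close>

definition dfa_bound :: "nat \<Rightarrow> nat \<Rightarrow> fm \<Rightarrow> bool" where
  "dfa_bound N m f \<longleftrightarrow> (\<exists>K. finite (range (residual K)) \<and> card (range (residual K)) \<le> N \<and>
     (\<forall>n a A. valid m n a A \<longrightarrow> (sat (grid m n) a A f \<longleftrightarrow> word n a A \<in> K)))"

text \<open>Windows around the last \<open>R\<close> columns may reach into the continuation, and
  they reach up to \<open>R\<close> columns further to the left: hence \<open>2 * R\<close>.\<close>

definition suffix_colours :: "nat \<Rightarrow> (nat + nat) set \<Rightarrow> nat \<Rightarrow> column list \<Rightarrow> (nat \<times> (nat + nat)) set list" where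
  "suffix_colours m V R u = map (\<lambda>l. {(i, v). i \<in> {1..m} \<and> v \<in> V \<and> i \<in> l v}) (drop (length u - 2 * R) u)"

definition window_types :: "'c set \<Rightarrow> nat \<Rightarrow> (int \<times> int \<Rightarrow> 'c set option) set" where
  "window_types V R = {\<tau>. dom \<tau> \<subseteq> {d. near R d} \<and> ran \<tau> \<subseteq> Pow V}"

text \<open>The windows of these positions do not extend beyond the last column of \<open>u\<close>,
  so a continuation leaves them unchanged.\<close>

definition inner_count :: "nat \<Rightarrow> (nat + nat) set \<Rightarrow> nat \<Rightarrow> column list \<Rightarrow> nat \<Rightarrow>
    (int \<times> int \<Rightarrow> (nat + nat) set option) \<Rightarrow> nat" where
  "inner_count m V R u r \<tau> = card {q \<in> dom (colouring m V u). snd q + int R \<le> int (length u) \<and>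
     window r (colouring m V u) q = \<tau>}"

lemma finite_window_types: "finite V \<Longrightarrow> finite (window_types V R)"
proof -
  assume "finite V"
  have "window_types V R \<subseteq> (\<Union>B\<in>Pow {d. near R d}. {\<tau>. dom \<tau> = B \<and> ran \<tau> \<subseteq> Pow V})"
    by (auto simp: window_types_def)
  moreover have "finite (\<Union>B\<in>Pow {d. near R d}. {\<tau>. dom \<tau> = B \<and> ran \<tau> \<subseteq> Pow V})"
    using \<open>finite V\<close> finite_near[of R]
    by (intro finite_UN_I finite_set_of_finite_maps) (auto intro: finite_subset)
  ultimately show ?thesis by (rule finite_subset)
qed

lemma window_in_window_types:
  "r \<le> R \<Longrightarrow> window r (colouring m V u) q \<in> window_types V R"
  by (cases q) (auto simp: window_types_def window_def near_def colouring_def dom_def ran_def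
      split: if_splits)

lemma colouring_suffix_eq:
  assumes suf: "suffix_colours m V R u = suffix_colours m V R u'"
    and j: "j > int (length u) - 2 * int R"
  shows "colouring m V (u @ v) (i, j) = colouring m V (u' @ v) (i, j + (int (length u') - int (length u)))"
proof -
  let ?\<delta> = "int (length u') - int (length u)"
  have len: "length u - (length u - 2 * R) = length u' - (length u' - 2 * R)"
    using arg_cong[OF suf, of length] by (simp add: suffix_colours_def)
  \<comment> \<open>Either both prefixes are long, or their lengths agree and the left border is
    seen at the same distance.\<close>
  then have or: "length u = length u' \<or> 2 * R \<le> length u \<and> 2 * R \<le> length u'" by linarith
  consider "j \<le> 0 \<or> j > int (length u + length v) \<or> i < 1 \<or> i > int m"
    | "1 \<le> j" "j \<le> int (length u)" "1 \<le> i" "i \<le> int m"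
    | "int (length u) < j" "j \<le> int (length u + length v)" "1 \<le> i" "i \<le> int m" by linarith
  then show ?thesis
  proof cases
    case 1
    then have "colouring m V (u @ v) (i, j) = None" by (auto simp: colouring_def)
    moreover have "j + ?\<delta> \<le> 0 \<or> j + ?\<delta> > int (length u' + length v) \<or> i < 1 \<or> i > int m"
      using 1 or j by auto
    then have "colouring m V (u' @ v) (i, j + ?\<delta>) = None" by (auto simp: colouring_def)
    ultimately show ?thesis by simp
  next
    case 2
    define e where "e = nat j - 1 - (length u - 2 * R)"
    have e: "nat j - 1 = length u - 2 * R + e" "nat (j + ?\<delta>) - 1 = length u' - 2 * R + e"
      and lt: "nat j - 1 < length u" "nat (j + ?\<delta>) - 1 < length u'" "1 \<le> j + ?\<delta>"
      using 2 or j by (auto simp: e_def)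
    have "e < length u - (length u - 2 * R)" "e < length u' - (length u' - 2 * R)"
      using e lt by linarith+
    then have *: "{(i, v). i \<in> {1..m} \<and> v \<in> V \<and> i \<in> (u ! (nat j - 1)) v} =
      {(i, v). i \<in> {1..m} \<and> v \<in> V \<and> i \<in> (u' ! (nat (j + ?\<delta>) - 1)) v}"
      using arg_cong[OF suf, of "\<lambda>xs. xs ! e"] unfolding e by (simp add: suffix_colours_def)
    have "{v \<in> V. i \<in> (u ! (nat j - 1)) v} = {v \<in> V. i \<in> (u' ! (nat (j + ?\<delta>) - 1)) v}"
      if "i \<in> {1..m}" for i
      using that arg_cong[OF *, of "\<lambda>S. {v. (i, v) \<in> S}"] by simp
    moreover have "nat i \<in> {1..m}" using 2 by auto
    ultimately show ?thesis
      using 2 lt by (auto simp: colouring_def nth_append)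
  next
    case 3
    then have "(u @ v) ! (nat j - 1) = (u' @ v) ! (nat (j + ?\<delta>) - 1)"
      by (auto simp: nth_append intro!: arg_cong[where f = "nth v"])
    with 3 show ?thesis by (auto simp: colouring_def)
  qed
qed

lemma card_outer_le:
  assumes suf: "suffix_colours m V R u = suffix_colours m V R u'" and r: "r \<le> R"
  shows "card {q \<in> dom (colouring m V (u @ v)). snd q + int R > int (length u) \<and> window r (colouring m V (u @ v)) q = \<tau>}
    \<le> card {q \<in> dom (colouring m V (u' @ v)). snd q + int R > int (length u') \<and> window r (colouring m V (u' @ v)) q = \<tau>}"
    (is "card ?B \<le> card ?B'")
proof (rule card_inj_on_le)
  let ?\<delta> = "(0, int (length u') - int (length u))"
  show "inj_on (\<lambda>q. q + ?\<delta>) ?B" by (rule inj_onI) (rule add_right_imp_eq)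
  show "finite ?B'" by (rule finite_subset[of _ "dom (colouring m V (u' @ v))"]) auto
  have "q + ?\<delta> \<in> ?B'" if q: "q \<in> ?B" for q
  proof -
    have eq: "colouring m V (u @ v) (q + d) = colouring m V (u' @ v) (q + ?\<delta> + d)" if "near r d" for d
    proof -
      have "snd q + snd d > int (length u) - 2 * int R"
        using q that r by (auto simp: near_def)
      from colouring_suffix_eq[OF suf this, of v "fst q + fst d"] show ?thesis
        by (cases q; cases d) (simp add: algebra_simps)
    qed
    have "window r (colouring m V (u' @ v)) (q + ?\<delta>) = window r (colouring m V (u @ v)) q"
      using eq by (auto simp: window_def near_def fun_eq_iff)
    moreover have "colouring m V (u' @ v) (q + ?\<delta>) = colouring m V (u @ v) q"
      using eq[of 0] by (simp add: near_def)
    ultimately show ?thesis using q by auto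
  qed
  then show "(\<lambda>q. q + ?\<delta>) ` ?B \<subseteq> ?B'" by blast
qed

text \<open>Positions are split at distance \<open>R\<close> before the cut. To the left of this
  line windows depend on the prefix alone and are counted up to \<open>t\<close>. To the right they
  see nothing but the stored suffix and the continuation, so translation by the difference of
  lengths is an exact matching.\<close>

lemma same_counts_append:
  assumes suf: "suffix_colours m V R u = suffix_colours m V R u'"
    and inner: "\<And>r \<tau>. r \<le> R \<Longrightarrow> \<tau> \<in> window_types V R \<Longrightarrow>
      min t (inner_count m V R u r \<tau>) = min t (inner_count m V R u' r \<tau>)"
  shows "same_counts t R (colouring m V (u @ v)) (colouring m V (u' @ v))"
  unfolding same_counts_def
proof (intro allI impI)
  fix r :: nat and \<tau> assume r: "r \<le> R"
  let ?c = "\<lambda>u. colouring m V (u @ v)"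
  let ?B = "\<lambda>u. {q \<in> dom (?c u). snd q + int R > int (length u) \<and> window r (?c u) q = \<tau>}"
  have split: "card {q \<in> dom (?c u). window r (?c u) q = \<tau>} = inner_count m V R u r \<tau> + card (?B u)" for u
  proof -
    let ?A = "{q \<in> dom (?c u). snd q + int R \<le> int (length u) \<and> window r (?c u) q = \<tau>}"
    let ?A' = "{q \<in> dom (colouring m V u). snd q + int R \<le> int (length u) \<and> window r (colouring m V u) q = \<tau>}"
    have eq: "?c u (i, j) = colouring m V u (i, j)" if "j \<le> int (length u)" for i j
      using that by (auto simp: colouring_def nth_append)
    have "window r (?c u) q = window r (colouring m V u) q" "?c u q = colouring m V u q"
      if q: "snd q + int R \<le> int (length u)" for q
    proof -
      have *: "?c u (q + d) = colouring m V u (q + d)" if "near r d" for d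
        using that q r eq[of "snd q + snd d" "fst q + fst d"] by (auto simp: near_def plus_prod_def)
      then show "window r (?c u) q = window r (colouring m V u) q"
        by (auto simp: window_def near_def fun_eq_iff)
      show "?c u q = colouring m V u q" using *[of 0] by (simp add: near_def)
    qed
    then have A: "?A = ?A'" by (auto simp: dom_def)
    have "{q \<in> dom (?c u). window r (?c u) q = \<tau>} = ?A \<union> ?B u" by auto
    moreover have "finite ?A" "finite (?B u)"
      by (rule finite_subset[of _ "dom (?c u)"], auto)+
    moreover have "?A \<inter> ?B u = {}" by auto
    ultimately have "card {q \<in> dom (?c u). window r (?c u) q = \<tau>} = card ?A + card (?B u)"
      by (metis (no_types, lifting) card_Un_disjoint)
    then show ?thesis unfolding A inner_count_def .
  qed
  have "min t (inner_count m V R u r \<tau>) = min t (inner_count m V R u' r \<tau>)"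
  proof (cases "\<tau> \<in> window_types V R")
    case False
    then have "inner_count m V R u r \<tau> = 0" for u
      using window_in_window_types[OF r] by (auto simp: inner_count_def)
    then show ?thesis by simp
  qed (use inner r in simp)
  moreover have "card (?B u) = card (?B u')"
    using card_outer_le[OF suf r] card_outer_le[OF suf[symmetric] r] by (rule antisym)
  ultimately show "min t (card {q \<in> dom (?c u). window r (?c u) q = \<tau>}) =
      min t (card {q \<in> dom (?c u'). window r (?c u') q = \<tau>})"
    unfolding split by linarith
qed

text \<open>The height enters only through the stored suffix, at most \<open>2 * R\<close> columns
  of \<open>m * card V\<close> bits each. The vector of truncated counts ranges over
  \<open>E\<close>, which depends on the formula alone.\<close>

lemma no_set_quant_dfa_bound:
  assumes f: "no_set_quant f"
  shows "\<exists>C. \<forall>m\<ge>1. dfa_bound (2 ^ (C * m)) m f"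
proof -
  define V where "V = (Inl ` free_set f \<union> Inr ` fo_vars f :: (nat + nat) set)"
  define R :: nat where "R = 2 ^ qdepth f"
  define t where "t = Suc (card (fo_vars f) * (2 * R + 1)\<^sup>2)"
  define E where "E = ({..R} \<times> window_types V R \<rightarrow>\<^sub>E {..t})"
  \<comment> \<open>The three summands pay for the length of the suffix, for its bits and for the
    count vector.\<close>
  define C where "C = 2 * R + (2 * R * card V + card E)"
  have finV: "finite V" by (simp add: V_def)
  then have finE: "finite E" by (auto simp: E_def intro!: finite_PiE finite_window_types)
  have "dfa_bound (2 ^ (C * m)) m f" if m: "m \<ge> 1" for m
  proof -
    define cnt where "cnt u = (\<lambda>(r, \<tau>)\<in>{..R} \<times> window_types V R. min t (inner_count m V R u r \<tau>))" for u
    define \<sigma> where "\<sigma> u = (suffix_colours m V R u, cnt u)" for u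
    define P where "P = Pow ({1..m} \<times> V)"
    define S where "S = {xs. set xs \<subseteq> P \<and> length xs \<le> 2 * R} \<times> E"
    have finP: "finite P" using finV by (simp add: P_def)
    \<comment> \<open>Exchanging a prefix can turn the word of a structure into a word of no structure, since
      pebbles may get lost; closing \<open>K\<close> under equality of counts makes it respect \<open>\<sigma>\<close> nevertheless.\<close>
    define K where "K = {w. \<exists>n a A. valid m n a A \<and> sat (grid m n) a A f \<and>
      same_counts t R (colouring m V (word n a A)) (colouring m V w)}"
    have trans: "same_counts t R c1 c3" if "same_counts t R c1 c2" "same_counts t R c2 c3"
      for c1 c2 c3 :: "int \<times> int \<Rightarrow> (nat + nat) set option"
      using that by (simp add: same_counts_def)
    have "u @ v \<in> K \<longleftrightarrow> u' @ v \<in> K" if eq: "\<sigma> u = \<sigma> u'" for u u' v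
    proof -
      have "min t (inner_count m V R u r \<tau>) = min t (inner_count m V R u' r \<tau>)"
        if "r \<le> R" "\<tau> \<in> window_types V R" for r \<tau>
      proof -
        have "cnt u (r, \<tau>) = cnt u' (r, \<tau>)" using eq by (simp add: \<sigma>_def)
        then show ?thesis using that by (simp add: cnt_def)
      qed
      then have "same_counts t R (colouring m V (u @ v)) (colouring m V (u' @ v))"
        using eq by (intro same_counts_append) (auto simp: \<sigma>_def)
      then show ?thesis unfolding K_def using trans same_counts_sym by blast
    qed
    moreover have "range \<sigma> \<subseteq> S"
    proof -
      have "suffix_colours m V R u \<in> {xs. set xs \<subseteq> P \<and> length xs \<le> 2 * R}" for u
        by (auto simp: suffix_colours_def P_def)
      moreover have "cnt u \<in> E" for u
        by (auto simp: cnt_def E_def)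
      ultimately show ?thesis by (auto simp: \<sigma>_def S_def)
    qed
    moreover have "finite S"
      using finP finE by (auto simp: S_def intro: finite_lists_length_le)
    moreover have "card S \<le> 2 ^ (C * m)"
    proof -
      have P: "card P = 2 ^ (m * card V)" using finV by (simp add: P_def card_Pow card_cartesian_product)
      have "card {xs. set xs \<subseteq> P \<and> length xs \<le> 2 * R} = (\<Sum>i\<le>2 * R. card P ^ i)"
        by (rule card_lists_length_le[OF finP])
      also have "\<dots> \<le> (\<Sum>i\<le>2 * R. card P ^ (2 * R))"
        by (intro sum_mono power_increasing) (simp_all add: P)
      also have "\<dots> = (2 * R + 1) * 2 ^ (2 * R * card V * m)"
        by (simp add: P power_mult[symmetric] mult_ac)
      also have "\<dots> \<le> 2 ^ (2 * R * m) * 2 ^ (2 * R * card V * m)"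
      proof (rule mult_le_mono1)
        have "2 * R + 1 \<le> 2 ^ (2 * R)" using less_exp[of "2 * R"] by linarith
        also have "\<dots> \<le> 2 ^ (2 * R * m)" using m by (intro power_increasing) auto
        finally show "2 * R + 1 \<le> 2 ^ (2 * R * m)" .
      qed
      finally have "card S \<le> 2 ^ (2 * R * m) * 2 ^ (2 * R * card V * m) * card E"
        by (simp add: S_def card_cartesian_product)
      also have "card E \<le> 2 ^ (card E * m)"
      proof -
        have "card E \<le> 2 ^ card E" by (rule less_imp_le[OF less_exp])
        also have "\<dots> \<le> 2 ^ (card E * m)" using m by (intro power_increasing) auto
        finally show ?thesis .
      qed
      finally show ?thesis by (simp add: C_def power_add[symmetric] algebra_simps)
    qed
    ultimately have "finite (range (residual K)) \<and> card (range (residual K)) \<le> 2 ^ (C * m)"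
      by (rule card_residual_le)
    moreover have "sat (grid m n) a A f \<longleftrightarrow> word n a A \<in> K" if v: "valid m n a A" for n a A
    proof
      assume "sat (grid m n) a A f"
      moreover have "same_counts t R (colouring m V (word n a A)) (colouring m V (word n a A))"
        by (simp add: same_counts_def)
      ultimately show "word n a A \<in> K" using v unfolding K_def by blast
    next
      assume "word n a A \<in> K"
      then obtain n' a' A' where s: "valid m n' a' A'" "sat (grid m n') a' A' f"
        "same_counts t R (colouring m V (word n' a' A')) (colouring m V (word n a A))"
        unfolding K_def by blast
      from same_counts_imp_sat_iff[OF f s(1) v V_def R_def t_def s(3)] s(2)
      show "sat (grid m n) a A f" by simp
    qed
    ultimately show ?thesis unfolding dfa_bound_def by blast
  qed
  then show ?thesis by blast
qed

section \<open>Automata for the levels of the hierarchy\<close>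

text \<open>Over the empty attribute set the picture fixes no set variable, so equivalence on
  pictures covers every valid assignment on a grid.\<close>

lemma sat_cong_equiv:
  assumes eq: "fm_equiv f g" and v: "valid m n a A"
  shows "sat (grid m n) a A f \<longleftrightarrow> sat (grid m n) a A g"
proof -
  \<comment> \<open>The constant function \<open>undefined\<close> is the only letter over the empty
    attribute set.\<close>
  define p :: picture where "p = mat m n (\<lambda>_. \<lambda>_. undefined)"
  have "a 0 \<in> grid m n" using v by (simp add: valid_def)
  then have "m \<ge> 1" "n \<ge> 1" by (auto simp: grid_def)
  then have "p \<in> pictures {}"
    by (auto simp: p_def pictures_def alphabet_def elements_mat_def)
  moreover have dom: "pdom p = grid m n" by (simp add: pdom_def grid_def p_def)
  then have "(a, A) \<in> assignments p" using v by (simp add: assignments_def valid_def)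
  ultimately have "pic_sat {} p a A f \<longleftrightarrow> pic_sat {} p a A g"
    using eq unfolding fm_equiv_def by blast
  then show ?thesis by (simp add: pic_sat_def dom)
qed

lemma dfa_boundE:
  assumes "dfa_bound N m f"
  obtains K where "finite (range (residual K))" "card (range (residual K)) \<le> N"
    "\<And>n a A. valid m n a A \<Longrightarrow> sat (grid m n) a A f \<longleftrightarrow> word n a A \<in> K"
  using assms unfolding dfa_bound_def by blast

lemma dfa_boundI:
  assumes "finite (range (residual K))" "card (range (residual K)) \<le> N"
    "\<And>n a A. valid m n a A \<Longrightarrow> sat (grid m n) a A f \<longleftrightarrow> word n a A \<in> K"
  shows "dfa_bound N m f"
  using assms unfolding dfa_bound_def by blast

lemma dfa_bound_mono:
  assumes "dfa_bound N m f" "N \<le> N'"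
  shows "dfa_bound N' m f"
proof -
  obtain K where "finite (range (residual K))" "card (range (residual K)) \<le> N"
    "\<And>n a A. valid m n a A \<Longrightarrow> sat (grid m n) a A f \<longleftrightarrow> word n a A \<in> K"
    using dfa_boundE[OF assms(1)] by blast
  with assms(2) show ?thesis by (intro dfa_boundI[of K]) simp_all
qed

lemma dfa_bound_equiv:
  assumes "dfa_bound N m g" "fm_equiv f g"
  shows "dfa_bound N m f"
proof -
  obtain K where "finite (range (residual K))" "card (range (residual K)) \<le> N"
    "\<And>n a A. valid m n a A \<Longrightarrow> sat (grid m n) a A g \<longleftrightarrow> word n a A \<in> K"
    using dfa_boundE[OF assms(1)] by blast
  with sat_cong_equiv[OF assms(2)] show ?thesis by (intro dfa_boundI[of K]) simp_all
qed

lemma residual_append: "residual K u = residual K u' \<Longrightarrow> u @ v \<in> K \<longleftrightarrow> u' @ v \<in> K"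
  by (auto simp: residual_def)

lemma dfa_bound_comb:
  assumes f: "dfa_bound N m f" and g: "dfa_bound N' m g"
    and h: "\<And>n a A. sat (grid m n) a A h \<longleftrightarrow> b (sat (grid m n) a A f) (sat (grid m n) a A g)"
  shows "dfa_bound (N * N') m h"
proof -
  obtain K where K: "finite (range (residual K))" "card (range (residual K)) \<le> N"
    "\<And>n a A. valid m n a A \<Longrightarrow> sat (grid m n) a A f \<longleftrightarrow> word n a A \<in> K"
    using dfa_boundE[OF f] by blast
  obtain L where L: "finite (range (residual L))" "card (range (residual L)) \<le> N'"
    "\<And>n a A. valid m n a A \<Longrightarrow> sat (grid m n) a A g \<longleftrightarrow> word n a A \<in> L"
    using dfa_boundE[OF g] by blast
  define M where "M = {w. b (w \<in> K) (w \<in> L)}"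
  have "finite (range (residual M)) \<and> card (range (residual M)) \<le> N * N'"
  proof (rule card_residual_le)
    show "u @ v \<in> M \<longleftrightarrow> u' @ v \<in> M"
      if "(residual K u, residual L u) = (residual K u', residual L u')" for u u' v
      using that residual_append[of K u u' v] residual_append[of L u u' v] by (simp add: M_def)
    show "range (\<lambda>u. (residual K u, residual L u)) \<subseteq> range (residual K) \<times> range (residual L)"
      by auto
  qed (use K L in \<open>simp_all add: card_cartesian_product mult_le_mono\<close>)
  then show ?thesis
    using K(3) L(3) h by (intro dfa_boundI[of M]) (simp_all add: M_def)
qed

lemma dfa_bound_Neg: "dfa_bound N m f \<Longrightarrow> dfa_bound N m (Neg f)"
proof -
  assume f: "dfa_bound N m f"
  obtain K where K: "finite (range (residual K))" "card (range (residual K)) \<le> N"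
    "\<And>n a A. valid m n a A \<Longrightarrow> sat (grid m n) a A f \<longleftrightarrow> word n a A \<in> K"
    using dfa_boundE[OF f] by blast
  have "finite (range (residual (- K))) \<and> card (range (residual (- K))) \<le> N"
  proof (rule card_residual_le[OF _ subset_refl])
    show "u @ v \<in> - K \<longleftrightarrow> u' @ v \<in> - K" if "residual K u = residual K u'" for u u' v
      using residual_append[OF that] by simp
  qed (fact K)+
  then show ?thesis
    using K(3) by (intro dfa_boundI[of "- K"]) simp_all
qed

section \<open>Nondeterministic automata and projection\<close>

primrec run_rel :: "('l \<Rightarrow> ('s \<times> 's) set) \<Rightarrow> 'l list \<Rightarrow> ('s \<times> 's) set" where
  "run_rel \<delta> [] = Id"
| "run_rel \<delta> (l # w) = \<delta> l O run_rel \<delta> w"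

lemma run_rel_append: "run_rel \<delta> (u @ v) = run_rel \<delta> u O run_rel \<delta> v"
  by (induction u) auto

text \<open>States are numbers because a definition cannot quantify over a type of states;
  \<open>nfa_boundI\<close> imports automata with other state types.\<close>

definition nfa_bound :: "nat \<Rightarrow> nat \<Rightarrow> fm \<Rightarrow> bool" where
  "nfa_bound N m f \<longleftrightarrow> (\<exists>\<delta> I F. (\<forall>l. \<delta> l \<subseteq> {..<N} \<times> {..<N}) \<and> I \<subseteq> {..<N} \<and>
     (\<forall>n a A. valid m n a A \<longrightarrow>
        (sat (grid m n) a A f \<longleftrightarrow> (\<exists>p\<in>I. \<exists>q\<in>F. (p, q) \<in> run_rel \<delta> (word n a A)))))"

lemma nfa_boundE:
  assumes "nfa_bound N m f"
  obtains \<delta> I F where "\<And>l. \<delta> l \<subseteq> {..<N} \<times> {..<N}" "I \<subseteq> {..<N}"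
    "\<And>n a A. valid m n a A \<Longrightarrow>
      sat (grid m n) a A f \<longleftrightarrow> (\<exists>p\<in>I. \<exists>q\<in>F. (p, q) \<in> run_rel \<delta> (word n a A))"
  using assms unfolding nfa_bound_def by blast

lemma nfa_boundI:
  fixes Q :: "'s set"
  assumes Q: "finite Q" "card Q \<le> N" and \<delta>: "\<And>l. \<delta> l \<subseteq> Q \<times> Q" and I: "I \<subseteq> Q"
    and f: "\<And>n a A. valid m n a A \<Longrightarrow>
      sat (grid m n) a A f \<longleftrightarrow> (\<exists>p\<in>I. \<exists>q\<in>F. (p, q) \<in> run_rel \<delta> (word n a A))"
  shows "nfa_bound N m f"
proof -
  obtain h :: "'s \<Rightarrow> nat" where inj: "inj_on h Q" and h: "h ` Q \<subseteq> {..<N}"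
    using Q by (metis card_lessThan card_le_inj finite_lessThan)
  define \<delta>' where "\<delta>' l = map_prod h h ` \<delta> l" for l
  have fwd: "(p, q) \<in> run_rel \<delta> w \<Longrightarrow> p \<in> Q \<Longrightarrow> (h p, h q) \<in> run_rel \<delta>' w \<and> q \<in> Q" for p q w
  proof (induction w arbitrary: p)
    case (Cons l w)
    then obtain r where r: "(p, r) \<in> \<delta> l" "(r, q) \<in> run_rel \<delta> w" by auto
    then have "(h p, h r) \<in> \<delta>' l" by (auto simp: \<delta>'_def intro!: image_eqI[of _ _ "(p, r)"])
    with Cons.IH[OF r(2)] r \<delta>[of l] show ?case by auto
  qed simp
  have bwd: "(h p, y) \<in> run_rel \<delta>' w \<Longrightarrow> p \<in> Q \<Longrightarrow> \<exists>q\<in>Q. y = h q \<and> (p, q) \<in> run_rel \<delta> w" for p y w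
  proof (induction w arbitrary: p)
    case (Cons l w)
    then obtain z where z: "(h p, z) \<in> \<delta>' l" "(z, y) \<in> run_rel \<delta>' w" by auto
    then obtain p' r where r: "(p', r) \<in> \<delta> l" "h p = h p'" "z = h r"
      by (auto simp: \<delta>'_def)
    then have "p' = p" "r \<in> Q" using \<delta>[of l] inj Cons.prems(2) by (auto dest: inj_onD)
    from Cons.IH[of r] z(2) \<open>z = h r\<close> \<open>r \<in> Q\<close> obtain q
      where "q \<in> Q" "y = h q" "(r, q) \<in> run_rel \<delta> w" by blast
    with r(1) \<open>p' = p\<close> show ?case by auto
  qed auto
  \<comment> \<open>\<open>h\<close> is injective on \<open>Q\<close> only. Intersecting with
    \<open>Q\<close> discards final states that no run from \<open>I\<close> can reach but whose
    names might clash.\<close>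
  have acc: "(\<exists>p\<in>h ` I. \<exists>q\<in>h ` (F \<inter> Q). (p, q) \<in> run_rel \<delta>' w) \<longleftrightarrow>
      (\<exists>p\<in>I. \<exists>q\<in>F. (p, q) \<in> run_rel \<delta> w)" for w
  proof
    assume "\<exists>p\<in>h ` I. \<exists>q\<in>h ` (F \<inter> Q). (p, q) \<in> run_rel \<delta>' w"
    then obtain p q where pq: "p \<in> I" "q \<in> F" "q \<in> Q" "(h p, h q) \<in> run_rel \<delta>' w" by blast
    from bwd[OF pq(4)] pq I obtain q' where "q' \<in> Q" "h q = h q'" "(p, q') \<in> run_rel \<delta> w" by blast
    with pq inj show "\<exists>p\<in>I. \<exists>q\<in>F. (p, q) \<in> run_rel \<delta> w" by (metis inj_onD)
  next
    assume "\<exists>p\<in>I. \<exists>q\<in>F. (p, q) \<in> run_rel \<delta> w"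
    then show "\<exists>p\<in>h ` I. \<exists>q\<in>h ` (F \<inter> Q). (p, q) \<in> run_rel \<delta>' w"
      using fwd I by blast
  qed
  have "\<delta>' l \<subseteq> {..<N} \<times> {..<N}" for l
    using \<delta>[of l] h by (auto simp: \<delta>'_def)
  moreover have "h ` I \<subseteq> {..<N}" using h I by blast
  ultimately show ?thesis
    unfolding nfa_bound_def using f acc by (intro exI[of _ \<delta>'] exI[of _ "h ` I"] exI[of _ "h ` (F \<inter> Q)"]) simp
qed

lemma nfa_bound_mono:
  assumes "nfa_bound N m f" "N \<le> N'"
  shows "nfa_bound N' m f"
proof -
  from assms(1) obtain \<delta> I F where "\<And>l. \<delta> l \<subseteq> {..<N} \<times> {..<N}" "I \<subseteq> {..<N}"
    "\<And>n a A. valid m n a A \<Longrightarrow>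
      sat (grid m n) a A f \<longleftrightarrow> (\<exists>p\<in>I. \<exists>q\<in>F. (p, q) \<in> run_rel \<delta> (word n a A))"
    by (rule nfa_boundE) blast
  with assms(2) show ?thesis by (intro nfa_boundI[of "{..<N}" N' \<delta> I m f F]) auto
qed

lemma nfa_bound_equiv:
  assumes "nfa_bound N m g" "fm_equiv f g"
  shows "nfa_bound N m f"
proof -
  from assms(1) obtain \<delta> I F where "\<And>l. \<delta> l \<subseteq> {..<N} \<times> {..<N}" "I \<subseteq> {..<N}"
    "\<And>n a A. valid m n a A \<Longrightarrow>
      sat (grid m n) a A g \<longleftrightarrow> (\<exists>p\<in>I. \<exists>q\<in>F. (p, q) \<in> run_rel \<delta> (word n a A))"
    by (rule nfa_boundE) blast
  with sat_cong_equiv[OF assms(2)] show ?thesis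
    by (intro nfa_boundI[of "{..<N}" N \<delta> I m f F]) simp_all
qed

text \<open>The states are the residuals, and reading a letter extends a representative word;
  \<open>det\<close> shows that the choice of the representative does not matter.\<close>

lemma dfa_bound_imp_nfa_bound:
  assumes "dfa_bound N m f"
  shows "nfa_bound N m f"
proof -
  obtain K where K: "finite (range (residual K))" "card (range (residual K)) \<le> N"
    "\<And>n a A. valid m n a A \<Longrightarrow> sat (grid m n) a A f \<longleftrightarrow> word n a A \<in> K"
    using dfa_boundE[OF assms] by blast
  define \<delta> where "\<delta> l = {(residual K u, residual K (u @ [l])) | u. True}" for l
  have det: "residual K u = residual K u' \<Longrightarrow> residual K (u @ w) = residual K (u' @ w)" for u u' w
    using residual_append[of K u u'] by (auto simp: residual_def)
  have run: "(residual K u, s) \<in> run_rel \<delta> w \<longleftrightarrow> s = residual K (u @ w)" for u s w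
  proof (induction w arbitrary: u)
    case (Cons l w)
    have "(residual K u, r) \<in> \<delta> l \<longleftrightarrow> r = residual K (u @ [l])" for r
      unfolding \<delta>_def using det[of u _ "[l]"] by blast
    then have "(residual K u, s) \<in> run_rel \<delta> (l # w) \<longleftrightarrow> (residual K (u @ [l]), s) \<in> run_rel \<delta> w"
      by auto
    with Cons.IH show ?case by simp
  qed auto
  show ?thesis
  proof (rule nfa_boundI[OF K(1,2)])
    show "\<delta> l \<subseteq> range (residual K) \<times> range (residual K)" for l by (auto simp: \<delta>_def)
    show "{residual K []} \<subseteq> range (residual K)" by simp
    show "sat (grid m n) a A f \<longleftrightarrow>
      (\<exists>p\<in>{residual K []}. \<exists>q\<in>{r. [] \<in> r}. (p, q) \<in> run_rel \<delta> (word n a A))"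
      if "valid m n a A" for n a A
      using K(3)[OF that] by (simp add: run) (simp add: residual_def)
  qed
qed

text \<open>Subset construction: the set of states reachable by a prefix decides all its
  continuations.\<close>

lemma nfa_bound_imp_dfa_bound:
  assumes "nfa_bound N m f"
  shows "dfa_bound (2 ^ N) m f"
proof -
  from assms obtain \<delta> I F where \<delta>: "\<And>l. \<delta> l \<subseteq> {..<N} \<times> {..<N}" and I: "I \<subseteq> {..<N}" and
    f: "\<And>n a A. valid m n a A \<Longrightarrow>
      sat (grid m n) a A f \<longleftrightarrow> (\<exists>p\<in>I. \<exists>q\<in>F. (p, q) \<in> run_rel \<delta> (word n a A))"
    by (rule nfa_boundE) blast
  define K where "K = {w. \<exists>p\<in>I. \<exists>q\<in>F. (p, q) \<in> run_rel \<delta> w}"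
  have sub: "run_rel \<delta> w `` I \<subseteq> {..<N}" for w
    using I
  proof (induction w arbitrary: I)
    case (Cons l w)
    have "\<delta> l `` I \<subseteq> {..<N}" using \<delta>[of l] by auto
    from Cons.IH[OF this] show ?case by (simp add: relcomp_Image)
  qed auto
  have "finite (range (residual K)) \<and> card (range (residual K)) \<le> 2 ^ N"
  proof (rule card_residual_le)
    show "u @ v \<in> K \<longleftrightarrow> u' @ v \<in> K" if "run_rel \<delta> u `` I = run_rel \<delta> u' `` I" for u u' v
    proof -
      have "w \<in> K \<longleftrightarrow> (\<exists>q\<in>F. q \<in> run_rel \<delta> w `` I)" for w by (auto simp: K_def)
      with that show ?thesis by (simp add: run_rel_append relcomp_Image)
    qed
    show "range (\<lambda>u. run_rel \<delta> u `` I) \<subseteq> Pow {..<N}" using sub by auto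
  qed (simp_all add: card_Pow)
  then show ?thesis using f by (intro dfa_boundI[of K]) (simp_all add: K_def)
qed

lemma nfa_bound_Conj:
  assumes f: "nfa_bound N m f" and g: "nfa_bound N' m g"
  shows "nfa_bound (N * N') m (Conj f g)"
proof -
  from f obtain \<delta> I F where 1: "\<And>l. \<delta> l \<subseteq> {..<N} \<times> {..<N}" "I \<subseteq> {..<N}"
    "\<And>n a A. valid m n a A \<Longrightarrow>
      sat (grid m n) a A f \<longleftrightarrow> (\<exists>p\<in>I. \<exists>q\<in>F. (p, q) \<in> run_rel \<delta> (word n a A))"
    by (rule nfa_boundE) blast
  from g obtain \<delta>' I' F' where 2: "\<And>l. \<delta>' l \<subseteq> {..<N'} \<times> {..<N'}" "I' \<subseteq> {..<N'}"
    "\<And>n a A. valid m n a A \<Longrightarrow>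
      sat (grid m n) a A g \<longleftrightarrow> (\<exists>p\<in>I'. \<exists>q\<in>F'. (p, q) \<in> run_rel \<delta>' (word n a A))"
    by (rule nfa_boundE) blast
  define \<delta>2 where "\<delta>2 l = {((p, p'), (q, q')). (p, q) \<in> \<delta> l \<and> (p', q') \<in> \<delta>' l}" for l
  have run: "((p, p'), (q, q')) \<in> run_rel \<delta>2 w \<longleftrightarrow> (p, q) \<in> run_rel \<delta> w \<and> (p', q') \<in> run_rel \<delta>' w" for p p' q q' w
  proof (induction w arbitrary: p p')
    case (Cons l w)
    have "((p, p'), (q, q')) \<in> run_rel \<delta>2 (l # w) \<longleftrightarrow>
      (\<exists>r r'. (p, r) \<in> \<delta> l \<and> (p', r') \<in> \<delta>' l \<and> ((r, r'), (q, q')) \<in> run_rel \<delta>2 w)"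
      by (auto simp: \<delta>2_def)
    then show ?case unfolding Cons.IH by auto
  qed auto
  show ?thesis
  proof (rule nfa_boundI[where Q = "{..<N} \<times> {..<N'}" and \<delta> = \<delta>2 and I = "I \<times> I'" and F = "F \<times> F'"])
    show "\<delta>2 l \<subseteq> ({..<N} \<times> {..<N'}) \<times> ({..<N} \<times> {..<N'})" for l
      using 1(1)[of l] 2(1)[of l] by (auto simp: \<delta>2_def)
    show "I \<times> I' \<subseteq> {..<N} \<times> {..<N'}" using 1(2) 2(2) by auto
    show "sat (grid m n) a A (Conj f g) \<longleftrightarrow>
      (\<exists>p\<in>I \<times> I'. \<exists>q\<in>F \<times> F'. (p, q) \<in> run_rel \<delta>2 (word n a A))" if "valid m n a A" for n a A
      using 1(3)[OF that] 2(3)[OF that] by (auto simp: run)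
  qed (simp_all add: card_cartesian_product)
qed

lemma nfa_bound_Disj:
  assumes f: "nfa_bound N m f" and g: "nfa_bound N' m g"
  shows "nfa_bound (N + N') m (Disj f g)"
proof -
  from f obtain \<delta> I F where 1: "\<And>l. \<delta> l \<subseteq> {..<N} \<times> {..<N}" "I \<subseteq> {..<N}"
    "\<And>n a A. valid m n a A \<Longrightarrow>
      sat (grid m n) a A f \<longleftrightarrow> (\<exists>p\<in>I. \<exists>q\<in>F. (p, q) \<in> run_rel \<delta> (word n a A))"
    by (rule nfa_boundE) blast
  from g obtain \<delta>' I' F' where 2: "\<And>l. \<delta>' l \<subseteq> {..<N'} \<times> {..<N'}" "I' \<subseteq> {..<N'}"
    "\<And>n a A. valid m n a A \<Longrightarrow>
      sat (grid m n) a A g \<longleftrightarrow> (\<exists>p\<in>I'. \<exists>q\<in>F'. (p, q) \<in> run_rel \<delta>' (word n a A))"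
    by (rule nfa_boundE) blast
  define \<delta>2 where "\<delta>2 l = map_prod Inl Inl ` \<delta> l \<union> map_prod Inr Inr ` \<delta>' l" for l
  have runl: "(Inl p, z) \<in> run_rel \<delta>2 w \<longleftrightarrow> (\<exists>q. z = Inl q \<and> (p, q) \<in> run_rel \<delta> w)" for p z w
  proof (induction w arbitrary: p)
    case (Cons l w)
    have "(Inl p, y) \<in> \<delta>2 l \<longleftrightarrow> (\<exists>q. y = Inl q \<and> (p, q) \<in> \<delta> l)" for y by (auto simp: \<delta>2_def)
    then have "(Inl p, z) \<in> run_rel \<delta>2 (l # w) \<longleftrightarrow> (\<exists>r. (p, r) \<in> \<delta> l \<and> (Inl r, z) \<in> run_rel \<delta>2 w)"
      by auto
    then show ?case unfolding Cons.IH by auto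
  qed auto
  have runr: "(Inr p, z) \<in> run_rel \<delta>2 w \<longleftrightarrow> (\<exists>q. z = Inr q \<and> (p, q) \<in> run_rel \<delta>' w)" for p z w
  proof (induction w arbitrary: p)
    case (Cons l w)
    have "(Inr p, y) \<in> \<delta>2 l \<longleftrightarrow> (\<exists>q. y = Inr q \<and> (p, q) \<in> \<delta>' l)" for y by (auto simp: \<delta>2_def)
    then have "(Inr p, z) \<in> run_rel \<delta>2 (l # w) \<longleftrightarrow> (\<exists>r. (p, r) \<in> \<delta>' l \<and> (Inr r, z) \<in> run_rel \<delta>2 w)"
      by auto
    then show ?case unfolding Cons.IH by auto
  qed auto
  show ?thesis
  proof (rule nfa_boundI[where Q = "{..<N} <+> {..<N'}" and \<delta> = \<delta>2 and I = "I <+> I'" and F = "F <+> F'"])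
    show "\<delta>2 l \<subseteq> ({..<N} <+> {..<N'}) \<times> ({..<N} <+> {..<N'})" for l
      using 1(1)[of l] 2(1)[of l] by (auto simp: \<delta>2_def)
    show "I <+> I' \<subseteq> {..<N} <+> {..<N'}" using 1(2) 2(2) by auto
    show "sat (grid m n) a A (Disj f g) \<longleftrightarrow>
      (\<exists>p\<in>I <+> I'. \<exists>q\<in>F <+> F'. (p, q) \<in> run_rel \<delta>2 (word n a A))" if "valid m n a A" for n a A
      using 1(3)[OF that] 2(3)[OF that] by (auto simp: Plus_def bex_Un runl runr)
  qed (simp_all add: card_Plus)
qed

lemma run_rel_project:
  "(p, q) \<in> run_rel (\<lambda>l. \<Union>M\<in>S. \<delta> (h l M)) w \<longleftrightarrow>
    (\<exists>Ms. length Ms = length w \<and> set Ms \<subseteq> S \<and> (p, q) \<in> run_rel \<delta> (map2 h w Ms))"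
proof (induction w arbitrary: p)
  case (Cons l w)
  show ?case (is "?L \<longleftrightarrow> ?R")
  proof
    assume ?L
    then obtain M r where M: "M \<in> S" "(p, r) \<in> \<delta> (h l M)"
      and "(r, q) \<in> run_rel (\<lambda>l. \<Union>M\<in>S. \<delta> (h l M)) w" by auto
    with Cons.IH obtain Ms where "length Ms = length w" "set Ms \<subseteq> S" "(r, q) \<in> run_rel \<delta> (map2 h w Ms)"
      by blast
    with M show ?R by (intro exI[of _ "M # Ms"]) auto
  next
    assume ?R
    then obtain Ns where Ns: "length Ns = Suc (length w)" "set Ns \<subseteq> S"
      "(p, q) \<in> run_rel \<delta> (map2 h (l # w) Ns)" by auto
    then obtain M Ms where M: "Ns = M # Ms" by (cases Ns) auto
    with Ns obtain r where r: "(p, r) \<in> \<delta> (h l M)" "(r, q) \<in> run_rel \<delta> (map2 h w Ms)" by auto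
    have "\<exists>Ms. length Ms = length w \<and> set Ms \<subseteq> S \<and> (r, q) \<in> run_rel \<delta> (map2 h w Ms)"
      using Ns M r by (intro exI[of _ Ms]) auto
    with Cons.IH have "(r, q) \<in> run_rel (\<lambda>l. \<Union>M\<in>S. \<delta> (h l M)) w" by blast
    with r M Ns show ?L by auto
  qed
qed auto

lemma vset_upd: "vset a (A(X := M)) = (vset a A)(Inl X := M)"
  by (rule ext) (simp add: vset_def split: sum.split)

lemma word_upd:
  "word n a (A(X := M)) =
    map2 (\<lambda>l M. l(Inl X := M)) (word n a A) (map (\<lambda>j. {i. (i, Suc j) \<in> M}) [0..<n])"
  by (rule nth_equalityI) (simp_all add: vset_upd fun_eq_iff)

text \<open>Projection: the automaton guesses the track of \<open>X\<close> column by column with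
  the same states. Guesses are restricted to rows of the grid, so that they assemble into an
  admissible set.\<close>

lemma nfa_bound_ExS:
  assumes f: "nfa_bound N m f"
  shows "nfa_bound N m (ExS X f)"
proof -
  from f obtain \<delta> I F where 1: "\<And>l. \<delta> l \<subseteq> {..<N} \<times> {..<N}" "I \<subseteq> {..<N}"
    "\<And>n a A. valid m n a A \<Longrightarrow>
      sat (grid m n) a A f \<longleftrightarrow> (\<exists>p\<in>I. \<exists>q\<in>F. (p, q) \<in> run_rel \<delta> (word n a A))"
    by (rule nfa_boundE) blast
  let ?h = "\<lambda>l M. l(Inl X := M)"
  let ?\<delta> = "\<lambda>l. \<Union>M\<in>Pow {1..m}. \<delta> (?h l M)"
  have run: "(p, q) \<in> run_rel ?\<delta> (word n a A) \<longleftrightarrow>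
    (\<exists>M\<subseteq>grid m n. (p, q) \<in> run_rel \<delta> (word n a (A(X := M))))" for p q n a A
  proof
    assume "(p, q) \<in> run_rel ?\<delta> (word n a A)"
    then obtain Ms where Ms: "length Ms = n" "set Ms \<subseteq> Pow {1..m}"
      "(p, q) \<in> run_rel \<delta> (map2 ?h (word n a A) Ms)"
      unfolding run_rel_project[where \<delta> = \<delta> and h = ?h] length_word by blast
    define M where "M = {(i, j). 1 \<le> j \<and> j \<le> n \<and> i \<in> Ms ! (j - 1)}"
    have "Ms ! (j - 1) \<subseteq> {1..m}" if "1 \<le> j" "j \<le> n" for j
    proof -
      have "Ms ! (j - 1) \<in> set Ms" using Ms(1) that by (intro nth_mem) simp
      with Ms(2) show ?thesis by blast
    qed
    then have "M \<subseteq> grid m n" by (fastforce simp: M_def grid_def)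
    moreover have "Ms = map (\<lambda>j. {i. (i, Suc j) \<in> M}) [0..<n]"
      using Ms(1) by (auto intro!: nth_equalityI simp: M_def)
    then have "word n a (A(X := M)) = map2 ?h (word n a A) Ms" by (simp add: word_upd)
    ultimately show "\<exists>M\<subseteq>grid m n. (p, q) \<in> run_rel \<delta> (word n a (A(X := M)))"
      using Ms(3) by auto
  next
    assume "\<exists>M\<subseteq>grid m n. (p, q) \<in> run_rel \<delta> (word n a (A(X := M)))"
    then obtain M where "M \<subseteq> grid m n" "(p, q) \<in> run_rel \<delta> (word n a (A(X := M)))" by blast
    then show "(p, q) \<in> run_rel ?\<delta> (word n a A)"
      unfolding run_rel_project[where \<delta> = \<delta> and h = ?h] word_upd
      by (intro exI[of _ "map (\<lambda>j. {i. (i, Suc j) \<in> M}) [0..<n]"]) (auto simp: grid_def)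
  qed
  show ?thesis
  proof (rule nfa_boundI[where Q = "{..<N}" and \<delta> = ?\<delta> and I = I and F = F])
    show "?\<delta> l \<subseteq> {..<N} \<times> {..<N}" for l using 1(1) by blast
    show "sat (grid m n) a A (ExS X f) \<longleftrightarrow> (\<exists>p\<in>I. \<exists>q\<in>F. (p, q) \<in> run_rel ?\<delta> (word n a A))"
      if v: "valid m n a A" for n a A
    proof -
      have "sat (grid m n) a (A(X := M)) f \<longleftrightarrow>
        (\<exists>p\<in>I. \<exists>q\<in>F. (p, q) \<in> run_rel \<delta> (word n a (A(X := M))))" if "M \<subseteq> grid m n" for M
        by (rule 1(3)) (use v that in \<open>simp add: valid_def\<close>)
      then show ?thesis unfolding run sat.simps by blast
    qed
  qed (use 1(2) in simp_all)
qed

section \<open>Exponential towers and the state bounds of the hierarchy\<close>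

primrec tower :: "nat \<Rightarrow> nat \<Rightarrow> nat" where
  "tower 0 x = x"
| "tower (Suc k) x = 2 ^ tower k x"

lemma tower_mono: "x \<le> y \<Longrightarrow> tower k x \<le> tower k y"
  by (induction k) auto

lemma tower_pos: "x > 0 \<Longrightarrow> tower k x > 0"
  by (induction k) auto

text \<open>Used to absorb sums and products of state numbers into the constant in the argument of
  the tower. Positivity excludes the case of \<open>2 ^ 0 + 2 ^ 0\<close>, which exceeds
  \<open>2 ^ 0\<close>; this is why the classes below ask for \<open>C > 0\<close>.\<close>

lemma tower_add_le:
  assumes "x > 0" "y > 0"
  shows "tower k x + tower k y \<le> tower k (x + y)"
proof (induction k)
  case (Suc k)
  have *: "(2::nat) ^ a + 2 ^ b \<le> 2 ^ (a + b)" if ab: "a > 0" "b > 0" for a b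
  proof -
    obtain c d where "a = Suc c" "b = Suc d" using ab by (metis gr0_implies_Suc)
    moreover have "(1::nat) \<le> 2 ^ c" "(1::nat) \<le> 2 ^ d" by simp_all
    then have "(2::nat) ^ c + 2 ^ d \<le> 2 * (2 ^ c * 2 ^ d)"
      using mult_le_mono[of 1 "2 ^ c" "2 ^ d" "2 ^ d"] mult_le_mono[of "2 ^ c" "2 ^ c" 1 "2 ^ d"]
      by linarith
    ultimately show ?thesis by (simp add: power_add)
  qed
  have "tower (Suc k) x + tower (Suc k) y \<le> 2 ^ (tower k x + tower k y)"
    using *[of "tower k x" "tower k y"] tower_pos assms by simp
  also have "\<dots> \<le> tower (Suc k) (x + y)" using Suc.IH by (simp add: power_increasing)
  finally show ?case .
qed simp

lemma tower_mult_le: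
  "x > 0 \<Longrightarrow> y > 0 \<Longrightarrow> tower (Suc k) x * tower (Suc k) y \<le> tower (Suc k) (x + y)"
  using tower_add_le[of x y k] by (simp add: power_add[symmetric] power_increasing)

definition dfa_class :: "nat \<Rightarrow> fm set" where
  "dfa_class k = {f. \<exists>C>0. \<forall>m\<ge>1. dfa_bound (tower k (C * m)) m f}"

definition nfa_class :: "nat \<Rightarrow> fm set" where
  "nfa_class k = {f. \<exists>C>0. \<forall>m\<ge>1. nfa_bound (tower k (C * m)) m f}"

lemma FO_subset_dfa_class: "FO \<subseteq> dfa_class 1"
proof
  fix f assume "f \<in> FO"
  then obtain g where g: "no_set_quant g" "fm_equiv f g" by (auto simp: FO_def)
  from no_set_quant_dfa_bound[OF g(1)] obtain C where C: "\<forall>m\<ge>1. dfa_bound (2 ^ (C * m)) m g" by blast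
  have "dfa_bound (tower 1 (Suc C * m)) m f" if "m \<ge> 1" for m
  proof -
    have "dfa_bound (2 ^ (C * m)) m f" using C that dfa_bound_equiv[OF _ g(2)] by blast
    then show ?thesis by (rule dfa_bound_mono) (simp add: power_increasing)
  qed
  then show "f \<in> dfa_class 1" unfolding dfa_class_def by blast
qed

lemma nfa_class_subset_dfa_class: "nfa_class k \<subseteq> dfa_class (Suc k)"
  unfolding nfa_class_def dfa_class_def tower.simps using nfa_bound_imp_dfa_bound by blast

lemma Bool_cl_dfa_class:
  assumes F: "F \<subseteq> dfa_class (Suc k)"
  shows "Bool_cl F \<subseteq> dfa_class (Suc k)"
proof
  have comb: "h \<in> dfa_class (Suc k)" if fg: "f \<in> dfa_class (Suc k)" "g \<in> dfa_class (Suc k)"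
    and h: "\<And>m n a A. sat (grid m n) a A h \<longleftrightarrow> b (sat (grid m n) a A f) (sat (grid m n) a A g)" for f g h b
  proof -
    from fg obtain C C' where C: "C > 0" "C' > 0" "\<forall>m\<ge>1. dfa_bound (tower (Suc k) (C * m)) m f"
      "\<forall>m\<ge>1. dfa_bound (tower (Suc k) (C' * m)) m g" unfolding dfa_class_def by blast
    have "dfa_bound (tower (Suc k) ((C + C') * m)) m h" if m: "m \<ge> 1" for m
    proof (rule dfa_bound_mono)
      show "dfa_bound (tower (Suc k) (C * m) * tower (Suc k) (C' * m)) m h"
        using C m h by (intro dfa_bound_comb) blast+
      show "tower (Suc k) (C * m) * tower (Suc k) (C' * m) \<le> tower (Suc k) ((C + C') * m)"
        unfolding add_mult_distrib by (rule tower_mult_le) (use C m in auto)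
    qed
    with C show ?thesis unfolding dfa_class_def by (intro CollectI exI[of _ "C + C'"]) auto
  qed
  fix f assume "f \<in> Bool_cl F"
  then show "f \<in> dfa_class (Suc k)"
  proof induction
    case (neg f) then show ?case unfolding dfa_class_def using dfa_bound_Neg by blast
  next
    case (conj f g) from conj.IH show ?case by (rule comb[where b = "(\<and>)"]) simp
  next
    case (disj f g) from disj.IH show ?case by (rule comb[where b = "(\<or>)"]) simp
  next
    case (equiv g f) then show ?case unfolding dfa_class_def using dfa_bound_equiv by blast
  qed (use F in blast)
qed

lemma Sigma1_mon_nfa_class:
  assumes F: "F \<subseteq> dfa_class (Suc k)"
  shows "Sigma1_mon F \<subseteq> nfa_class (Suc k)"
proof
  fix f assume "f \<in> Sigma1_mon F"
  then show "f \<in> nfa_class (Suc k)"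
  proof induction
    case (base f)
    with F have "f \<in> dfa_class (Suc k)" by blast
    then show ?case unfolding dfa_class_def nfa_class_def using dfa_bound_imp_nfa_bound by blast
  next
    case (exS f X) then show ?case unfolding nfa_class_def using nfa_bound_ExS by blast
  next
    case (conj f g)
    then obtain C C' where C: "C > 0" "C' > 0" "\<forall>m\<ge>1. nfa_bound (tower (Suc k) (C * m)) m f"
      "\<forall>m\<ge>1. nfa_bound (tower (Suc k) (C' * m)) m g" unfolding nfa_class_def by blast
    have "nfa_bound (tower (Suc k) ((C + C') * m)) m (Conj f g)" if m: "m \<ge> 1" for m
    proof (rule nfa_bound_mono)
      show "nfa_bound (tower (Suc k) (C * m) * tower (Suc k) (C' * m)) m (Conj f g)"
        using C m by (intro nfa_bound_Conj) blast+
      show "tower (Suc k) (C * m) * tower (Suc k) (C' * m) \<le> tower (Suc k) ((C + C') * m)"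
        unfolding add_mult_distrib by (rule tower_mult_le) (use C m in auto)
    qed
    with C show ?case unfolding nfa_class_def by (intro CollectI exI[of _ "C + C'"]) auto
  next
    case (disj f g)
    then obtain C C' where C: "C > 0" "C' > 0" "\<forall>m\<ge>1. nfa_bound (tower (Suc k) (C * m)) m f"
      "\<forall>m\<ge>1. nfa_bound (tower (Suc k) (C' * m)) m g" unfolding nfa_class_def by blast
    have "nfa_bound (tower (Suc k) ((C + C') * m)) m (Disj f g)" if m: "m \<ge> 1" for m
    proof (rule nfa_bound_mono)
      show "nfa_bound (tower (Suc k) (C * m) + tower (Suc k) (C' * m)) m (Disj f g)"
        using C m by (intro nfa_bound_Disj) blast+
      show "tower (Suc k) (C * m) + tower (Suc k) (C' * m) \<le> tower (Suc k) ((C + C') * m)"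
        unfolding add_mult_distrib by (rule tower_add_le) (use C m in auto)
    qed
    with C show ?case unfolding nfa_class_def by (intro CollectI exI[of _ "C + C'"]) auto
  next
    case (equiv g f) then show ?case unfolding nfa_class_def using nfa_bound_equiv by blast
  qed
qed

text \<open>First-order formulas start with deterministic automata at height 1, so the set
  quantifiers of the first level are free of charge. Every further level determinises once, before
  its Boolean closure is formed.\<close>

lemma Sigma_mon_nfa_class: "Sigma_mon (Suc k) \<subseteq> nfa_class (Suc k)"
proof (induction k)
  case 0
  show ?case
    using Sigma1_mon_nfa_class[OF Bool_cl_dfa_class, of FO 0] FO_subset_dfa_class
    by (simp add: Sigma_mon_def)
next
  case (Suc k)
  then have "Sigma_mon (Suc k) \<subseteq> dfa_class (Suc (Suc k))" using nfa_class_subset_dfa_class by blast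
  from Sigma1_mon_nfa_class[OF Bool_cl_dfa_class[OF this]]
  show ?case by (simp add: Sigma_mon_def)
qed

section \<open>Insertion of blank columns\<close>

lemma relpow_loop: "(x, x) \<in> R ^^ c \<Longrightarrow> (x, x) \<in> R ^^ (c * q)"
  by (induction q) (auto simp: relpow_add)

text \<open>A walk of more than \<open>N\<close> steps contains a cycle whose length is in
  \<open>{1..N}\<close> and thus divides \<open>P\<close>; extra turns prolong the walk by exactly
  \<open>P\<close>. So large powers grow along steps of \<open>P\<close>, and there are only
  finitely many relations to grow through.\<close>

lemma relpow_eventually_periodic:
  fixes R :: "(nat \<times> nat) set"
  assumes R: "R \<subseteq> {..<N} \<times> {..<N}" and P: "P > 0" "\<And>c. c \<in> {1..N} \<Longrightarrow> c dvd P"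
  obtains d where "\<And>e. e \<ge> d \<Longrightarrow> R ^^ e = R ^^ (e + P)"
proof -
  have "R ^^ Suc N \<subseteq> R ^^ (Suc N + P)"
  proof clarify
    fix x y assume "(x, y) \<in> R ^^ Suc N"
    then obtain f where f: "f 0 = x" "f (Suc N) = y" "\<And>i. i < Suc N \<Longrightarrow> (f i, f (Suc i)) \<in> R"
      unfolding relpow_fun_conv by blast
    have sub: "(f i, f (i + l)) \<in> R ^^ l" if "i + l \<le> Suc N" for i l
      unfolding relpow_fun_conv using f(3) that by (intro exI[of _ "\<lambda>j. f (i + j)"]) auto
    have "f i \<in> {..<N}" if "i \<le> N" for i
      using f(3)[of i] R that by auto
    then have "f ` {..N} \<subseteq> {..<N}" by blast
    then have "card (f ` {..N}) \<le> N" using card_mono[of "{..<N}" "f ` {..N}"] by simp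
    then have "\<not> inj_on f {..N}" using card_image[of f "{..N}"] by auto
    then obtain i j where ij: "i < j" "j \<le> N" "f i = f j"
      unfolding inj_on_def by (metis atMost_iff linorder_neqE_nat)
    have "j - i dvd P" by (rule P(2)) (use ij in auto)
    then obtain q where q: "P = (j - i) * q" by (rule dvdE)
    have "(x, f i) \<in> R ^^ i" using sub[of 0 i] ij f(1) by simp
    moreover have "(f i, f i) \<in> R ^^ (j - i)" using sub[of i "j - i"] ij by simp
    then have "(f i, f i) \<in> R ^^ P" unfolding q by (rule relpow_loop)
    moreover have "(f i, y) \<in> R ^^ (Suc N - i)" using sub[of i "Suc N - i"] ij f(2) by simp
    ultimately have "(x, y) \<in> R ^^ (i + (P + (Suc N - i)))"
      unfolding relpow_add by blast
    moreover have "i + (P + (Suc N - i)) = Suc N + P" using ij by simp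
    ultimately show "(x, y) \<in> R ^^ (Suc N + P)" by metis
  qed
  then have incr: "R ^^ e \<subseteq> R ^^ (e + P)" if "e \<ge> Suc N" for e
  proof -
    from that obtain r where r: "e = Suc N + r" using le_Suc_ex by blast
    have "R ^^ e \<subseteq> R ^^ (Suc N + P) O R ^^ r"
      unfolding r relpow_add[of "Suc N" r] using \<open>R ^^ Suc N \<subseteq> _\<close> by (rule relcomp_mono) simp
    also have "\<dots> = R ^^ (e + P)" unfolding r relpow_add[symmetric] by (simp add: add_ac)
    finally show ?thesis .
  qed
  define S where "S k = R ^^ (Suc N + k * P)" for k
  have fin: "S k \<subseteq> {..<N} \<times> {..<N}" for k
  proof -
    have "R ^^ Suc e \<subseteq> {..<N} \<times> {..<N}" for e
      using R by (induction e) auto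
    then show ?thesis unfolding S_def by simp
  qed
  have step: "S k \<subseteq> S (Suc k)" for k
    using incr[of "Suc N + k * P"] by (simp add: S_def add_ac)
  have "\<exists>k. S k = S (Suc k)"
  proof (rule ccontr)
    assume "\<not> ?thesis"
    then have psub: "S k \<subset> S (Suc k)" for k using step by blast
    have "k \<le> card (S k)" for k
    proof (induction k)
      case (Suc k)
      have "card (S k) < card (S (Suc k))"
        using psub fin[of "Suc k"] by (intro psubset_card_mono) (auto intro: finite_subset)
      with Suc show ?case by simp
    qed simp
    from this[of "Suc (N * N)"] have "Suc (N * N) \<le> card ({..<N} \<times> {..<N})"
      using card_mono[OF _ fin] by (meson finite_SigmaI finite_lessThan le_trans)
    then show False by (simp add: card_cartesian_product)
  qed
  \<comment> \<open>A single coincidence is enough: composing it with \<open>R ^^ r\<close> carries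
    it to all larger exponents.\<close>
  then obtain k where k: "S k = S (Suc k)" by blast
  show thesis
  proof (rule that)
    fix e assume "e \<ge> Suc N + k * P"
    then obtain r where r: "e = Suc N + k * P + r" using le_Suc_ex by blast
    have "R ^^ e = S k O R ^^ r" by (simp only: r relpow_add S_def)
    also have "\<dots> = S (Suc k) O R ^^ r" by (simp only: k)
    also have "\<dots> = R ^^ (Suc N + Suc k * P + r)" by (simp only: relpow_add S_def)
    also have "Suc N + Suc k * P + r = e + P" by (simp add: r)
    finally show "R ^^ e = R ^^ (e + P)" .
  qed
qed

section \<open>Stability of formulas under insertion\<close>

definition shift :: "nat \<Rightarrow> nat \<Rightarrow> (nat \<Rightarrow> pos) \<Rightarrow> nat \<Rightarrow> pos" where
  "shift h P a x = (fst (a x), if snd (a x) \<le> h then snd (a x) else snd (a x) + P)"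

text \<open>All set variables are empty: set quantifiers are dealt with inside the formulas given by
  automata, and first-order closure keeps these values. The \<open>T\<close> columns on either side
  of the insertion point are free of pebbles, so an automaton reads blank letters there.\<close>

definition pumpable :: "nat \<Rightarrow> nat \<Rightarrow> nat \<Rightarrow> fm \<Rightarrow> bool" where
  "pumpable m P T f \<longleftrightarrow> (\<forall>n a h. T \<le> h \<longrightarrow> h + T \<le> n \<longrightarrow> (\<forall>x. a x \<in> grid m n) \<longrightarrow>
     (\<forall>x. snd (a x) \<le> h - T \<or> h + T < snd (a x)) \<longrightarrow>
     (sat (grid m n) a (\<lambda>_. {}) f \<longleftrightarrow> sat (grid m (n + P)) (shift h P a) (\<lambda>_. {}) f))"

lemma pumpableD:
  assumes "pumpable m P T f" "T \<le> h" "h + T \<le> n" "\<And>x. a x \<in> grid m n"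
    "\<And>x. snd (a x) \<le> h - T \<or> h + T < snd (a x)"
  shows "sat (grid m n) a (\<lambda>_. {}) f \<longleftrightarrow> sat (grid m (n + P)) (shift h P a) (\<lambda>_. {}) f"
  using assms unfolding pumpable_def by blast

lemma pumpable_mono:
  assumes "pumpable m P T f" "T \<le> T'"
  shows "pumpable m P T' f"
  unfolding pumpable_def
proof (intro allI impI)
  fix n h :: nat and a :: "nat \<Rightarrow> pos"
  assume *: "T' \<le> h" "h + T' \<le> n" "\<forall>x. a x \<in> grid m n" "\<forall>x. snd (a x) \<le> h - T' \<or> h + T' < snd (a x)"
  have "snd (a x) \<le> h - T \<or> h + T < snd (a x)" for x
    using assms(2) *(1,2) spec[OF *(4), of x] by linarith
  with * assms(2) show "sat (grid m n) a (\<lambda>_. {}) f \<longleftrightarrow> sat (grid m (n + P)) (shift h P a) (\<lambda>_. {}) f"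
    by (intro pumpableD[OF assms(1)]) auto
qed

lemma shift_in_grid: "a x \<in> grid m n \<Longrightarrow> shift h P a x \<in> grid m (n + P)"
  by (auto simp: shift_def grid_def)

lemma run_rel_replicate: "run_rel \<delta> (replicate d l) = \<delta> l ^^ d"
  by (induction d) (simp_all add: relpow_commute[symmetric])

text \<open>Around the insertion point the automaton applies a high power of one relation, that of
  the blank letter. Adding \<open>P\<close> to the exponent leaves this power unchanged.\<close>

lemma nfa_bound_pumpable:
  assumes f: "nfa_bound N m f" and P: "P > 0" "\<And>c. c \<in> {1..N} \<Longrightarrow> c dvd P"
  shows "\<exists>T. pumpable m P T f"
proof -
  from f obtain \<delta> I F where \<delta>: "\<And>l. \<delta> l \<subseteq> {..<N} \<times> {..<N}" and
    f: "\<And>n a A. valid m n a A \<Longrightarrow>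
      sat (grid m n) a A f \<longleftrightarrow> (\<exists>p\<in>I. \<exists>q\<in>F. (p, q) \<in> run_rel \<delta> (word n a A))"
    by (rule nfa_boundE) blast
  let ?b = "\<lambda>_. {} :: nat set"
  obtain d where d: "\<And>e. e \<ge> d \<Longrightarrow> \<delta> ?b ^^ e = \<delta> ?b ^^ (e + P)"
    using relpow_eventually_periodic[OF \<delta> P] by blast
  have "pumpable m P d f"
    unfolding pumpable_def
  proof (intro allI impI)
    fix n h :: nat and a :: "nat \<Rightarrow> pos"
    assume h: "d \<le> h" "h + d \<le> n" and a: "\<forall>x. a x \<in> grid m n"
      and free: "\<forall>x. snd (a x) \<le> h - d \<or> h + d < snd (a x)"
    let ?w = "word n a (\<lambda>_. {})" and ?w' = "word (n + P) (shift h P a) (\<lambda>_. {})"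
    have nofree: "{i. (i, Suc j) \<in> vset a (\<lambda>_. {}) v} = {}" if "h - d \<le> j" "j < h + d" for j v
    proof (cases v)
      case (Inr x)
      have "snd (a x) \<noteq> Suc j" using that spec[OF free, of x] h by linarith
      with Inr show ?thesis by (cases "a x") auto
    qed simp
    have nofree': "{i. (i, Suc j) \<in> vset (shift h P a) (\<lambda>_. {}) v} = {}"
      if "h - d \<le> j" "j < h + d + P" for j v
    proof (cases v)
      case (Inr x)
      have "snd (shift h P a x) \<noteq> Suc j"
        using that spec[OF free, of x] h by (auto simp: shift_def)
      with Inr show ?thesis by (cases "shift h P a x") auto
    qed simp
    have left: "{i. (i, Suc j) \<in> vset (shift h P a) (\<lambda>_. {}) v} = {i. (i, Suc j) \<in> vset a (\<lambda>_. {}) v}"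
      if "j < h - d" for j v
    proof (cases v)
      case (Inr x)
      with that h show ?thesis by (cases "a x") (auto simp: shift_def)
    qed simp
    have right: "{i. (i, Suc (j + P)) \<in> vset (shift h P a) (\<lambda>_. {}) v} = {i. (i, Suc j) \<in> vset a (\<lambda>_. {}) v}"
      if "h + d \<le> j" for j v
    proof (cases v)
      case (Inr x)
      with that h show ?thesis by (cases "a x") (auto simp: shift_def)
    qed simp
    have w: "?w = take (h - d) ?w @ replicate (2 * d) ?b @ drop (h + d) ?w"
      using h by (intro nth_equalityI) (auto simp: nth_append nofree)
    have w': "?w' = take (h - d) ?w @ replicate (2 * d + P) ?b @ drop (h + d) ?w"
    proof (rule nth_equalityI)
      show "length ?w' = length (take (h - d) ?w @ replicate (2 * d + P) ?b @ drop (h + d) ?w)"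
        using h by simp
      fix j assume "j < length ?w'"
      then have j: "j < n + P" by simp
      consider "j < h - d" | "h - d \<le> j" "j < h + d + P" | "h + d + P \<le> j" by linarith
      then show "?w' ! j = (take (h - d) ?w @ replicate (2 * d + P) ?b @ drop (h + d) ?w) ! j"
      proof cases
        case 1
        then show ?thesis using h j left by (simp add: nth_append)
      next
        case 2
        moreover have "j + d - h < 2 * d + P" using 2 h by linarith
        ultimately show ?thesis using h j nofree' by (simp add: nth_append)
      next
        case 3
        then obtain e where e: "j = h + d + e + P" by (metis le_Suc_ex add.assoc add.commute)
        then have "e < n - (h + d)" using j by simp
        moreover have "\<not> h + d + e + P < h - d" by simp
        ultimately show ?thesis using h j right[of "h + d + e"] by (simp add: nth_append e)
      qed
    qed
    have "run_rel \<delta> ?w' = run_rel \<delta> (take (h - d) ?w) O \<delta> ?b ^^ (2 * d + P) O run_rel \<delta> (drop (h + d) ?w)"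
      unfolding w' by (simp only: run_rel_append run_rel_replicate)
    also have "\<delta> ?b ^^ (2 * d + P) = \<delta> ?b ^^ (2 * d)" using d[of "2 * d"] by simp
    also have "run_rel \<delta> (take (h - d) ?w) O \<delta> ?b ^^ (2 * d) O run_rel \<delta> (drop (h + d) ?w) = run_rel \<delta> ?w"
      by (subst (3) w) (simp only: run_rel_append run_rel_replicate)
    finally have "run_rel \<delta> ?w' = run_rel \<delta> ?w" .
    moreover have "valid m n a (\<lambda>_. {})" "valid m (n + P) (shift h P a) (\<lambda>_. {})"
      using a shift_in_grid by (auto simp: valid_def)
    ultimately show "sat (grid m n) a (\<lambda>_. {}) f \<longleftrightarrow> sat (grid m (n + P)) (shift h P a) (\<lambda>_. {}) f"
      using f by simp
  qed
  then show ?thesis by blast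
qed

text \<open>A new pebble may land in the pebble-free zone, or in the inserted columns. The insertion point
  can then be moved inside the zone to one side of the new pebble, without changing the pictures
  or the old pebbles.\<close>

lemma pumpable_quant:
  assumes f: "pumpable m P T f" and T: "T' = 3 * T + P"
    and h: "T' \<le> h" "h + T' \<le> n" and a: "\<And>x. a x \<in> grid m n"
    and free: "\<And>x. snd (a x) \<le> h - T' \<or> h + T' < snd (a x)"
  shows "d \<in> grid m n \<Longrightarrow> \<exists>d'\<in>grid m (n + P).
      sat (grid m n) (a(x := d)) (\<lambda>_. {}) f \<longleftrightarrow> sat (grid m (n + P)) ((shift h P a)(x := d')) (\<lambda>_. {}) f"
    (is "_ \<Longrightarrow> ?forth d")
    and "d' \<in> grid m (n + P) \<Longrightarrow> \<exists>d\<in>grid m n.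
      sat (grid m n) (a(x := d)) (\<lambda>_. {}) f \<longleftrightarrow> sat (grid m (n + P)) ((shift h P a)(x := d')) (\<lambda>_. {}) f"
    (is "_ \<Longrightarrow> ?back d'")
proof -
  have left: "sat (grid m n) (a(x := d)) (\<lambda>_. {}) f \<longleftrightarrow>
      sat (grid m (n + P)) ((shift h P a)(x := d)) (\<lambda>_. {}) f"
    if d: "d \<in> grid m n" "snd d \<le> h + P" for d
  proof -
    \<comment> \<open>A new pebble in a column up to \<open>h + P\<close> keeps its column. The
      small zone around the moved insertion point begins just after \<open>h + P\<close> and stays
      within the old zone, so old pebbles avoid it and are shifted as before.\<close>
    let ?h = "h + P + T"
    have "shift ?h P (a(x := d)) = (shift h P a)(x := d)"
    proof
      fix y show "shift ?h P (a(x := d)) y = ((shift h P a)(x := d)) y"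
        using d free[of y] T by (cases d) (auto simp: shift_def)
    qed
    moreover have "snd ((a(x := d)) y) \<le> ?h - T \<or> ?h + T < snd ((a(x := d)) y)" for y
      using d free[of y] T by auto
    ultimately show ?thesis
      using pumpableD[OF f, of ?h n "a(x := d)"] h a d T by simp
  qed
  have right: "sat (grid m n) (a(x := (i, j))) (\<lambda>_. {}) f \<longleftrightarrow>
      sat (grid m (n + P)) ((shift h P a)(x := (i, j + P))) (\<lambda>_. {}) f"
    if d: "(i, j) \<in> grid m n" "h < j" for i j
  proof -
    \<comment> \<open>Here the small zone ends at column \<open>h\<close>, to the left of the new
      pebble, which is shifted together with the right part.\<close>
    let ?h = "h - T"
    have "shift ?h P (a(x := (i, j))) = (shift h P a)(x := (i, j + P))"
    proof
      fix y show "shift ?h P (a(x := (i, j))) y = ((shift h P a)(x := (i, j + P))) y"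
        using d h free[of y] T by (auto simp: shift_def)
    qed
    moreover have "snd ((a(x := (i, j))) y) \<le> ?h - T \<or> ?h + T < snd ((a(x := (i, j))) y)" for y
      using d h free[of y] T by auto
    ultimately show ?thesis
      using pumpableD[OF f, of ?h n "a(x := (i, j))"] h a d T by simp
  qed
  show "?forth d" if d: "d \<in> grid m n"
  proof (cases "snd d \<le> h + P")
    case True
    moreover have "d \<in> grid m (n + P)" using d by (auto simp: grid_def)
    ultimately show ?thesis using left[OF d] by blast
  next
    case False
    moreover have "(fst d, snd d + P) \<in> grid m (n + P)" using d by (auto simp: grid_def)
    moreover have "h < snd d" using False by simp
    ultimately show ?thesis using right[of "fst d" "snd d"] d by (metis prod.collapse)
  qed
  show "?back d'" if d: "d' \<in> grid m (n + P)"
  proof (cases "snd d' \<le> h + P")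
    case True
    moreover from this have "d' \<in> grid m n" using d h T by (auto simp: grid_def)
    ultimately show ?thesis using left by blast
  next
    case False
    then have "(fst d', snd d' - P) \<in> grid m n" using d by (auto simp: grid_def)
    moreover from False have "h < snd d' - P" "snd d' - P + P = snd d'" by auto
    ultimately show ?thesis using right[of "fst d'" "snd d' - P"] by (metis prod.collapse)
  qed
qed

text \<open>The order of quantifiers matters: the period is prescribed by the state bound, whereas
  the margin \<open>T\<close> may depend on the period and on the height.\<close>

definition pump_class :: "nat \<Rightarrow> fm set" where
  "pump_class k = {f. \<exists>C>0. \<forall>m\<ge>1. \<forall>P>0.
     (\<forall>c\<in>{1..tower k (C * m)}. c dvd P) \<longrightarrow> (\<exists>T. pumpable m P T f)}"

lemma pump_classI:
  assumes "C > 0"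
    and "\<And>m P. m \<ge> 1 \<Longrightarrow> P > 0 \<Longrightarrow> (\<And>c. c \<in> {1..tower k (C * m)} \<Longrightarrow> c dvd P) \<Longrightarrow> \<exists>T. pumpable m P T f"
  shows "f \<in> pump_class k"
  unfolding pump_class_def using assms by (intro CollectI exI[of _ C]) blast

lemma pump_classE:
  assumes "f \<in> pump_class k"
  obtains C where "C > 0"
    "\<And>m P. m \<ge> 1 \<Longrightarrow> P > 0 \<Longrightarrow> (\<And>c. c \<in> {1..tower k (C * m)} \<Longrightarrow> c dvd P) \<Longrightarrow> \<exists>T. pumpable m P T f"
proof -
  from assms obtain C where C: "C > 0" "\<forall>m\<ge>1. \<forall>P>0.
     (\<forall>c\<in>{1..tower k (C * m)}. c dvd P) \<longrightarrow> (\<exists>T. pumpable m P T f)"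
    unfolding pump_class_def by blast
  show thesis by (rule that[OF C(1)]) (use C(2) in blast)
qed

lemma pump_class_map:
  assumes f: "f \<in> pump_class k" and g: "\<And>m P T. pumpable m P T f \<Longrightarrow> \<exists>T. pumpable m P T g"
  shows "g \<in> pump_class k"
proof -
  obtain C where C: "C > 0"
    "\<And>m P. m \<ge> 1 \<Longrightarrow> P > 0 \<Longrightarrow> (\<And>c. c \<in> {1..tower k (C * m)} \<Longrightarrow> c dvd P) \<Longrightarrow> \<exists>T. pumpable m P T f"
    using pump_classE[OF f] by blast
  show ?thesis
  proof (rule pump_classI[OF C(1)])
    fix m P :: nat
    assume "m \<ge> 1" "P > 0" and "\<And>c. c \<in> {1..tower k (C * m)} \<Longrightarrow> c dvd P"
    from C(2)[OF this] g show "\<exists>T. pumpable m P T g" by blast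
  qed
qed

lemma pump_class_comb:
  assumes f: "f \<in> pump_class k" and g: "g \<in> pump_class k"
    and h: "\<And>m n a. sat (grid m n) a (\<lambda>_. {}) h \<longleftrightarrow>
      b (sat (grid m n) a (\<lambda>_. {}) f) (sat (grid m n) a (\<lambda>_. {}) g)"
  shows "h \<in> pump_class k"
proof -
  obtain C where C: "C > 0"
    "\<And>m P. m \<ge> 1 \<Longrightarrow> P > 0 \<Longrightarrow> (\<And>c. c \<in> {1..tower k (C * m)} \<Longrightarrow> c dvd P) \<Longrightarrow> \<exists>T. pumpable m P T f"
    using pump_classE[OF f] by blast
  obtain C' where C': "C' > 0"
    "\<And>m P. m \<ge> 1 \<Longrightarrow> P > 0 \<Longrightarrow> (\<And>c. c \<in> {1..tower k (C' * m)} \<Longrightarrow> c dvd P) \<Longrightarrow> \<exists>T. pumpable m P T g"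
    using pump_classE[OF g] by blast
  show ?thesis
  proof (rule pump_classI)
    show "C + C' > 0" using C by simp
    fix m P :: nat
    assume mP: "m \<ge> 1" "P > 0" and dvd: "\<And>c. c \<in> {1..tower k ((C + C') * m)} \<Longrightarrow> c dvd P"
    have le: "tower k (C * m) \<le> tower k ((C + C') * m)" "tower k (C' * m) \<le> tower k ((C + C') * m)"
      by (auto intro!: tower_mono)
    obtain T where "pumpable m P T f"
      using C(2)[OF mP dvd] le(1) by fastforce
    then have f': "pumpable m P (max T T') f" for T' by (rule pumpable_mono) simp
    obtain T' where "pumpable m P T' g"
      using C'(2)[OF mP dvd] le(2) by fastforce
    then have "pumpable m P (max T T') g" by (rule pumpable_mono) simp
    with f'[of T'] have "pumpable m P (max T T') h" unfolding pumpable_def h by simp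
    then show "\<exists>T. pumpable m P T h" by blast
  qed
qed

lemma pumpable_ExF: "pumpable m P T f \<Longrightarrow> pumpable m P (3 * T + P) (ExF x f)"
  unfolding pumpable_def[of _ _ "3 * T + P"]
proof (intro allI impI)
  fix n h :: nat and a :: "nat \<Rightarrow> pos"
  assume f: "pumpable m P T f" and h: "3 * T + P \<le> h" "h + (3 * T + P) \<le> n"
    and a: "\<forall>x. a x \<in> grid m n" and free: "\<forall>x. snd (a x) \<le> h - (3 * T + P) \<or> h + (3 * T + P) < snd (a x)"
  note * = pumpable_quant[OF f refl h a[rule_format] free[rule_format], where x = x]
  show "sat (grid m n) a (\<lambda>_. {}) (ExF x f) \<longleftrightarrow> sat (grid m (n + P)) (shift h P a) (\<lambda>_. {}) (ExF x f)"
    unfolding sat.simps using *(1) *(2) by meson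
qed

text \<open>A quantifier enlarges only the margin and a binary connective only the constant
  \<open>C\<close>. The height of the tower remains that of the automata at the leaves.\<close>

lemma FO_cl_pump_class:
  assumes "f \<in> FO_cl (nfa_class k)"
  shows "f \<in> pump_class k"
  using assms
proof induction
  case (base f)
  then obtain C where C: "C > 0" "\<And>m. m \<ge> 1 \<Longrightarrow> nfa_bound (tower k (C * m)) m f"
    unfolding nfa_class_def by blast
  show ?case by (rule pump_classI[OF C(1)]) (rule nfa_bound_pumpable[OF C(2)])
next
  case (neg f)
  from neg.IH show ?case by (rule pump_class_map) (auto simp: pumpable_def)
next
  case (conj f g)
  from conj.IH show ?case by (rule pump_class_comb[where b = "(\<and>)"]) simp
next
  case (disj f g)
  from disj.IH show ?case by (rule pump_class_comb[where b = "(\<or>)"]) simp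
next
  case (exF f x)
  from exF.IH show ?case by (rule pump_class_map) (blast intro: pumpable_ExF)
next
  case (allF f x)
  have "pumpable m P T f \<Longrightarrow> pumpable m P T (Neg f)" for m P T f
    by (simp add: pumpable_def)
  then have "pumpable m P T f \<Longrightarrow> pumpable m P (3 * T + P) (Neg (ExF x (Neg f)))" for m P T
    using pumpable_ExF by blast
  moreover have "pumpable m P T (Neg (ExF x (Neg f))) \<longleftrightarrow> pumpable m P T (AllF x f)" for m P T
    by (simp add: pumpable_def)
  ultimately have "pumpable m P T f \<Longrightarrow> pumpable m P (3 * T + P) (AllF x f)" for m P T by blast
  with allF.IH show ?case by (rule_tac pump_class_map) blast+
next
  case (equiv g f)
  have "pumpable m P T f" if g: "pumpable m P T g" for m P T
    unfolding pumpable_def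
  proof (intro allI impI)
    fix n h :: nat and a :: "nat \<Rightarrow> pos"
    assume *: "T \<le> h" "h + T \<le> n" "\<forall>x. a x \<in> grid m n" "\<forall>x. snd (a x) \<le> h - T \<or> h + T < snd (a x)"
    have v: "valid m n a (\<lambda>_. {})" "valid m (n + P) (shift h P a) (\<lambda>_. {})"
      using * shift_in_grid by (auto simp: valid_def)
    show "sat (grid m n) a (\<lambda>_. {}) f \<longleftrightarrow> sat (grid m (n + P)) (shift h P a) (\<lambda>_. {}) f"
      unfolding sat_cong_equiv[OF equiv.hyps(2) v(1)] sat_cong_equiv[OF equiv.hyps(2) v(2)]
      using pumpableD[OF g *(1,2)] *(3,4) by blast
  qed
  with equiv.IH show ?case by (rule_tac pump_class_map) blast+
qed

lemma FO_cl_mono: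
  assumes "f \<in> FO_cl F" "F \<subseteq> G"
  shows "f \<in> FO_cl G"
  using assms(1)
proof induction
  case (base f)
  with assms(2) show ?case by (blast intro: FO_cl.base)
next
  case (equiv g f)
  from equiv.IH equiv.hyps(2) show ?case by (rule FO_cl.equiv)
qed (rule FO_cl.intros; assumption)+

section \<open>Binary counters\<close>

text \<open>A carry leaves position \<open>i\<close> exactly when bit \<open>i\<close> falls from 1
  to 0. For even \<open>t\<close> nothing above bit 0 changes; for odd \<open>t\<close> the upper
  part \<open>t div 2\<close> is itself incremented.\<close>

lemma bit_Suc_flip:
  "bit (Suc t) (Suc i) \<noteq> bit t (Suc i) \<longleftrightarrow> bit t i \<and> \<not> bit (Suc t) i"
proof (induction i arbitrary: t)
  case 0
  show ?case by (cases "even t") (auto simp: bit_Suc bit_0 elim!: evenE oddE)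
next
  case (Suc i)
  show ?case
    by (cases "even t") (use Suc[of "t div 2"] in \<open>auto simp: bit_Suc even_Suc_div_two odd_Suc_div_two\<close>)
qed

lemma all_bits_iff_dvd_Suc: "(\<forall>i<F. bit t i) \<longleftrightarrow> 2 ^ F dvd Suc t"
proof (induction F arbitrary: t)
  case (Suc F)
  have even: "even n" if "2 ^ Suc F dvd n" for n :: nat
    using that by (rule dvd_trans[rotated]) simp
  have "(\<forall>i<Suc F. bit t i) \<longleftrightarrow> odd t \<and> (\<forall>i<F. bit (t div 2) i)"
    by (auto simp: All_less_Suc2 bit_Suc bit_0)
  also have "\<dots> \<longleftrightarrow> odd t \<and> 2 ^ F dvd Suc (t div 2)" by (simp add: Suc.IH)
  also have "\<dots> \<longleftrightarrow> 2 ^ Suc F dvd Suc t"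
  proof (cases "even t")
    case True
    with even[of "Suc t"] show ?thesis by auto
  next
    case False
    then have *: "Suc t = 2 * Suc (t div 2)" by (auto elim: oddE)
    have "2 ^ Suc F dvd Suc t \<longleftrightarrow> 2 ^ F dvd Suc (t div 2)"
      unfolding * power_Suc by (rule nat_mult_dvd_cancel1) simp
    with False show ?thesis by blast
  qed
  finally show ?case .
qed simp

text \<open>A row-by-row binary counter can be checked without carry marks: a bit other than the
  lowest one changes exactly when its lower neighbour changes from 1 to 0.\<close>

definition counts :: "nat \<Rightarrow> nat \<Rightarrow> (nat \<Rightarrow> nat \<Rightarrow> bool) \<Rightarrow> bool" where
  "counts F T b \<longleftrightarrow> (\<forall>i<F. \<not> b 0 i) \<and> (\<forall>t. Suc t < T \<longrightarrow> (b (Suc t) 0 \<noteq> b t 0) \<and>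
     (\<forall>i. Suc i < F \<longrightarrow> (b (Suc t) (Suc i) \<noteq> b t (Suc i) \<longleftrightarrow> b t i \<and> \<not> b (Suc t) i)))"

lemma counts_bit: "counts F T bit"
  using bit_Suc_flip by (auto simp: counts_def bit_0)

text \<open>\<open>T\<close> may exceed \<open>2 ^ F\<close>. The carry out of the highest bit is
  unconstrained, so the counter wraps around and goes on recording the lowest \<open>F\<close> bits
  of \<open>t\<close>.\<close>

lemma counts_eq_bit:
  assumes "counts F T b" "t < T" "i < F"
  shows "b t i \<longleftrightarrow> bit t i"
  using assms(2,3)
proof (induction t arbitrary: i)
  case 0
  then show ?case using assms(1) by (simp add: counts_def)
next
  case (Suc t)
  from Suc.prems(2) show ?case
  proof (induction i)
    case 0
    have "b (Suc t) 0 \<noteq> b t 0" using assms(1) Suc.prems(1) by (simp add: counts_def)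
    with Suc.IH[of 0] Suc.prems(1) 0 show ?case by (simp add: bit_0)
  next
    case (Suc i)
    have "b (Suc t) (Suc i) \<noteq> b t (Suc i) \<longleftrightarrow> b t i \<and> \<not> b (Suc t) i"
      using assms(1) \<open>Suc t < T\<close> Suc.prems by (simp add: counts_def)
    with Suc.IH Suc.prems \<open>Suc t < T\<close> \<open>\<And>i. t < T \<Longrightarrow> i < F \<Longrightarrow> b t i \<longleftrightarrow> bit t i\<close>[of i]
      \<open>\<And>i. t < T \<Longrightarrow> i < F \<Longrightarrow> b t i \<longleftrightarrow> bit t i\<close>[of "Suc i"] bit_Suc_flip[of t i]
    show ?case by auto
  qed
qed

text \<open>The last value consists of ones, so it is -1 modulo \<open>2 ^ F\<close>: the counter
  has run through complete cycles.\<close>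

lemma counts_dvd:
  assumes "counts F T b" "T > 0" "\<And>i. i < F \<Longrightarrow> b (T - 1) i"
  shows "2 ^ F dvd T"
  using all_bits_iff_dvd_Suc[of F "T - 1"] counts_eq_bit[OF assms(1), of "T - 1"] assms(2,3) by simp

lemma bit_top_pow: "F > 0 \<Longrightarrow> bit (2 ^ F - 1 :: nat) (F - 1)" and not_bit_top_pow: "F > 0 \<Longrightarrow> \<not> bit (2 ^ F :: nat) (F - 1)"
proof -
  assume F: "F > 0"
  have "\<forall>i<F. bit (2 ^ F - 1 :: nat) i" unfolding all_bits_iff_dvd_Suc by simp
  then show "bit (2 ^ F - 1 :: nat) (F - 1)" using F by simp
  show "\<not> bit (2 ^ F :: nat) (F - 1)" using F by (simp add: bit_exp_iff)
qed

text \<open>The highest bit falls for the first time when the counter reaches \<open>2 ^ F\<close>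
  and overflows. Forbidding such a fall leaves exactly one cycle.\<close>

lemma counts_eq_pow:
  assumes c: "counts F T b" and "T > 0" "F > 0" "\<And>i. i < F \<Longrightarrow> b (T - 1) i"
    and no: "\<And>t. Suc t < T \<Longrightarrow> \<not> (b t (F - 1) \<and> \<not> b (Suc t) (F - 1))"
  shows "T = 2 ^ F"
proof (rule ccontr)
  assume "T \<noteq> 2 ^ F"
  moreover have "2 ^ F \<le> T" using counts_dvd[OF c] assms(2,4) by (simp add: dvd_imp_le)
  ultimately have "2 ^ F < T" by simp
  then have "2 ^ F - 1 < T" "Suc (2 ^ F - 1) < T" by simp_all
  with no[of "2 ^ F - 1"] counts_eq_bit[OF c, of _ "F - 1"] bit_top_pow[of F] not_bit_top_pow[of F] \<open>F > 0\<close>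
  show False by simp
qed

lemma bit_top_mono:
  assumes "Suc t < 2 ^ F" "bit t (F - 1)" "F > 0"
  shows "bit (Suc t) (F - 1)"
proof -
  obtain f where F: "F = Suc f" using assms(3) by (cases F) auto
  have "odd (t div 2 ^ f)" using assms(2) F by (simp add: bit_iff_odd)
  then have "t div 2 ^ f \<ge> 1" by (auto intro: Suc_leI odd_pos)
  moreover have "t div 2 ^ f \<le> Suc t div 2 ^ f" by (rule div_le_mono) simp
  moreover have "Suc t div 2 ^ f < 2" using assms(1) F by (simp add: less_mult_imp_div_less)
  ultimately have "Suc t div 2 ^ f = 1" by linarith
  then show ?thesis using F by (simp add: bit_iff_odd)
qed

text \<open>What a window of length \<open>F\<close> at column \<open>e\<close> has to satisfy. The
  interval of length \<open>L\<close> from \<open>c\<close> holds successive \<open>F\<close>-bit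
  numbers, lowest bit first, with bits \<open>\<beta>\<close> and block starts marked by
  \<open>s\<close>, so that \<open>e\<close> and \<open>e + F\<close> are the same digit of
  successive numbers. The clauses concern, in this order, the first number, marks and lowest bits,
  the carry rule, overflow at the highest bit (the cell before a mark), and the last number.\<close>

definition block_ok :: "bool \<Rightarrow> nat \<Rightarrow> nat \<Rightarrow> nat \<Rightarrow> (nat \<Rightarrow> bool) \<Rightarrow> (nat \<Rightarrow> bool) \<Rightarrow> nat \<Rightarrow> bool" where
  "block_ok ov c L F \<beta> s e \<longleftrightarrow>
     (e = c \<longrightarrow> s e \<and> (\<forall>j. e \<le> j \<and> j < e + F \<longrightarrow> \<not> \<beta> j \<and> (j = e \<or> \<not> s j))) \<and>
     (e + F < c + L \<longrightarrow> (s e \<longleftrightarrow> s (e + F)) \<and> (s (e + F) \<longrightarrow> (\<beta> (e + F) \<noteq> \<beta> e))) \<and>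
     (e + F < c + L \<and> 2 \<le> e \<and> \<not> s (e + F) \<longrightarrow>
        (\<beta> (e + F) \<noteq> \<beta> e \<longleftrightarrow> \<beta> (e - 1) \<and> \<not> \<beta> (e + F - 1))) \<and>
     (\<not> ov \<and> e + F < c + L \<and> s (Suc e) \<longrightarrow> \<not> (\<beta> e \<and> \<not> \<beta> (e + F))) \<and>
     (e + F = c + L \<longrightarrow> s e \<and> (\<forall>j. e \<le> j \<and> j < e + F \<longrightarrow> \<beta> j))"

lemma block_okD:
  assumes "block_ok ov c L F \<beta> s e" "e + F < c + L"
  shows "s (e + F) \<Longrightarrow> \<beta> (e + F) \<noteq> \<beta> e"
    and "2 \<le> e \<Longrightarrow> \<not> s (e + F) \<Longrightarrow> \<beta> (e + F) \<noteq> \<beta> e \<longleftrightarrow> \<beta> (e - 1) \<and> \<not> \<beta> (e + F - 1)"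
    and "\<not> ov \<Longrightarrow> s (Suc e) \<Longrightarrow> \<not> (\<beta> e \<and> \<not> \<beta> (e + F))"
  using assms unfolding block_ok_def by blast+

text \<open>The first window and the copying of marks force the marks to have period
  \<open>F\<close>. The last window begins at a mark, so \<open>F\<close> divides \<open>L\<close>,
  and the cells can be rearranged into a sequence of numbers to which \<open>counts\<close>
  applies.\<close>

lemma blocks_ok_imp:
  assumes F: "F > 0" "F \<le> L" and c: "c \<ge> 1"
    and ok: "\<And>e. c \<le> e \<Longrightarrow> e + F \<le> c + L \<Longrightarrow> block_ok ov c L F \<beta> s e"
  shows "F * 2 ^ F dvd L" and "\<not> ov \<Longrightarrow> L = F * 2 ^ F"
proof -
  have "block_ok ov c L F \<beta> s c" by (rule ok) (use F in simp_all)
  then have *: "s c" "\<forall>j. c \<le> j \<and> j < c + F \<longrightarrow> \<not> \<beta> j \<and> (j = c \<or> \<not> s j)"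
    unfolding block_ok_def by simp_all
  have first: "\<not> \<beta> (c + j) \<and> (s (c + j) \<longleftrightarrow> j = 0)" if "j < F" for j
    using spec[OF *(2), of "c + j"] *(1) that by auto
  have s: "j < L \<Longrightarrow> s (c + j) \<longleftrightarrow> F dvd j" for j
  proof (induction j rule: less_induct)
    case (less j)
    show ?case
    proof (cases "j < F")
      case True
      with first have "s (c + j) \<longleftrightarrow> j = 0" by simp
      with True show ?thesis by (auto dest: dvd_imp_le)
    next
      case False
      have "block_ok ov c L F \<beta> s (c + (j - F))" by (rule ok) (use False less.prems in simp_all)
      then have "s (c + (j - F)) \<longleftrightarrow> s (c + j)"
        unfolding block_ok_def using False less.prems by simp
      with less.IH[of "j - F"] less.prems False F show ?thesis
        by (auto simp: dvd_minus_self)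
    qed
  qed
  have "block_ok ov c L F \<beta> s (c + (L - F))" by (rule ok) (use F in simp_all)
  then have last: "s (c + (L - F))" "\<And>j. L - F \<le> j \<Longrightarrow> j < L \<Longrightarrow> \<beta> (c + j)"
    unfolding block_ok_def using F by simp_all
  have "F dvd L - F" using s[of "L - F"] last(1) F by simp
  then have "F dvd L" using F by (simp add: dvd_minus_self)
  then obtain T where T: "L = F * T" by (rule dvdE)
  then have "T > 0" using F by (cases T) auto
  define b where "b t i = \<beta> (c + (F * t + i))" for t i
  have step: "block_ok ov c L F \<beta> s (c + (F * t + i))" "c + (F * t + i) + F < c + L"
    "c + (F * t + i) + F = c + (F * Suc t + i)" "F * Suc t + i < L" if "Suc t < T" "i < F" for t i
  proof -
    have "F * Suc (Suc t) \<le> F * T" using that by (intro mult_le_mono2) simp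
    then show *: "F * Suc t + i < L" using that T by simp
    then show "c + (F * t + i) + F < c + L" "c + (F * t + i) + F = c + (F * Suc t + i)" by simp_all
    then show "block_ok ov c L F \<beta> s (c + (F * t + i))" by (intro ok) auto
  qed
  have "counts F T b"
    unfolding counts_def
  proof (intro conjI allI impI)
    fix i assume "i < F"
    then show "\<not> b 0 i" using first by (simp add: b_def)
  next
    fix t assume t: "Suc t < T"
    show "b (Suc t) 0 \<noteq> b t 0"
      using block_okD(1)[OF step(1,2)[OF t F(1)]] s[OF step(4)[OF t F(1)]]
      unfolding b_def step(3)[OF t F(1)] by simp
    fix i assume i: "Suc i < F"
    \<comment> \<open>A cell that does not start a block has its next lower digit immediately to its
      left, so the carry rule applies to it.\<close>
    have "\<not> F dvd F * Suc t + Suc i" using i by (metis dvd_add_right_iff dvd_imp_le dvd_triv_left not_le zero_less_Suc)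
    with s[OF step(4)[OF t i]] have "\<not> s (c + (F * t + Suc i) + F)"
      unfolding step(3)[OF t i] by blast
    moreover have "2 \<le> c + (F * t + Suc i)" using c by simp
    ultimately have "\<beta> (c + (F * t + Suc i) + F) \<noteq> \<beta> (c + (F * t + Suc i)) \<longleftrightarrow>
        \<beta> (c + (F * t + Suc i) - 1) \<and> \<not> \<beta> (c + (F * t + Suc i) + F - 1)"
      by (intro block_okD(2)[OF step(1,2)[OF t i]])
    then show "b (Suc t) (Suc i) \<noteq> b t (Suc i) \<longleftrightarrow> b t i \<and> \<not> b (Suc t) i"
      unfolding b_def step(3)[OF t i] by simp
  qed
  moreover have full: "b (T - 1) i" if "i < F" for i
  proof -
    have "F * (T - 1) = L - F" using T by (simp add: right_diff_distrib')
    with last(2)[of "L - F + i"] that F show ?thesis by (simp add: b_def)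
  qed
  ultimately show "F * 2 ^ F dvd L" using counts_dvd[of F T b] \<open>T > 0\<close> T by simp
  assume ov: "\<not> ov"
  have "\<not> (b t (F - 1) \<and> \<not> b (Suc t) (F - 1))" if t: "Suc t < T" for t
  proof -
    have l: "F - 1 < F" using F by simp
    \<comment> \<open>The highest digit is recognised by the mark on the cell to its right.\<close>
    have "Suc (c + (F * t + (F - 1))) = c + F * Suc t" using F by simp
    moreover have "s (c + F * Suc t)" using step(4)[OF t F(1)] s[of "F * Suc t"] by simp
    ultimately have "s (Suc (c + (F * t + (F - 1))))" by (simp only:)
    from block_okD(3)[OF step(1,2)[OF t l] ov this] show ?thesis
      unfolding b_def step(3)[OF t l] .
  qed
  with counts_eq_pow[OF \<open>counts F T b\<close> \<open>T > 0\<close> F(1) full] T show "L = F * 2 ^ F" by simp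
qed

lemma blocks_ok_exist:
  assumes F: "F > 0" and L: "F * 2 ^ F dvd L" "L > 0" and ov: "\<not> ov \<Longrightarrow> L = F * 2 ^ F"
    and e: "c \<le> e" "e + F \<le> c + L"
  shows "block_ok ov c L F (\<lambda>j. bit ((j - c) div F) ((j - c) mod F)) (\<lambda>j. F dvd j - c) e"
proof -
  obtain T where T: "L = F * T" "2 ^ F dvd T" "T > 0"
    using L by (auto elim!: dvdE simp: mult_ac)
  define x where "x = e - c"
  have x: "e = c + x" "x + F \<le> L" using e by (simp_all add: x_def)
  define t i where "t = x div F" and "i = x mod F"
  have xti: "x = F * t + i" "i < F" using F by (simp_all add: t_def i_def)
  have 1: "(x + F) div F = Suc t" "(x + F) mod F = i" using F by (simp_all add: t_def i_def)
  have 2: "(F dvd x) = (i = 0)" "(F dvd x + F) = (i = 0)" by (auto simp: i_def)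
  have 3: "(x - 1) div F = t \<and> (x - 1) mod F = i - 1 \<and> (x + F - 1) div F = Suc t \<and> (x + F - 1) mod F = i - 1"
    if "i \<noteq> 0"
  proof -
    have "x - 1 = F * t + (i - 1)" "x + F - 1 = F * Suc t + (i - 1)" using xti that by simp_all
    moreover have "(F * y + (i - 1)) div F = y \<and> (F * y + (i - 1)) mod F = i - 1" for y
      using xti by simp
    ultimately show ?thesis by metis
  qed
  have 4: "F dvd Suc x \<longleftrightarrow> i = F - 1"
  proof -
    have "Suc x = F * t + Suc i" using xti by simp
    then have "F dvd Suc x \<longleftrightarrow> F dvd Suc i" by (metis dvd_add_right_iff dvd_triv_left)
    also have "\<dots> \<longleftrightarrow> i = F - 1" using xti by (auto dest: dvd_imp_le)
    finally show ?thesis .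
  qed
  have flip: "bit (Suc t) i \<noteq> bit t i \<longleftrightarrow> bit t (i - 1) \<and> \<not> bit (Suc t) (i - 1)" if "i \<noteq> 0"
    using that bit_Suc_flip[of t "i - 1"] by simp
  have flip0: "bit (Suc t) 0 \<noteq> bit t 0" by (simp add: bit_0)
  have small: "(j - c) div F = 0 \<and> (F dvd j - c \<longleftrightarrow> j = c)" if "c \<le> j" "j < c + F" for j
    using that by (auto dest!: dvd_imp_le)
  \<comment> \<open>Without overflow there are exactly \<open>2 ^ F\<close> numbers, and among these
    the highest bit never falls.\<close>
  have A: "bit (Suc t) (F - 1)" if "\<not> ov" "x + F < L" "i = F - 1" "bit t (F - 1)"
  proof (rule bit_top_mono[OF _ that(4) F])
    have "F * Suc t < F * T" using that xti T by simp
    then have "Suc t < T" unfolding nat_mult_less_cancel1[OF F] .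
    moreover have "T = 2 ^ F" using ov[OF that(1)] T F by simp
    ultimately show "Suc t < 2 ^ F" by simp
  qed
  have B: "i = 0 \<and> (\<forall>j. e \<le> j \<and> j < e + F \<longrightarrow> bit ((j - c) div F) ((j - c) mod F))" if "x + F = L"
  proof -
    have "F dvd x" using that T by (metis dvd_add_left_iff dvd_triv_left dvd_refl)
    then have i: "i = 0" using 2 by simp
    have "F * Suc t = F * T" using that xti T i by simp
    then have "Suc t = T" unfolding nat_mult_eq_cancel1[OF F] .
    then have "T = Suc t" ..
    then have bits: "\<forall>i<F. bit t i" using T all_bits_iff_dvd_Suc[of F t] by simp
    have "bit ((j - c) div F) ((j - c) mod F)" if j: "e \<le> j" "j < e + F" for j
    proof -
      obtain y where y: "j - c = F * t + y" "y < F"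
        using j x xti i by (intro that[of "j - e"]) auto
      then show ?thesis using bits by simp
    qed
    with i show ?thesis by blast
  qed
  show ?thesis
    unfolding block_ok_def
  proof (intro conjI impI, goal_cases)
    case 2 then show ?case using small by auto
  next
    case 5 then show ?case using x 1 2 3 flip by (simp add: t_def[symmetric] i_def[symmetric])
  next
    case 6 then show ?case using x 1 4 A by (auto simp: t_def[symmetric] i_def[symmetric] Suc_diff_le)
  next
    case 7 then show ?case using x 2 B by simp
  next
    case 8 then show ?case using x B by simp
  qed (use x 1 2 flip0 in \<open>simp_all add: t_def[symmetric] i_def[symmetric]\<close>)
qed

section \<open>Counter formulas\<close>

abbreviation Imp :: "fm \<Rightarrow> fm \<Rightarrow> fm" where "Imp f g \<equiv> Disj (Neg f) g"
abbreviation Iff :: "fm \<Rightarrow> fm \<Rightarrow> fm" where "Iff f g \<equiv> Conj (Imp f g) (Imp g f)"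

text \<open>The first-order variable 9 is reserved for the auxiliary quantifiers of these formulas.\<close>

definition Top_Row :: "nat \<Rightarrow> fm" where "Top_Row x = Neg (ExF 9 (S1 9 x))"
definition Bottom_Row :: "nat \<Rightarrow> fm" where "Bottom_Row x = Neg (ExF 9 (S1 x 9))"
definition No_Left :: "nat \<Rightarrow> nat \<Rightarrow> fm" where "No_Left J x = Neg (ExF 9 (Conj (S2 9 x) (Mem J 9)))"
definition No_Right :: "nat \<Rightarrow> nat \<Rightarrow> fm" where "No_Right J x = Neg (ExF 9 (Conj (S2 x 9) (Mem J 9)))"
definition First_Top :: "nat \<Rightarrow> nat \<Rightarrow> fm" where "First_Top J x = Conj (Mem J x) (Conj (Top_Row x) (No_Left J x))"
definition Right_After :: "nat \<Rightarrow> nat \<Rightarrow> fm" where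
  "Right_After J x = Conj (Top_Row x) (Conj (Neg (Mem J x)) (Neg (No_Left J x)))"
definition Subset :: "nat \<Rightarrow> nat \<Rightarrow> fm" where "Subset J I = AllF 0 (Imp (Mem J 0) (Mem I 0))"
text \<open>The first part makes the set a union of full columns. The second asks for exactly one
  cell of the top row at which a run of columns begins, so the columns form one interval.\<close>

definition Strip :: "nat \<Rightarrow> fm" where
  "Strip I = Conj (AllF 0 (AllF 1 (Imp (S1 0 1) (Iff (Mem I 0) (Mem I 1)))))
     (ExF 0 (Conj (First_Top I 0) (AllF 1 (Imp (First_Top I 1) (Eq 1 0)))))"

definition strip :: "nat \<Rightarrow> nat \<Rightarrow> nat \<Rightarrow> pos set" where
  "strip m c L = {1..m} \<times> {c..<c + L}"

lemma sat_Top_Row: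
  assumes "x \<noteq> 9" "a x \<in> grid m n"
  shows "sat (grid m n) a A (Top_Row x) \<longleftrightarrow> fst (a x) = 1"
proof -
  obtain i j where ij: "a x = (i, j)" by (cases "a x")
  have "(\<exists>d\<in>grid m n. (i, j) = (fst d + 1, snd d)) \<longleftrightarrow> i \<noteq> 1"
  proof
    assume "i \<noteq> 1"
    with assms(2) ij show "\<exists>d\<in>grid m n. (i, j) = (fst d + 1, snd d)"
      by (intro bexI[of _ "(i - 1, j)"]) (auto simp: grid_def)
  qed (auto simp: grid_def)
  then show ?thesis using assms(1) ij by (simp add: Top_Row_def)
qed

lemma sat_Bottom_Row:
  assumes "x \<noteq> 9" "a x \<in> grid m n"
  shows "sat (grid m n) a A (Bottom_Row x) \<longleftrightarrow> fst (a x) = m"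
proof -
  obtain i j where ij: "a x = (i, j)" by (cases "a x")
  have "(\<exists>d\<in>grid m n. d = (i + 1, j)) \<longleftrightarrow> i \<noteq> m"
    using assms(2) ij by (auto simp: grid_def)
  then show ?thesis using assms(1) ij by (simp add: Bottom_Row_def)
qed

lemma sat_No_Left:
  assumes "x \<noteq> 9" "a x \<in> grid m n" "A J \<subseteq> grid m n"
  shows "sat (grid m n) a A (No_Left J x) \<longleftrightarrow> snd (a x) = 1 \<or> (fst (a x), snd (a x) - 1) \<notin> A J"
proof -
  obtain i j where ij: "a x = (i, j)" by (cases "a x")
  have "(\<exists>d\<in>grid m n. (i, j) = (fst d, snd d + 1) \<and> d \<in> A J) \<longleftrightarrow> j \<noteq> 1 \<and> (i, j - 1) \<in> A J"
  proof
    assume "j \<noteq> 1 \<and> (i, j - 1) \<in> A J"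
    with assms(2,3) ij show "\<exists>d\<in>grid m n. (i, j) = (fst d, snd d + 1) \<and> d \<in> A J"
      by (intro bexI[of _ "(i, j - 1)"]) (auto simp: grid_def)
  qed (auto simp: grid_def)
  then show ?thesis using assms(1) ij by (simp add: No_Left_def)
qed

lemma sat_No_Right:
  assumes "x \<noteq> 9" "A J \<subseteq> grid m n"
  shows "sat (grid m n) a A (No_Right J x) \<longleftrightarrow> (fst (a x), snd (a x) + 1) \<notin> A J"
proof -
  obtain i j where ij: "a x = (i, j)" by (cases "a x")
  have "(\<exists>d\<in>grid m n. d = (i, j + 1) \<and> d \<in> A J) \<longleftrightarrow> (i, j + 1) \<in> A J"
    using assms(2) by auto
  then show ?thesis using assms(1) ij by (simp add: No_Right_def)
qed

lemma strip_subset_grid: "1 \<le> c \<Longrightarrow> c + L \<le> n + 1 \<Longrightarrow> strip m c L \<subseteq> grid m n"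
  by (auto simp: strip_def grid_def)

lemma sat_First_Top:
  assumes "x \<noteq> 9" "a x \<in> grid m n" "A J = strip m e F" "1 \<le> e" "1 \<le> F" "e + F \<le> n + 1"
  shows "sat (grid m n) a A (First_Top J x) \<longleftrightarrow> a x = (1, e)"
proof -
  have "A J \<subseteq> grid m n" using strip_subset_grid assms by simp
  from sat_Top_Row[of x a, OF assms(1,2)] sat_No_Left[of x a m n A J, OF assms(1,2) this] show ?thesis
    using assms(2-) by (cases "a x") (auto simp: First_Top_def strip_def grid_def)
qed

lemma sat_Right_After:
  assumes "x \<noteq> 9" "a x \<in> grid m n" "A J = strip m e F" "1 \<le> e" "1 \<le> F" "e + F \<le> n + 1"
  shows "sat (grid m n) a A (Right_After J x) \<longleftrightarrow> a x = (1, e + F)"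
proof -
  have "A J \<subseteq> grid m n" using strip_subset_grid assms by simp
  from sat_Top_Row[of x a, OF assms(1,2)] sat_No_Left[of x a m n A J, OF assms(1,2) this] show ?thesis
    using assms(2-) by (cases "a x") (auto simp: Right_After_def strip_def grid_def)
qed

lemma sat_Strip:
  assumes m: "m \<ge> 1" and I: "A I \<subseteq> grid m n"
  shows "sat (grid m n) a A (Strip I) \<longleftrightarrow> (\<exists>c L. 1 \<le> c \<and> 1 \<le> L \<and> c + L \<le> n + 1 \<and> A I = strip m c L)"
    (is "?L \<longleftrightarrow> ?R")
proof -
  have first: "sat (grid m n) b A (First_Top I x) \<longleftrightarrow> b x \<in> A I \<and> fst (b x) = 1 \<and>
      (snd (b x) = 1 \<or> (1, snd (b x) - 1) \<notin> A I)" if "b x \<in> grid m n" "x \<noteq> 9" for b x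
    using sat_Top_Row[of x b, OF that(2,1)] sat_No_Left[of x b m n A I, OF that(2,1) I] by (auto simp: First_Top_def)
  have eq: "?L \<longleftrightarrow> (\<forall>p\<in>grid m n. \<forall>q\<in>grid m n. q = (fst p + 1, snd p) \<longrightarrow> (p \<in> A I \<longleftrightarrow> q \<in> A I)) \<and>
      (\<exists>p\<in>grid m n. p \<in> A I \<and> fst p = 1 \<and> (snd p = 1 \<or> (1, snd p - 1) \<notin> A I) \<and>
        (\<forall>q\<in>grid m n. q \<in> A I \<and> fst q = 1 \<and> (snd q = 1 \<or> (1, snd q - 1) \<notin> A I) \<longrightarrow> q = p))"
    unfolding Strip_def by (simp add: first cong: bex_cong_simp ball_cong_simp) blast
  show ?thesis
  proof
    assume ?L
    then have down: "\<And>p q. p \<in> grid m n \<Longrightarrow> q \<in> grid m n \<Longrightarrow> q = (fst p + 1, snd p) \<Longrightarrow> p \<in> A I \<longleftrightarrow> q \<in> A I"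
      and "\<exists>p\<in>grid m n. p \<in> A I \<and> fst p = 1 \<and> (snd p = 1 \<or> (1, snd p - 1) \<notin> A I) \<and>
        (\<forall>q\<in>grid m n. q \<in> A I \<and> fst q = 1 \<and> (snd q = 1 \<or> (1, snd q - 1) \<notin> A I) \<longrightarrow> q = p)"
      unfolding eq by blast+
    then obtain p where p: "p \<in> A I" "fst p = 1"
      and uniq_p: "\<And>q. q \<in> grid m n \<Longrightarrow> q \<in> A I \<Longrightarrow> fst q = 1 \<Longrightarrow> snd q = 1 \<or> (1, snd q - 1) \<notin> A I \<Longrightarrow> q = p"
      by blast
    define c where "c = snd p"
    have p_eq: "p = (1, c)" using p(2) by (cases p) (simp add: c_def)
    then have c: "(1, c) \<in> A I" using p(1) by simp
    have uniq: "j = c" if "(1, j) \<in> A I" "j = 1 \<or> (1, j - 1) \<notin> A I" for j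
    proof -
      have "(1, j) = p" by (rule uniq_p) (use that I in auto)
      then show ?thesis using p_eq by simp
    qed
    have cols: "1 \<le> i \<Longrightarrow> i \<le> m \<Longrightarrow> (i, j) \<in> A I \<longleftrightarrow> (1, j) \<in> A I" for i j
    proof (induction i)
      case (Suc i)
      show ?case
      proof (cases "i \<noteq> 0 \<and> 1 \<le> j \<and> j \<le> n")
        case True
        then have "(i, j) \<in> grid m n" "(Suc i, j) \<in> grid m n"
          using Suc.prems by (simp_all add: grid_def)
        from down[OF this] have "(i, j) \<in> A I \<longleftrightarrow> (Suc i, j) \<in> A I" by simp
        with Suc.IH Suc.prems True show ?thesis by simp
      next
        case False
        then show ?thesis using I by (auto simp: grid_def)
      qed
    qed simp
    define M where "M = {j. (1, j) \<in> A I}"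
    have M: "M \<subseteq> {1..n}" "c \<in> M" using I c by (auto simp: M_def grid_def)
    have finM: "finite M" using M(1) finite_subset by blast
    \<comment> \<open>Walking left from a column of \<open>M\<close>, one leaves \<open>M\<close>
      only where a run begins, and \<open>c\<close> is the only such place.\<close>
    have min: "j \<ge> c \<and> {c..j} \<subseteq> M" if "j \<in> M" for j
      using that
    proof (induction j rule: less_induct)
      case (less j)
      show ?case
      proof (cases "j = 1 \<or> j - 1 \<notin> M")
        case True
        then have "j = c" using uniq[of j] less.prems by (auto simp: M_def)
        then show ?thesis using less.prems by simp
      next
        case False
        then have "j - 1 < j" "j - 1 \<in> M" using M(1) less.prems by auto
        from less.IH[OF this] have "c \<le> j - 1" "{c..j - 1} \<subseteq> M" by auto
        moreover have "{c..j} \<subseteq> insert j {c..j - 1}" by auto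
        ultimately show ?thesis using less.prems by auto
      qed
    qed
    define L where "L = Suc (Max M) - c"
    have "Max M \<in> M" using finM M(2) by (intro Max_in) auto
    then have "{c..Max M} \<subseteq> M" "c \<le> Max M" "Max M \<le> n" using min M(1) by auto
    moreover have "M \<subseteq> {c..Max M}" using min finM by auto
    ultimately have "M = {c..Max M}" "c \<le> Max M" "Max M \<le> n" by blast+
    moreover from this have "c + L = Suc (Max M)" by (simp add: L_def)
    ultimately have "M = {c..<c + L}" "1 \<le> L" "c + L \<le> n + 1" by (simp_all add: atLeastLessThanSuc_atLeastAtMost)
    moreover have "A I = {1..m} \<times> M"
    proof -
      have "p \<in> A I \<longleftrightarrow> p \<in> {1..m} \<times> M" for p
      proof (cases p)
        case (Pair i j)
        show ?thesis
        proof (cases "1 \<le> i \<and> i \<le> m")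
          case True
          then show ?thesis using cols[of i j] Pair by (simp add: M_def)
        next
          case False
          then show ?thesis using I Pair by (auto simp: grid_def)
        qed
      qed
      then show ?thesis by blast
    qed
    moreover have "1 \<le> c" using M by auto
    ultimately show ?R unfolding strip_def by blast
  next
    assume ?R
    then obtain c L where cL: "1 \<le> c" "1 \<le> L" "c + L \<le> n + 1" and A: "A I = strip m c L" by blast
    show ?L unfolding eq A
    proof (intro conjI bexI[of _ "(1, c)"])
      show "(1, c) \<in> grid m n" using cL m by (auto simp: grid_def)
    qed (use cL m in \<open>auto simp: strip_def grid_def\<close>)
  qed
qed

lemma sat_Subset: "A J \<subseteq> grid m n \<Longrightarrow> sat (grid m n) a A (Subset J I) \<longleftrightarrow> A J \<subseteq> A I"
  by (auto simp: Subset_def)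

text \<open>\<open>J\<close> is the ruler: its left end and the cell right after it give first-order
  access to distance \<open>F\<close>. Bits and marks are read in the top row. The conjuncts
  correspond to the clauses of \<open>block_ok\<close>, with \<open>Eq 0 0\<close> as truth.\<close>

definition Block_Conditions :: "bool \<Rightarrow> nat \<Rightarrow> nat \<Rightarrow> nat \<Rightarrow> nat \<Rightarrow> fm" where
  "Block_Conditions ov I B S J =
     Conj (AllF 0 (Imp (Conj (First_Top J 0) (First_Top I 0))
       (Conj (Mem S 0) (AllF 1 (Imp (Conj (Mem J 1) (Top_Row 1))
          (Conj (Neg (Mem B 1)) (Disj (Eq 1 0) (Neg (Mem S 1)))))))))
    (Conj (AllF 0 (AllF 1 (Imp (Conj (First_Top J 0) (Conj (Right_After J 1) (Mem I 1)))
       (Conj (Iff (Mem S 0) (Mem S 1)) (Imp (Mem S 1) (Iff (Mem B 1) (Neg (Mem B 0))))))))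
    (Conj (AllF 0 (AllF 1 (AllF 2 (AllF 3 (Imp (Conj (First_Top J 0) (Conj (Right_After J 1) (Conj (Mem I 1)
         (Conj (S2 2 0) (Conj (S2 3 1) (Neg (Mem S 1)))))))
       (Iff (Iff (Mem B 1) (Neg (Mem B 0))) (Conj (Mem B 2) (Neg (Mem B 3)))))))))
    (Conj (AllF 0 (AllF 1 (AllF 2 (Imp (Conj (First_Top J 0) (Conj (Right_After J 1) (Conj (Mem I 1)
         (Conj (S2 0 2) (Mem S 2)))))
       (if ov then Eq 0 0 else Imp (Mem B 0) (Mem B 1))))))
    (AllF 0 (Imp (Conj (First_Top J 0) (Neg (ExF 1 (Conj (Right_After J 1) (Mem I 1)))))
       (Conj (Mem S 0) (AllF 1 (Imp (Conj (Mem J 1) (Top_Row 1)) (Mem B 1)))))))))"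

lemma sat_Block_Conditions:
  assumes "m \<ge> 1" and I: "A I = strip m c L" and J: "A J = strip m e F"
    and le: "1 \<le> c" "c \<le> e" "1 \<le> F" "e + F \<le> c + L" "c + L \<le> n + 1"
  shows "sat (grid m n) a A (Block_Conditions ov I B S J) \<longleftrightarrow>
    block_ok ov c L F (\<lambda>j. (1, j) \<in> A B) (\<lambda>j. (1, j) \<in> A S) e"
proof -
  have FJ: "sat (grid m n) b A (First_Top J x) \<longleftrightarrow> b x = (1, e)" if "x \<noteq> 9" "b x \<in> grid m n" for b x
    by (rule sat_First_Top[of x b m n A J, OF that J]) (use le in auto)
  have FI: "sat (grid m n) b A (First_Top I x) \<longleftrightarrow> b x = (1, c)" if "x \<noteq> 9" "b x \<in> grid m n" for b x
    by (rule sat_First_Top[of x b m n A I, OF that I]) (use le in auto)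
  have AJ: "sat (grid m n) b A (Right_After J x) \<longleftrightarrow> b x = (1, e + F)" if "x \<noteq> 9" "b x \<in> grid m n" for b x
    by (rule sat_Right_After[of x b m n A J, OF that J]) (use le in auto)
  have mem: "(1, j) \<in> A I \<longleftrightarrow> c \<le> j \<and> j < c + L" "(1, j) \<in> A J \<longleftrightarrow> e \<le> j \<and> j < e + F"
    "(1, j) \<in> grid m n \<longleftrightarrow> 1 \<le> j \<and> j \<le> n" for j
    using \<open>m \<ge> 1\<close> by (auto simp: I J strip_def grid_def)
  have e: "(1, e) \<in> grid m n" unfolding mem using le by simp
  have row: "(\<forall>q\<in>grid m n. q \<in> A J \<and> fst q = 1 \<longrightarrow> P q) \<longleftrightarrow> (\<forall>j. e \<le> j \<and> j < e + F \<longrightarrow> P (1, j))" for P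
  proof -
    have "A J \<subseteq> grid m n" unfolding J by (rule strip_subset_grid) (use le in auto)
    then have "(\<forall>q\<in>grid m n. q \<in> A J \<and> fst q = 1 \<longrightarrow> P q) \<longleftrightarrow> (\<forall>j. (1, j) \<in> A J \<longrightarrow> P (1, j))" by auto
    then show ?thesis unfolding mem .
  qed
  have one: "(\<forall>q\<in>grid m n. q = p \<longrightarrow> P q) \<longleftrightarrow> (p \<in> grid m n \<longrightarrow> P p)" for p P by auto
  have 1: "sat (grid m n) a A (AllF 0 (Imp (Conj (First_Top J 0) (First_Top I 0))
       (Conj (Mem S 0) (AllF 1 (Imp (Conj (Mem J 1) (Top_Row 1))
          (Conj (Neg (Mem B 1)) (Disj (Eq 1 0) (Neg (Mem S 1))))))))) \<longleftrightarrow>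
      (\<forall>p\<in>grid m n. p = (1, e) \<longrightarrow> p = (1, c) \<longrightarrow> p \<in> A S \<and>
        (\<forall>q\<in>grid m n. q \<in> A J \<and> fst q = 1 \<longrightarrow> q \<notin> A B \<and> (q = p \<or> q \<notin> A S)))"
    (is "sat _ _ _ ?f1 \<longleftrightarrow> _")
    by (simp add: FJ FI AJ sat_Top_Row cong: bex_cong_simp ball_cong_simp) blast
  have 2: "sat (grid m n) a A (AllF 0 (AllF 1 (Imp (Conj (First_Top J 0) (Conj (Right_After J 1) (Mem I 1)))
       (Conj (Iff (Mem S 0) (Mem S 1)) (Imp (Mem S 1) (Iff (Mem B 1) (Neg (Mem B 0)))))))) \<longleftrightarrow>
      (\<forall>p\<in>grid m n. p = (1, e) \<longrightarrow> (\<forall>q\<in>grid m n. q = (1, e + F) \<longrightarrow> q \<in> A I \<longrightarrow>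
        (p \<in> A S \<longleftrightarrow> q \<in> A S) \<and> (q \<in> A S \<longrightarrow> (q \<in> A B \<longleftrightarrow> p \<notin> A B))))"
    (is "sat _ _ _ ?f2 \<longleftrightarrow> _")
    by (simp add: FJ FI AJ sat_Top_Row cong: bex_cong_simp ball_cong_simp) blast
  have 3: "sat (grid m n) a A (AllF 0 (AllF 1 (AllF 2 (AllF 3 (Imp (Conj (First_Top J 0) (Conj (Right_After J 1) (Conj (Mem I 1)
         (Conj (S2 2 0) (Conj (S2 3 1) (Neg (Mem S 1)))))))
       (Iff (Iff (Mem B 1) (Neg (Mem B 0))) (Conj (Mem B 2) (Neg (Mem B 3))))))))) \<longleftrightarrow>
      (\<forall>p\<in>grid m n. \<forall>q\<in>grid m n. \<forall>p'\<in>grid m n. \<forall>q'\<in>grid m n.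
        p = (1, e) \<and> q = (1, e + F) \<and> q \<in> A I \<and> p = (fst p', snd p' + 1) \<and> q = (fst q', snd q' + 1) \<and> q \<notin> A S \<longrightarrow>
        ((q \<in> A B) \<noteq> (p \<in> A B) \<longleftrightarrow> p' \<in> A B \<and> q' \<notin> A B))"
    (is "sat _ _ _ ?f3 \<longleftrightarrow> _")
    unfolding sat.simps(9) by (intro ball_cong refl) (auto simp: FJ AJ)
  have 4: "sat (grid m n) a A (AllF 0 (AllF 1 (AllF 2 (Imp (Conj (First_Top J 0) (Conj (Right_After J 1) (Conj (Mem I 1)
         (Conj (S2 0 2) (Mem S 2)))))
       (if ov then Eq 0 0 else Imp (Mem B 0) (Mem B 1)))))) \<longleftrightarrow>
      (\<forall>p\<in>grid m n. p = (1, e) \<longrightarrow> (\<forall>q\<in>grid m n. q = (1, e + F) \<longrightarrow> q \<in> A I \<longrightarrow>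
        (\<forall>r\<in>grid m n. r = (fst p, Suc (snd p)) \<longrightarrow> r \<in> A S \<longrightarrow> ov \<or> (p \<in> A B \<longrightarrow> q \<in> A B))))"
    (is "sat _ _ _ ?f4 \<longleftrightarrow> _")
    by (cases ov) (simp_all add: FJ FI AJ sat_Top_Row cong: bex_cong_simp ball_cong_simp, blast)
  have 5: "sat (grid m n) a A (AllF 0 (Imp (Conj (First_Top J 0) (Neg (ExF 1 (Conj (Right_After J 1) (Mem I 1)))))
       (Conj (Mem S 0) (AllF 1 (Imp (Conj (Mem J 1) (Top_Row 1)) (Mem B 1)))))) \<longleftrightarrow>
      (\<forall>p\<in>grid m n. p = (1, e) \<longrightarrow> \<not> (\<exists>q\<in>grid m n. q = (1, e + F) \<and> q \<in> A I) \<longrightarrow> p \<in> A S \<and>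
        (\<forall>q\<in>grid m n. q \<in> A J \<and> fst q = 1 \<longrightarrow> q \<in> A B))"
    (is "sat _ _ _ ?f5 \<longleftrightarrow> _")
    by (simp add: FJ FI AJ sat_Top_Row cong: bex_cong_simp ball_cong_simp) blast
  have in_grid: "(1, Suc e) \<in> grid m n \<and> (1, e + F) \<in> grid m n" if "e + F < c + L"
    unfolding mem using that le by auto
  have in_I: "(1, e + F) \<in> A I \<longleftrightarrow> e + F < c + L" unfolding mem using le by auto
  \<comment> \<open>The ruler determines the end points over which the formulas quantify, so each
    conjunct collapses to a statement about column numbers.\<close>
  have 1: "sat (grid m n) a A ?f1 \<longleftrightarrow> (e = c \<longrightarrow> (1, e) \<in> A S \<and>
      (\<forall>j. e \<le> j \<and> j < e + F \<longrightarrow> (1, j) \<notin> A B \<and> (j = e \<or> (1, j) \<notin> A S)))"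
    unfolding 1 row one using e by auto
  have 2: "sat (grid m n) a A ?f2 \<longleftrightarrow> (e + F < c + L \<longrightarrow> ((1, e) \<in> A S \<longleftrightarrow> (1, e + F) \<in> A S) \<and>
      ((1, e + F) \<in> A S \<longrightarrow> ((1, e + F) \<in> A B) \<noteq> ((1, e) \<in> A B)))"
    unfolding 2 one in_I using e in_grid by blast
  have 3: "sat (grid m n) a A ?f3 \<longleftrightarrow> (e + F < c + L \<and> 2 \<le> e \<and> (1, e + F) \<notin> A S \<longrightarrow>
      (((1, e + F) \<in> A B) \<noteq> ((1, e) \<in> A B) \<longleftrightarrow> (1, e - 1) \<in> A B \<and> (1, e + F - 1) \<notin> A B))"
    unfolding 3
  proof (rule iffI, rule impI)
    assume *: "\<forall>p\<in>grid m n. \<forall>q\<in>grid m n. \<forall>p'\<in>grid m n. \<forall>q'\<in>grid m n.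
        p = (1, e) \<and> q = (1, e + F) \<and> q \<in> A I \<and> p = (fst p', snd p' + 1) \<and> q = (fst q', snd q' + 1) \<and> q \<notin> A S \<longrightarrow>
        ((q \<in> A B) \<noteq> (p \<in> A B) \<longleftrightarrow> p' \<in> A B \<and> q' \<notin> A B)"
      and c: "e + F < c + L \<and> 2 \<le> e \<and> (1, e + F) \<notin> A S"
    have "(1, e - 1) \<in> grid m n" "(1, e + F - 1) \<in> grid m n" unfolding mem using c le by auto
    then show "((1, e + F) \<in> A B) \<noteq> ((1, e) \<in> A B) \<longleftrightarrow> (1, e - 1) \<in> A B \<and> (1, e + F - 1) \<notin> A B"
      by (rule *[rule_format, OF e conjunct2[OF in_grid[OF conjunct1[OF c]]]]) (use c in_I in auto)
  next
    assume *: "e + F < c + L \<and> 2 \<le> e \<and> (1, e + F) \<notin> A S \<longrightarrow>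
      (((1, e + F) \<in> A B) \<noteq> ((1, e) \<in> A B) \<longleftrightarrow> (1, e - 1) \<in> A B \<and> (1, e + F - 1) \<notin> A B)"
    show "\<forall>p\<in>grid m n. \<forall>q\<in>grid m n. \<forall>p'\<in>grid m n. \<forall>q'\<in>grid m n.
        p = (1, e) \<and> q = (1, e + F) \<and> q \<in> A I \<and> p = (fst p', snd p' + 1) \<and> q = (fst q', snd q' + 1) \<and> q \<notin> A S \<longrightarrow>
        ((q \<in> A B) \<noteq> (p \<in> A B) \<longleftrightarrow> p' \<in> A B \<and> q' \<notin> A B)"
    proof (intro ballI impI, elim conjE)
      fix p q p' q'
      assume g: "p' \<in> grid m n" "p = (1, e)" "q = (1, e + F)" "q \<in> A I" "q \<notin> A S"
        and p: "p = (fst p', snd p' + 1)" "q = (fst q', snd q' + 1)"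
      have "p' = (1, e - 1)" "q' = (1, e + F - 1)" using p g by (cases p'; cases q'; auto)+
      moreover have "2 \<le> e" using p(1) g(1,2) by (cases p') (auto simp: grid_def)
      ultimately show "(q \<in> A B) \<noteq> (p \<in> A B) \<longleftrightarrow> p' \<in> A B \<and> q' \<notin> A B"
        using * g in_I by simp
    qed
  qed
  have 4: "sat (grid m n) a A ?f4 \<longleftrightarrow> (\<not> ov \<and> e + F < c + L \<and> (1, Suc e) \<in> A S \<longrightarrow>
      \<not> ((1, e) \<in> A B \<and> (1, e + F) \<notin> A B))"
    unfolding 4 one in_I fst_conv snd_conv using e in_grid by blast
  have "(\<exists>q\<in>grid m n. q = (1, e + F) \<and> q \<in> A I) \<longleftrightarrow> e + F \<noteq> c + L"
    using in_I in_grid le by auto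
  then have 5: "sat (grid m n) a A ?f5 \<longleftrightarrow> (e + F = c + L \<longrightarrow> (1, e) \<in> A S \<and>
      (\<forall>j. e \<le> j \<and> j < e + F \<longrightarrow> (1, j) \<in> A B))"
    unfolding 5 row one using e by blast
  show ?thesis
    unfolding Block_Conditions_def sat.simps(6) 1 2 3 4 5 block_ok_def ..
qed

text \<open>Bits and marks are subsets of the grid, whereas the standard counter is a function on
  all numbers. A window inside the strip reads columns 1 to \<open>n\<close> only.\<close>

lemma block_ok_cong:
  assumes eq: "\<And>j. 1 \<le> j \<Longrightarrow> j \<le> n \<Longrightarrow> \<beta> j = \<beta>' j" "\<And>j. 1 \<le> j \<Longrightarrow> j \<le> n \<Longrightarrow> s j = s' j"
    and le: "1 \<le> c" "c \<le> e" "1 \<le> F" "e + F \<le> c + L" "c + L \<le> n + 1"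
  shows "block_ok ov c L F \<beta> s e = block_ok ov c L F \<beta>' s' e"
proof -
  have 1: "\<beta> e = \<beta>' e" "s e = s' e" using eq[of e] le by simp_all
  have 2: "\<beta> j = \<beta>' j" "s j = s' j" if "e \<le> j" "j < e + F" for j using eq[of j] le that by simp_all
  have 3: "\<beta> (e + F) = \<beta>' (e + F)" "s (e + F) = s' (e + F)" "s (Suc e) = s' (Suc e)" if "e + F < c + L"
    using eq[of "e + F"] eq[of "Suc e"] le that by simp_all
  have 4: "\<beta> (e - 1) = \<beta>' (e - 1)" "\<beta> (e + F - 1) = \<beta>' (e + F - 1)" if "e + F < c + L" "2 \<le> e"
    using eq[of "e - 1"] eq[of "e + F - 1"] le that by simp_all
  show ?thesis unfolding block_ok_def using 1 2 3 4 by (smt (verit))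
qed

text \<open>\<open>g\<close> says that \<open>J\<close> is a strip of the ruler's length. The
  negated existential runs through all placements of the ruler in \<open>I\<close>; the first
  conjunct provides at least one placement, as otherwise a short strip would pass vacuously.\<close>

definition Block_Counter :: "bool \<Rightarrow> fm \<Rightarrow> nat \<Rightarrow> nat \<Rightarrow> nat \<Rightarrow> nat \<Rightarrow> fm" where
  "Block_Counter ov g I B S J = ExS B (ExS S (Conj (ExS J (Conj g (Subset J I)))
     (Neg (ExS J (Conj g (Conj (Subset J I) (Neg (Block_Conditions ov I B S J))))))))"

lemma sat_Block_Counter:
  assumes g: "\<And>a A. A J \<subseteq> grid m n \<Longrightarrow> sat (grid m n) a A g \<longleftrightarrow>
      (\<exists>e. 1 \<le> e \<and> e + F \<le> n + 1 \<and> A J = strip m e F)"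
    and dist: "distinct [I, B, S, J]" and I: "A I = strip m c L"
    and le: "1 \<le> m" "1 \<le> F" "1 \<le> c" "1 \<le> L" "c + L \<le> n + 1"
  shows "sat (grid m n) a A (Block_Counter ov g I B S J) \<longleftrightarrow> F * 2 ^ F dvd L \<and> (ov \<or> L = F * 2 ^ F)"
    (is "?L \<longleftrightarrow> ?R")
proof -
  have neq: "I \<noteq> B" "I \<noteq> S" "I \<noteq> J" "B \<noteq> S" "B \<noteq> J" "S \<noteq> J"
    "B \<noteq> I" "S \<noteq> I" "J \<noteq> I" "S \<noteq> B" "J \<noteq> B" "J \<noteq> S" using dist by auto
  have sub: "strip m e F \<subseteq> strip m c L \<longleftrightarrow> c \<le> e \<and> e + F \<le> c + L" for e
  proof
    assume "strip m e F \<subseteq> strip m c L"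
    moreover have "(1, e) \<in> strip m e F" "(1, e + F - 1) \<in> strip m e F" using le by (auto simp: strip_def)
    ultimately have "(1, e) \<in> strip m c L" "(1, e + F - 1) \<in> strip m c L" by blast+
    then show "c \<le> e \<and> e + F \<le> c + L" using le by (auto simp: strip_def)
  qed (auto simp: strip_def)
  have strip_grid: "strip m e F \<subseteq> grid m n" if "c \<le> e" "e + F \<le> c + L" for e
    by (rule strip_subset_grid) (use that le in auto)
  define A2 where "A2 MB MS M = A(B := MB, S := MS, J := M)" for MB MS M
  have A2: "A2 MB MS M I = strip m c L" "A2 MB MS M J = M" "A2 MB MS M B = MB" "A2 MB MS M S = MS" for MB MS M
    using neq I by (simp_all add: A2_def)
  have ex: "(\<exists>M\<subseteq>grid m n. sat (grid m n) a (A2 MB MS M) (Conj g (Subset J I))) \<longleftrightarrow> F \<le> L" for MB MS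
  proof -
    have eq: "sat (grid m n) a (A2 MB MS M) (Conj g (Subset J I)) \<longleftrightarrow>
        (\<exists>e. 1 \<le> e \<and> e + F \<le> n + 1 \<and> M = strip m e F) \<and> M \<subseteq> strip m c L" if "M \<subseteq> grid m n" for M
      using that by (simp add: g sat_Subset A2)
    have "(\<exists>M\<subseteq>grid m n. sat (grid m n) a (A2 MB MS M) (Conj g (Subset J I))) \<longleftrightarrow>
        (\<exists>M\<subseteq>grid m n. (\<exists>e. 1 \<le> e \<and> e + F \<le> n + 1 \<and> M = strip m e F) \<and> M \<subseteq> strip m c L)"
      by (intro ex_cong1 conj_cong refl eq)
    also have "\<dots> \<longleftrightarrow> F \<le> L"
    proof
      assume "\<exists>M\<subseteq>grid m n. (\<exists>e. 1 \<le> e \<and> e + F \<le> n + 1 \<and> M = strip m e F) \<and> M \<subseteq> strip m c L"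
      then show "F \<le> L" using sub by force
    next
      assume "F \<le> L"
      then have "strip m c F \<subseteq> strip m c L" "strip m c F \<subseteq> grid m n"
        using sub strip_grid by auto
      then show "\<exists>M\<subseteq>grid m n. (\<exists>e. 1 \<le> e \<and> e + F \<le> n + 1 \<and> M = strip m e F) \<and> M \<subseteq> strip m c L"
        using le \<open>F \<le> L\<close> by (intro exI[of _ "strip m c F"]) auto
    qed
    finally show ?thesis .
  qed
  have all: "\<not> (\<exists>M\<subseteq>grid m n. sat (grid m n) a (A2 MB MS M) (Conj g (Conj (Subset J I) (Neg (Block_Conditions ov I B S J))))) \<longleftrightarrow>
      (\<forall>e. c \<le> e \<longrightarrow> e + F \<le> c + L \<longrightarrow> block_ok ov c L F (\<lambda>j. (1, j) \<in> MB) (\<lambda>j. (1, j) \<in> MS) e)"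
    (is "\<not> ?ex \<longleftrightarrow> ?all") for MB MS
  proof -
    have body: "sat (grid m n) a (A2 MB MS (strip m e F)) (Block_Conditions ov I B S J) \<longleftrightarrow>
      block_ok ov c L F (\<lambda>j. (1, j) \<in> MB) (\<lambda>j. (1, j) \<in> MS) e" if "c \<le> e" "e + F \<le> c + L" for e
      using sat_Block_Conditions[of m "A2 MB MS (strip m e F)" I c L J e F n a ov B S] that le by (simp only: A2)
    have "?ex \<longleftrightarrow> (\<exists>e. c \<le> e \<and> e + F \<le> c + L \<and>
        \<not> sat (grid m n) a (A2 MB MS (strip m e F)) (Block_Conditions ov I B S J))"
    proof
      assume ?ex
      then obtain M where M: "M \<subseteq> grid m n" "sat (grid m n) a (A2 MB MS M) g"
        "sat (grid m n) a (A2 MB MS M) (Subset J I)"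
        "\<not> sat (grid m n) a (A2 MB MS M) (Block_Conditions ov I B S J)" by auto
      then obtain e where "M = strip m e F" by (auto simp: g A2)
      moreover from M this have "c \<le> e \<and> e + F \<le> c + L" by (simp add: sat_Subset A2 sub)
      ultimately show "\<exists>e. c \<le> e \<and> e + F \<le> c + L \<and>
        \<not> sat (grid m n) a (A2 MB MS (strip m e F)) (Block_Conditions ov I B S J)" using M(4) by blast
    next
      assume "\<exists>e. c \<le> e \<and> e + F \<le> c + L \<and>
        \<not> sat (grid m n) a (A2 MB MS (strip m e F)) (Block_Conditions ov I B S J)"
      then obtain e where e: "c \<le> e" "e + F \<le> c + L"
        "\<not> sat (grid m n) a (A2 MB MS (strip m e F)) (Block_Conditions ov I B S J)" by blast
      moreover have "sat (grid m n) a (A2 MB MS (strip m e F)) g"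
      proof (subst g)
        show "\<exists>e'\<ge>1. e' + F \<le> n + 1 \<and> A2 MB MS (strip m e F) J = strip m e' F"
          using e(1,2) le by (intro exI[of _ e]) (simp add: A2)
      qed (simp add: A2 strip_grid[OF e(1,2)])
      moreover have "sat (grid m n) a (A2 MB MS (strip m e F)) (Subset J I)"
        using strip_grid[OF e(1,2)] e by (simp add: sat_Subset A2 sub)
      ultimately show ?ex using strip_grid[OF e(1,2)] by (intro exI[of _ "strip m e F"]) simp
    qed
    then show ?thesis using body by blast
  qed
  define ok where "ok (MB :: pos set) (MS :: pos set) \<longleftrightarrow> (\<forall>e. c \<le> e \<longrightarrow> e + F \<le> c + L \<longrightarrow>
    block_ok ov c L F (\<lambda>j. (1, j) \<in> MB) (\<lambda>j. (1, j) \<in> MS) e)" for MB MS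
  have L: "?L \<longleftrightarrow> (\<exists>MB\<subseteq>grid m n. \<exists>MS\<subseteq>grid m n. F \<le> L \<and> ok MB MS)"
    unfolding Block_Counter_def sat.simps(10)[of _ _ _ B] sat.simps(10)[of _ _ _ S]
      sat.simps(6)[of _ _ _ "ExS J (Conj g (Subset J I))"] sat.simps(5)[of _ _ _ "ExS J f" for f]
      sat.simps(10)[of _ _ _ J] A2_def[symmetric] ex all ok_def ..
  show ?thesis
  proof
    assume ?L
    then obtain MB MS where FL: "F \<le> L" and ok: "ok MB MS" unfolding L by blast
    have "F > 0" using le(2) by simp
    from blocks_ok_imp[OF this FL le(3) ok[unfolded ok_def, rule_format]] show ?R by blast
  next
    assume R: ?R
    define \<beta> where "\<beta> j \<longleftrightarrow> bit ((j - c) div F) ((j - c) mod F)" for j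
    define s where "s j \<longleftrightarrow> F dvd j - c" for j
    define MB MS where "MB = {(i, j) \<in> grid m n. \<beta> j}" and "MS = {(i, j) \<in> grid m n. s j}"
    have "block_ok ov c L F (\<lambda>j. (1, j) \<in> MB) (\<lambda>j. (1, j) \<in> MS) e" if e: "c \<le> e" "e + F \<le> c + L" for e
    proof -
      have "block_ok ov c L F (\<lambda>j. (1, j) \<in> MB) (\<lambda>j. (1, j) \<in> MS) e = block_ok ov c L F \<beta> s e"
        by (rule block_ok_cong[where n = n]) (use e le in \<open>auto simp: MB_def MS_def grid_def\<close>)
      moreover have "block_ok ov c L F \<beta> s e"
        unfolding \<beta>_def s_def by (rule blocks_ok_exist) (use R e le in auto)
      ultimately show ?thesis by simp
    qed
    moreover have "MB \<subseteq> grid m n" "MS \<subseteq> grid m n" by (auto simp: MB_def MS_def)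
    moreover have "F \<le> L"
    proof -
      have "F dvd L" using R by (meson dvd_mult_left)
      then show ?thesis using le by (intro dvd_imp_le) auto
    qed
    ultimately show ?L unfolding L ok_def by blast
  qed
qed

text \<open>At the bottom of the recursion the height is the ruler: each column holds an
  \<open>m\<close>-bit number, lowest bit in the top row, and neighbouring columns hold successive
  numbers. The fourth conjunct forbids overflow, which would show in the bottom row.\<close>

definition Column_Counter :: "nat \<Rightarrow> nat \<Rightarrow> fm" where
  "Column_Counter I B =
     Conj (AllF 0 (Imp (Conj (Mem I 0) (No_Left I 0)) (Neg (Mem B 0))))
    (Conj (AllF 0 (AllF 1 (Imp (Conj (Mem I 0) (Conj (Mem I 1) (Conj (S2 0 1) (Top_Row 0))))
       (Iff (Mem B 1) (Neg (Mem B 0))))))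
    (Conj (AllF 0 (AllF 1 (AllF 2 (AllF 3 (Imp (Conj (Mem I 0) (Conj (Mem I 1) (Conj (S2 0 1) (Conj (S1 2 0) (S1 3 1)))))
       (Iff (Iff (Mem B 1) (Neg (Mem B 0))) (Conj (Mem B 2) (Neg (Mem B 3)))))))))
    (Conj (AllF 0 (AllF 1 (Imp (Conj (Mem I 0) (Conj (Mem I 1) (Conj (S2 0 1) (Bottom_Row 0)))) (Imp (Mem B 0) (Mem B 1)))))
    (AllF 0 (Imp (Conj (Mem I 0) (No_Right I 0)) (Mem B 0))))))"

lemma sat_Column_Counter:
  assumes I: "A I = strip m c L" and le: "1 \<le> m" "1 \<le> c" "1 \<le> L" "c + L \<le> n + 1"
  shows "sat (grid m n) a A (Column_Counter I B) \<longleftrightarrow>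
    counts m L (\<lambda>t i. (Suc i, c + t) \<in> A B) \<and>
    (\<forall>t. Suc t < L \<longrightarrow> (m, c + t) \<in> A B \<longrightarrow> (m, c + Suc t) \<in> A B) \<and>
    (\<forall>i<m. (Suc i, c + (L - 1)) \<in> A B)"
proof -
  let ?b = "\<lambda>t i. (Suc i, c + t) \<in> A B"
  have sub: "A I \<subseteq> grid m n" unfolding I by (rule strip_subset_grid) (use le in auto)
  have mem: "(i, j) \<in> A I \<longleftrightarrow> 1 \<le> i \<and> i \<le> m \<and> c \<le> j \<and> j < c + L" for i j
    by (auto simp: I strip_def)
  have NP: "sat (grid m n) b A (No_Left I x) \<longleftrightarrow> snd (b x) = 1 \<or> (fst (b x), snd (b x) - 1) \<notin> A I"
    if "x \<noteq> 9" "b x \<in> grid m n" for b x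
    by (rule sat_No_Left[of x b m n A I, OF that sub])
  have NS: "sat (grid m n) b A (No_Right I x) \<longleftrightarrow> (fst (b x), snd (b x) + 1) \<notin> A I" if "x \<noteq> 9" for b x
    by (rule sat_No_Right[of x A I m n b, OF that sub])
  have I_all: "(\<forall>p\<in>grid m n. p \<in> A I \<and> P p \<longrightarrow> Q p) \<longleftrightarrow> (\<forall>i<m. \<forall>t<L. P (Suc i, c + t) \<longrightarrow> Q (Suc i, c + t))" for P Q
  proof
    assume *: "\<forall>p\<in>grid m n. p \<in> A I \<and> P p \<longrightarrow> Q p"
    show "\<forall>i<m. \<forall>t<L. P (Suc i, c + t) \<longrightarrow> Q (Suc i, c + t)"
      using * sub mem by (auto simp: subset_eq)
  next
    assume *: "\<forall>i<m. \<forall>t<L. P (Suc i, c + t) \<longrightarrow> Q (Suc i, c + t)"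
    show "\<forall>p\<in>grid m n. p \<in> A I \<and> P p \<longrightarrow> Q p"
    proof (intro ballI impI, elim conjE)
      fix p assume p: "p \<in> A I" "P p"
      obtain i j where ij: "p = (i, j)" by (cases p)
      then have "i - 1 < m" "j - c < L" "p = (Suc (i - 1), c + (j - c))" using p(1) mem[of i j] by auto
      with * p(2) show "Q p" by metis
    qed
  qed
  have 1: "sat (grid m n) a A (AllF 0 (Imp (Conj (Mem I 0) (No_Left I 0)) (Neg (Mem B 0)))) \<longleftrightarrow> (\<forall>i<m. \<not> ?b 0 i)"
  proof -
    have "sat (grid m n) a A (AllF 0 (Imp (Conj (Mem I 0) (No_Left I 0)) (Neg (Mem B 0)))) \<longleftrightarrow>
      (\<forall>p\<in>grid m n. p \<in> A I \<and> (snd p = 1 \<or> (fst p, snd p - 1) \<notin> A I) \<longrightarrow> p \<notin> A B)"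
      unfolding sat.simps(9) by (intro ball_cong refl) (auto simp: NP)
    also have "\<dots> \<longleftrightarrow> (\<forall>i<m. \<not> ?b 0 i)"
    proof -
      have "c + t = 1 \<or> (Suc i, c + t - 1) \<notin> A I \<longleftrightarrow> t = 0" if "t < L" "i < m" for t i
        unfolding mem using that le by auto
      moreover have "0 < L" using le by simp
      ultimately show ?thesis unfolding I_all fst_conv snd_conv by blast
    qed
    finally show ?thesis .
  qed
  have 2: "sat (grid m n) a A (AllF 0 (AllF 1 (Imp (Conj (Mem I 0) (Conj (Mem I 1) (Conj (S2 0 1) (Top_Row 0))))
       (Iff (Mem B 1) (Neg (Mem B 0)))))) \<longleftrightarrow> (\<forall>t. Suc t < L \<longrightarrow> ?b (Suc t) 0 \<noteq> ?b t 0)"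
  proof -
    have "sat (grid m n) a A (AllF 0 (AllF 1 (Imp (Conj (Mem I 0) (Conj (Mem I 1) (Conj (S2 0 1) (Top_Row 0))))
       (Iff (Mem B 1) (Neg (Mem B 0)))))) \<longleftrightarrow>
      (\<forall>p\<in>grid m n. \<forall>q\<in>grid m n. p \<in> A I \<and> q \<in> A I \<and> q = (fst p, snd p + 1) \<and> fst p = 1 \<longrightarrow> (q \<in> A B) \<noteq> (p \<in> A B))"
      unfolding sat.simps(9) by (intro ball_cong refl) (auto simp: sat_Top_Row)
    also have "\<dots> \<longleftrightarrow> (\<forall>p\<in>grid m n. p \<in> A I \<and> ((fst p, snd p + 1) \<in> A I \<and> fst p = 1) \<longrightarrow>
        ((fst p, snd p + 1) \<in> A B) \<noteq> (p \<in> A B))" using sub by blast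
    also have "\<dots> \<longleftrightarrow> (\<forall>t. Suc t < L \<longrightarrow> ?b (Suc t) 0 \<noteq> ?b t 0)"
      unfolding I_all using le by (auto simp: mem)
    finally show ?thesis .
  qed
  have 3: "sat (grid m n) a A (AllF 0 (AllF 1 (AllF 2 (AllF 3 (Imp (Conj (Mem I 0) (Conj (Mem I 1) (Conj (S2 0 1) (Conj (S1 2 0) (S1 3 1)))))
       (Iff (Iff (Mem B 1) (Neg (Mem B 0))) (Conj (Mem B 2) (Neg (Mem B 3))))))))) \<longleftrightarrow>
     (\<forall>t. Suc t < L \<longrightarrow> (\<forall>i. Suc i < m \<longrightarrow> (?b (Suc t) (Suc i) \<noteq> ?b t (Suc i) \<longleftrightarrow> ?b t i \<and> \<not> ?b (Suc t) i)))"
    (is "?l \<longleftrightarrow> ?r")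
  proof -
    have "?l \<longleftrightarrow> (\<forall>p\<in>grid m n. \<forall>q\<in>grid m n. \<forall>p'\<in>grid m n. \<forall>q'\<in>grid m n.
        p \<in> A I \<and> q \<in> A I \<and> q = (fst p, snd p + 1) \<and> p = (fst p' + 1, snd p') \<and> q = (fst q' + 1, snd q') \<longrightarrow>
        ((q \<in> A B) \<noteq> (p \<in> A B) \<longleftrightarrow> p' \<in> A B \<and> q' \<notin> A B))"
      unfolding sat.simps(9) by (intro ball_cong refl) auto
    also have "\<dots> \<longleftrightarrow> ?r"
    proof
      assume *: "\<forall>p\<in>grid m n. \<forall>q\<in>grid m n. \<forall>p'\<in>grid m n. \<forall>q'\<in>grid m n.
        p \<in> A I \<and> q \<in> A I \<and> q = (fst p, snd p + 1) \<and> p = (fst p' + 1, snd p') \<and> q = (fst q' + 1, snd q') \<longrightarrow>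
        ((q \<in> A B) \<noteq> (p \<in> A B) \<longleftrightarrow> p' \<in> A B \<and> q' \<notin> A B)"
      show ?r
      proof (intro allI impI)
        fix t i assume ti: "Suc t < L" "Suc i < m"
        have "(Suc (Suc i), c + t) \<in> A I" "(Suc (Suc i), c + Suc t) \<in> A I"
          "(Suc i, c + t) \<in> A I" "(Suc i, c + Suc t) \<in> A I" using ti by (auto simp: mem)
        moreover from this have "(Suc (Suc i), c + t) \<in> grid m n" "(Suc (Suc i), c + Suc t) \<in> grid m n"
          "(Suc i, c + t) \<in> grid m n" "(Suc i, c + Suc t) \<in> grid m n" using sub by auto
        ultimately show "?b (Suc t) (Suc i) \<noteq> ?b t (Suc i) \<longleftrightarrow> ?b t i \<and> \<not> ?b (Suc t) i"
          by (intro *[rule_format]) auto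
      qed
    next
      assume *: ?r
      show "\<forall>p\<in>grid m n. \<forall>q\<in>grid m n. \<forall>p'\<in>grid m n. \<forall>q'\<in>grid m n.
        p \<in> A I \<and> q \<in> A I \<and> q = (fst p, snd p + 1) \<and> p = (fst p' + 1, snd p') \<and> q = (fst q' + 1, snd q') \<longrightarrow>
        ((q \<in> A B) \<noteq> (p \<in> A B) \<longleftrightarrow> p' \<in> A B \<and> q' \<notin> A B)"
      proof (intro ballI impI, elim conjE)
        fix p q p' q'
        assume g: "p \<in> A I" "q \<in> A I" "p' \<in> grid m n" and e: "q = (fst p, snd p + 1)" "p = (fst p' + 1, snd p')" "q = (fst q' + 1, snd q')"
        obtain i j where p': "p' = (i, j)" by (cases p')
        then have p: "p = (Suc i, j)" "q = (Suc i, Suc j)" "q' = (i, Suc j)" using e by (cases q'; auto)+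
        have i: "1 \<le> i" using g(3) p' by (auto simp: grid_def)
        have "Suc (j - c) < L" "Suc (i - 1) < m" "c + (j - c) = j" "Suc (i - 1) = i" "c + Suc (j - c) = Suc j"
          using g(1,2) p i by (auto simp: mem)
        with *[rule_format, of "j - c" "i - 1"]
        show "(q \<in> A B) \<noteq> (p \<in> A B) \<longleftrightarrow> p' \<in> A B \<and> q' \<notin> A B" unfolding p p' by simp
      qed
    qed
    finally show ?thesis .
  qed
  have 4: "sat (grid m n) a A (AllF 0 (AllF 1 (Imp (Conj (Mem I 0) (Conj (Mem I 1) (Conj (S2 0 1) (Bottom_Row 0))))
       (Imp (Mem B 0) (Mem B 1))))) \<longleftrightarrow> (\<forall>t. Suc t < L \<longrightarrow> (m, c + t) \<in> A B \<longrightarrow> (m, c + Suc t) \<in> A B)"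
  proof -
    have "sat (grid m n) a A (AllF 0 (AllF 1 (Imp (Conj (Mem I 0) (Conj (Mem I 1) (Conj (S2 0 1) (Bottom_Row 0))))
       (Imp (Mem B 0) (Mem B 1))))) \<longleftrightarrow>
      (\<forall>p\<in>grid m n. \<forall>q\<in>grid m n. p \<in> A I \<and> q \<in> A I \<and> q = (fst p, snd p + 1) \<and> fst p = m \<longrightarrow> p \<in> A B \<longrightarrow> q \<in> A B)"
      unfolding sat.simps(9) by (intro ball_cong refl) (auto simp: sat_Bottom_Row)
    also have "\<dots> \<longleftrightarrow> (\<forall>p\<in>grid m n. p \<in> A I \<and> ((fst p, snd p + 1) \<in> A I \<and> fst p = m) \<longrightarrow>
        p \<in> A B \<longrightarrow> (fst p, snd p + 1) \<in> A B)" using sub by blast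
    also have "\<dots> \<longleftrightarrow> (\<forall>i<m. \<forall>t<L. Suc t < L \<and> Suc i = m \<longrightarrow> (m, c + t) \<in> A B \<longrightarrow> (m, c + Suc t) \<in> A B)"
      unfolding I_all by (auto simp: mem)
    also have "\<dots> \<longleftrightarrow> (\<forall>t. Suc t < L \<longrightarrow> (m, c + t) \<in> A B \<longrightarrow> (m, c + Suc t) \<in> A B)"
    proof
      assume *: "\<forall>i<m. \<forall>t<L. Suc t < L \<and> Suc i = m \<longrightarrow> (m, c + t) \<in> A B \<longrightarrow> (m, c + Suc t) \<in> A B"
      show "\<forall>t. Suc t < L \<longrightarrow> (m, c + t) \<in> A B \<longrightarrow> (m, c + Suc t) \<in> A B"
        using *[rule_format, of "m - 1"] le by simp
    qed auto
    finally show ?thesis .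
  qed
  have 5: "sat (grid m n) a A (AllF 0 (Imp (Conj (Mem I 0) (No_Right I 0)) (Mem B 0))) \<longleftrightarrow>
      (\<forall>i<m. (Suc i, c + (L - 1)) \<in> A B)"
  proof -
    have "sat (grid m n) a A (AllF 0 (Imp (Conj (Mem I 0) (No_Right I 0)) (Mem B 0))) \<longleftrightarrow>
      (\<forall>p\<in>grid m n. p \<in> A I \<and> (fst p, snd p + 1) \<notin> A I \<longrightarrow> p \<in> A B)"
      unfolding sat.simps(9) by (intro ball_cong refl) (auto simp: NS)
    also have "\<dots> \<longleftrightarrow> (\<forall>i<m. \<forall>t<L. \<not> Suc t < L \<longrightarrow> (Suc i, c + t) \<in> A B)"
      unfolding I_all by (auto simp: mem)
    also have "\<dots> \<longleftrightarrow> (\<forall>i<m. (Suc i, c + (L - 1)) \<in> A B)"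
    proof -
      have "t < L \<and> \<not> Suc t < L \<longleftrightarrow> t = L - 1" for t using le by auto
      then show ?thesis by metis
    qed
    finally show ?thesis .
  qed
  show ?thesis unfolding Column_Counter_def sat.simps(6) 1 2 3 4 5 counts_def by blast
qed

lemma counts_cong:
  assumes b: "counts F T b" and eq: "\<And>t i. t < T \<Longrightarrow> i < F \<Longrightarrow> b' t i = b t i" and pos: "F > 0" "T > 0"
  shows "counts F T b'"
  unfolding counts_def
proof (intro conjI allI impI)
  show "\<not> b' 0 i" if "i < F" for i using b that pos by (simp add: counts_def eq)
  fix t assume t: "Suc t < T"
  show "b' (Suc t) 0 \<noteq> b' t 0" using b t pos by (simp add: counts_def eq)
  show "b' (Suc t) (Suc i) \<noteq> b' t (Suc i) \<longleftrightarrow> b' t i \<and> \<not> b' (Suc t) i" if "Suc i < F" for i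
    using b t that by (simp add: counts_def eq)
qed

lemma sat_Column_Counter_iff:
  assumes I: "A I = strip m c L" and B: "I \<noteq> B" and le: "1 \<le> m" "1 \<le> c" "1 \<le> L" "c + L \<le> n + 1"
  shows "sat (grid m n) a A (ExS B (Column_Counter I B)) \<longleftrightarrow> L = 2 ^ m"
proof -
  have sat: "sat (grid m n) a (A(B := M)) (Column_Counter I B) \<longleftrightarrow>
    counts m L (\<lambda>t i. (Suc i, c + t) \<in> M) \<and>
    (\<forall>t. Suc t < L \<longrightarrow> (m, c + t) \<in> M \<longrightarrow> (m, c + Suc t) \<in> M) \<and>
    (\<forall>i<m. (Suc i, c + (L - 1)) \<in> M)" for M
    using sat_Column_Counter[of "A(B := M)" I m c L n a B] I B le by simp
  show ?thesis
  proof
    assume "sat (grid m n) a A (ExS B (Column_Counter I B))"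
    then obtain M where M: "counts m L (\<lambda>t i. (Suc i, c + t) \<in> M)"
      "\<forall>t. Suc t < L \<longrightarrow> (m, c + t) \<in> M \<longrightarrow> (m, c + Suc t) \<in> M"
      "\<forall>i<m. (Suc i, c + (L - 1)) \<in> M" using sat by auto
    show "L = 2 ^ m"
      by (rule counts_eq_pow[OF M(1)]) (use M le in auto)
  next
    assume L: "L = 2 ^ m"
    define M where "M = {(i, j) \<in> grid m n. c \<le> j \<and> bit (j - c) (i - 1)}"
    have M: "(Suc i, c + t) \<in> M \<longleftrightarrow> bit t i" if "t < L" "i < m" for t i
      using that le by (auto simp: M_def grid_def)
    have "counts m L (\<lambda>t i. (Suc i, c + t) \<in> M)"
      by (rule counts_cong[OF counts_bit]) (use M le in simp_all)
    moreover have "(m, c + Suc t) \<in> M" if "Suc t < L" "(m, c + t) \<in> M" for t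
      using M[of t "m - 1"] M[of "Suc t" "m - 1"] bit_top_mono[of t m] that L le by simp
    moreover have "(Suc i, c + (L - 1)) \<in> M" if "i < m" for i
      using M[of "L - 1" i] all_bits_iff_dvd_Suc[of m "L - 1"] that L by simp
    moreover have "M \<subseteq> grid m n" by (auto simp: M_def)
    ultimately show "sat (grid m n) a A (ExS B (Column_Counter I B))" using sat by auto
  qed
qed

section \<open>Nested counters and divisibility of the width\<close>

primrec seg_len :: "nat \<Rightarrow> nat \<Rightarrow> nat" where
  "seg_len m 0 = 2 ^ m"
| "seg_len m (Suc k) = seg_len m k * 2 ^ seg_len m k"

text \<open>Level \<open>k\<close> has \<open>3 * k\<close> for its strip, which is free. Above the
  bottom, \<open>3 * k + 1\<close> holds its bits and \<open>3 * k + 2\<close> its marks, and the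
  ruler is the strip variable of the level below. A strip holding all numbers of \<open>F\<close>
  bits consists of \<open>2 ^ F\<close> blocks of length \<open>F\<close>, hence the recursion of
  \<open>seg_len\<close>.\<close>

primrec Segment :: "nat \<Rightarrow> fm" where
  "Segment 0 = Conj (Strip 0) (ExS 1 (Column_Counter 0 1))"
| "Segment (Suc k) = Conj (Strip (3 * Suc k))
     (Block_Counter False (Segment k) (3 * Suc k) (3 * Suc k + 1) (3 * Suc k + 2) (3 * k))"

lemma seg_len_pos: "seg_len m k > 0"
  by (induction k) auto

lemma sat_Segment:
  assumes m: "1 \<le> m"
  shows "A (3 * k) \<subseteq> grid m n \<Longrightarrow> sat (grid m n) a A (Segment k) \<longleftrightarrow>
    (\<exists>c. 1 \<le> c \<and> c + seg_len m k \<le> n + 1 \<and> A (3 * k) = strip m c (seg_len m k))"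
proof (induction k arbitrary: a A)
  case 0
  then have "sat (grid m n) a A (Segment 0) \<longleftrightarrow> (\<exists>c L. 1 \<le> c \<and> 1 \<le> L \<and> c + L \<le> n + 1 \<and> A 0 = strip m c L) \<and>
    sat (grid m n) a A (ExS 1 (Column_Counter 0 1))"
    using sat_Strip[OF m, of A 0 n a] by simp
  also have "\<dots> \<longleftrightarrow> (\<exists>c L. 1 \<le> c \<and> 1 \<le> L \<and> c + L \<le> n + 1 \<and> A 0 = strip m c L \<and> L = 2 ^ m)"
  proof -
    have "sat (grid m n) a A (ExS 1 (Column_Counter 0 1)) \<longleftrightarrow> L = 2 ^ m"
      if "A 0 = strip m c L" "1 \<le> c" "1 \<le> L" "c + L \<le> n + 1" for c L
      by (rule sat_Column_Counter_iff[of A 0 m c L 1, OF that(1) _ m that(2-4)]) simp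
    then show ?thesis by blast
  qed
  finally show ?case by auto
next
  case (Suc k)
  let ?i = "3 * Suc k"
  have "sat (grid m n) a A (Segment (Suc k)) \<longleftrightarrow> (\<exists>c L. 1 \<le> c \<and> 1 \<le> L \<and> c + L \<le> n + 1 \<and> A ?i = strip m c L) \<and>
    sat (grid m n) a A (Block_Counter False (Segment k) ?i (?i + 1) (?i + 2) (3 * k))"
    using sat_Strip[OF m, of A ?i n a] Suc.prems by simp
  also have "\<dots> \<longleftrightarrow> (\<exists>c L. 1 \<le> c \<and> 1 \<le> L \<and> c + L \<le> n + 1 \<and> A ?i = strip m c L \<and> L = seg_len m (Suc k))"
  proof -
    have "sat (grid m n) a A (Block_Counter False (Segment k) ?i (?i + 1) (?i + 2) (3 * k)) \<longleftrightarrow> L = seg_len m (Suc k)"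
      if "A ?i = strip m c L" "1 \<le> c" "1 \<le> L" "c + L \<le> n + 1" for c L
    proof -
      have F: "1 \<le> seg_len m k" using seg_len_pos[of m k] by simp
      have "distinct [?i, ?i + 1, ?i + 2, 3 * k]" by simp
      from sat_Block_Counter[of "3 * k" m n "Segment k" "seg_len m k" ?i "?i + 1" "?i + 2" A c L, OF Suc.IH this that(1) m F that(2-4)]
      show ?thesis by auto
    qed
    then show ?thesis by blast
  qed
  finally show ?case using seg_len_pos[of m "Suc k"] by (auto simp: Suc_le_eq simp del: seg_len.simps)
qed

text \<open>The quantifier names the set of all positions, to which the counter is applied. Overflow
  is allowed, so any number of complete cycles may fill the width.\<close>

definition Divisible_Width :: "nat \<Rightarrow> fm" where
  "Divisible_Width k = ExS (3 * Suc k) (Conj (AllF 0 (Mem (3 * Suc k) 0))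
     (Block_Counter True (Segment k) (3 * Suc k) (3 * Suc k + 1) (3 * Suc k + 2) (3 * k)))"

lemma sat_Divisible_Width:
  assumes "1 \<le> m" "1 \<le> n"
  shows "sat (grid m n) a A (Divisible_Width k) \<longleftrightarrow> seg_len m (Suc k) dvd n"
proof -
  let ?i = "3 * Suc k"
  let ?C = "Block_Counter True (Segment k) ?i (?i + 1) (?i + 2) (3 * k)"
  have "sat (grid m n) a A (Divisible_Width k) \<longleftrightarrow> (\<exists>M\<subseteq>grid m n. grid m n \<subseteq> M \<and> sat (grid m n) a (A(?i := M)) ?C)"
    by (auto simp: Divisible_Width_def)
  also have "\<dots> \<longleftrightarrow> sat (grid m n) a (A(?i := grid m n)) ?C" by (metis subset_antisym subset_refl)
  also have "\<dots> \<longleftrightarrow> seg_len m (Suc k) dvd n"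
  proof -
    have F: "1 \<le> seg_len m k" using seg_len_pos[of m k] by simp
    have d: "distinct [?i, ?i + 1, ?i + 2, 3 * k]" by simp
    have g: "(A(?i := grid m n)) ?i = strip m 1 n" by (auto simp: strip_def grid_def)
    have "1 + n \<le> n + 1" by simp
    from sat_Block_Counter[of "3 * k" m n "Segment k" "seg_len m k" ?i "?i + 1" "?i + 2" "A(?i := grid m n)" 1 n, OF sat_Segment[OF assms(1)] d g assms(1) F order_refl assms(2) this]
    show ?thesis by simp
  qed
  finally show ?thesis .
qed

section \<open>Separation\<close>

lemma no_set_quant_Sigma_mon: "no_set_quant f \<Longrightarrow> f \<in> Sigma_mon k"
proof (induction k)
  case 0
  then show ?case by (auto simp: Sigma_mon_def FO_def fm_equiv_def)
next
  case (Suc k)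
  then show ?case by (auto simp: Sigma_mon_def intro: Sigma1_mon.base Bool_cl.base)
qed

lemma Sigma_mon_Suc_intros:
  shows "f \<in> Bool_cl (Sigma_mon k) \<Longrightarrow> f \<in> Sigma_mon (Suc k)"
    and "f \<in> Sigma_mon (Suc k) \<Longrightarrow> ExS X f \<in> Sigma_mon (Suc k)"
    and "f \<in> Sigma_mon (Suc k) \<Longrightarrow> g \<in> Sigma_mon (Suc k) \<Longrightarrow> Conj f g \<in> Sigma_mon (Suc k)"
  by (auto simp: Sigma_mon_def intro: Sigma1_mon.intros)

lemmas seg_defs = Strip_def First_Top_def Right_After_def Top_Row_def Bottom_Row_def No_Left_def No_Right_def Subset_def Block_Conditions_def
  Column_Counter_def

text \<open>Both occurrences of \<open>g\<close> sit below \<open>ExS J\<close>, one of them under a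
  negation: a Boolean combination of formulas at the level of \<open>g\<close>. The quantifiers over
  bits and marks lift it to the next level.\<close>

lemma Block_Counter_Sigma_mon:
  assumes g: "g \<in> Sigma_mon (Suc k)"
  shows "Block_Counter ov g I B S J \<in> Sigma_mon (Suc (Suc k))"
proof -
  have nq: "no_set_quant (Subset J I)" "no_set_quant (Conj (Subset J I) (Neg (Block_Conditions ov I B S J)))"
    by (simp_all add: seg_defs)
  have "ExS J (Conj g h) \<in> Sigma_mon (Suc k)" if "no_set_quant h" for h
    by (rule Sigma_mon_Suc_intros(2)[OF Sigma_mon_Suc_intros(3)[OF g no_set_quant_Sigma_mon[OF that]]])
  from this[OF nq(1)] this[OF nq(2)]
  have "Conj (ExS J (Conj g (Subset J I))) (Neg (ExS J (Conj g (Conj (Subset J I) (Neg (Block_Conditions ov I B S J))))))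
    \<in> Bool_cl (Sigma_mon (Suc k))"
    by (blast intro: Bool_cl.intros)
  then show ?thesis
    unfolding Block_Counter_def by (intro Sigma_mon_Suc_intros(2) Sigma_mon_Suc_intros(1))
qed

lemma Segment_Sigma_mon: "Segment k \<in> Sigma_mon (Suc k)"
proof (induction k)
  case 0
  have "no_set_quant (Strip 0)" "no_set_quant (Column_Counter 0 1)" by (simp_all add: seg_defs)
  then show ?case
    unfolding Segment.simps by (intro Sigma_mon_Suc_intros(2,3) no_set_quant_Sigma_mon)
next
  case (Suc k)
  have "no_set_quant (Strip (3 * Suc k))" by (simp add: seg_defs)
  then show ?case
    unfolding Segment.simps by (intro Sigma_mon_Suc_intros(3) no_set_quant_Sigma_mon Block_Counter_Sigma_mon Suc.IH)
qed

lemma Divisible_Width_Sigma_mon: "Divisible_Width k \<in> Sigma_mon (Suc (Suc k))"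
  unfolding Divisible_Width_def
  by (intro Sigma_mon_Suc_intros(2,3) Block_Counter_Sigma_mon Segment_Sigma_mon no_set_quant_Sigma_mon) simp

lemma free_Segment: "free_fo (Segment k) = {}" "free_set (Segment k) \<subseteq> {3 * k}"
  by (induction k) (auto simp: Block_Counter_def seg_defs)

lemma free_Divisible_Width: "free_fo (Divisible_Width k) = {}" "free_set (Divisible_Width k) = {}"
  using free_Segment[of k] by (auto simp: Divisible_Width_def Block_Counter_def seg_defs)

lemma sat_free_cong:
  "(\<And>x. x \<in> free_fo f \<Longrightarrow> a x = a' x) \<Longrightarrow> (\<And>X. X \<in> free_set f \<Longrightarrow> A X = A' X) \<Longrightarrow>
    sat D a A f = sat D a' A' f"
proof (induction f arbitrary: a a' A A')
  case (Neg f)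
  then show ?case by (metis free_fo.simps(5) free_set.simps(5) sat.simps(5))
next
  case (Conj f g)
  have "sat D a A f = sat D a' A' f" "sat D a A g = sat D a' A' g"
    by (rule Conj.IH; use Conj.prems in simp)+
  then show ?case by simp
next
  case (Disj f g)
  have "sat D a A f = sat D a' A' f" "sat D a A g = sat D a' A' g"
    by (rule Disj.IH; use Disj.prems in simp)+
  then show ?case by simp
next
  case (ExF x f)
  have "sat D (a(x := d)) A f = sat D (a'(x := d)) A' f" for d
    by (rule ExF.IH) (use ExF.prems in auto)
  then show ?case by simp
next
  case (AllF x f)
  have "sat D (a(x := d)) A f = sat D (a'(x := d)) A' f" for d
    by (rule AllF.IH) (use AllF.prems in auto)
  then show ?case by simp
next
  case (ExS X f)
  have "sat D a (A(X := M)) f = sat D a' (A'(X := M)) f" for M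
    by (rule ExS.IH) (use ExS.prems in auto)
  then show ?case by simp
next
  case (AllS X f)
  have "sat D a (A(X := M)) f = sat D a' (A'(X := M)) f" for M
    by (rule AllS.IH) (use AllS.prems in auto)
  then show ?case by simp
qed auto

definition blank :: "nat \<Rightarrow> nat \<Rightarrow> picture" where
  "blank m n = mat m n (\<lambda>_. \<lambda>_. undefined)"

lemma blank_pictures: "m \<ge> 1 \<Longrightarrow> n \<ge> 1 \<Longrightarrow> blank m n \<in> pictures {}"
  by (auto simp: blank_def pictures_def alphabet_def elements_mat_def)

lemma blank_in_language_iff:
  assumes f: "free_fo f = {}" "free_set f \<subseteq> {}" and mn: "m \<ge> 1" "n \<ge> 1"
  shows "blank m n \<in> language {} f \<longleftrightarrow> sat (grid m n) a (\<lambda>_. {}) f"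
proof -
  have dom: "pdom (blank m n) = grid m n" by (simp add: pdom_def grid_def blank_def)
  have eq: "sat (grid m n) b B f \<longleftrightarrow> sat (grid m n) a (\<lambda>_. {}) f" for b B
    by (rule sat_free_cong) (use f in auto)
  have "((\<lambda>_. (1, 1)), (\<lambda>_. {})) \<in> assignments (blank m n)"
    using mn by (auto simp: assignments_def dom grid_def)
  moreover have "pic_sat {} (blank m n) b B f \<longleftrightarrow> sat (grid m n) a (\<lambda>_. {}) f" for b B
    unfolding pic_sat_def dom by (rule eq)
  ultimately show ?thesis
    using blank_pictures[OF mn] unfolding language_def by blast
qed

section \<open>A common multiple with few factors 2, and the choice of the height\<close>

lemma even_part_decomp:
  "c > 0 \<Longrightarrow> \<exists>e y. c = 2 ^ e * y \<and> odd y" for c :: nat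
proof (induction c rule: less_induct)
  case (less c)
  show ?case
  proof (cases "even c")
    case True
    then obtain d where d: "c = 2 * d" by (rule evenE)
    with less.IH[of d] less.prems obtain e y where "d = 2 ^ e * y" "odd y" by auto
    then show ?thesis using d by (intro exI[of _ "Suc e"] exI[of _ y]) simp
  next
    case False
    then show ?thesis by (intro exI[of _ 0] exI[of _ c]) simp
  qed
qed

text \<open>The power of 2 in a number up to \<open>N < 2 ^ s\<close> is at most
  \<open>2 ^ (s - 1)\<close>, and the odd part of that number is among the odd numbers up to
  \<open>N\<close>. So \<open>2 ^ (s - 1)\<close> times the product of these odd numbers is a
  suitable multiple.\<close>

lemma common_multiple_not_dvd:
  assumes N: "N < 2 ^ s" and s: "s > 0"
  obtains P :: nat where "P > 0" "\<And>c. c \<in> {1..N} \<Longrightarrow> c dvd P" "\<not> 2 ^ s dvd P"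
proof -
  define M where "M = \<Prod>{i \<in> {1..N}. odd i}"
  have M: "odd M" unfolding M_def by (rule ccontr) (auto simp: even_prod_iff)
  define P where "P = 2 ^ (s - 1) * M"
  have "P > 0" using M by (auto simp: P_def intro: odd_pos)
  moreover have "c dvd P" if c: "c \<in> {1..N}" for c
  proof -
    obtain e y where y: "c = 2 ^ e * y" "odd y" using even_part_decomp[of c] c by auto
    have "y dvd c" using y(1) by (metis dvd_triv_right)
    then have "y \<le> c" using c by (intro dvd_imp_le) auto
    then have "y \<in> {i \<in> {1..N}. odd i}" using y(2) c by (auto intro: Suc_leI odd_pos)
    then have "y dvd M" unfolding M_def by (intro dvd_prodI) auto
    have "2 ^ e dvd c" using y(1) by (rule dvdI)
    then have "2 ^ e \<le> c" using c by (intro dvd_imp_le) auto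
    moreover have "c < 2 ^ s" using c N by simp
    ultimately have "(2::nat) ^ e < 2 ^ s" by (rule le_less_trans)
    then have "e < s" by simp
    then have "(2::nat) ^ e dvd 2 ^ (s - 1)" by (intro le_imp_power_dvd) simp
    with \<open>y dvd M\<close> have "2 ^ e * y dvd P" unfolding P_def by (rule mult_dvd_mono[rotated])
    then show ?thesis using y(1) by simp
  qed
  moreover have "\<not> 2 ^ s dvd P"
  proof
    assume "2 ^ s dvd P"
    moreover have "(2::nat) ^ s = 2 ^ (s - 1) * 2" using s by (cases s) auto
    ultimately have "even M" unfolding P_def by simp
    then show False using M by simp
  qed
  ultimately show thesis by (rule that)
qed

lemma tower_strict_mono: "x < y \<Longrightarrow> tower k x < tower k y"
  by (induction k) auto

lemma tower_pow2: "tower k (2 ^ x) = 2 ^ tower k x"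
  by (induction k) auto

lemma tower_le_seg_len: "tower (Suc k) m \<le> seg_len m k"
proof (induction k)
  case (Suc k)
  have "tower (Suc (Suc k)) m \<le> 2 ^ seg_len m k" using Suc.IH by (simp add: power_increasing)
  also have "\<dots> \<le> seg_len m (Suc k)" using seg_len_pos[of m k] by simp
  finally show ?case .
qed simp

text \<open>Supplies a height at which one exponential in the argument of a tower beats the constant
  of the formula.\<close>

lemma ex_mult_less_pow2: "\<exists>m\<ge>1. C * m < (2::nat) ^ m"
proof -
  have sq: "m * m \<le> 2 ^ m" if "m \<ge> 4" for m :: nat
    using that
  proof (induction m rule: nat_induct_at_least)
    case (Suc m)
    have "4 * m \<le> m * m" using Suc.hyps by (rule mult_le_mono1)
    moreover have "Suc m * Suc m = m * m + 2 * m + 1" by simp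
    ultimately have "Suc m * Suc m \<le> 2 * (m * m)" using Suc.hyps by linarith
    with Suc.IH show ?case by simp
  qed simp
  have "C * (C + 4) < (C + 4) * (C + 4)" by simp
  also have "\<dots> \<le> 2 ^ (C + 4)" by (rule sq) simp
  finally show ?thesis by (intro exI[of _ "C + 4"]) simp
qed

lemma Divisible_Width_not_definable: "\<not> definable (FO_cl (Sigma_mon (Suc k))) {} (language {} (Divisible_Width k))"
proof
  assume "definable (FO_cl (Sigma_mon (Suc k))) {} (language {} (Divisible_Width k))"
  then obtain f where f: "f \<in> FO_cl (Sigma_mon (Suc k))" "free_fo f = {}" "free_set f \<subseteq> {}"
    and eq: "language {} (Divisible_Width k) = language {} f" unfolding definable_def by blast
  have "f \<in> pump_class (Suc k)"
    by (rule FO_cl_pump_class[OF FO_cl_mono[OF f(1) Sigma_mon_nfa_class]])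
  then obtain C where pump: "\<And>m P. m \<ge> 1 \<Longrightarrow> P > 0 \<Longrightarrow>
      (\<And>c. c \<in> {1..tower (Suc k) (C * m)} \<Longrightarrow> c dvd P) \<Longrightarrow> \<exists>T. pumpable m P T f"
    by (rule pump_classE) blast
  obtain m where m: "m \<ge> 1" "C * m < 2 ^ m" using ex_mult_less_pow2[of C] by blast
  define s where "s = seg_len m k"
  \<comment> \<open>An exponential in the argument of a tower can be moved to the outside, where it
    compares with the factor \<open>2 ^ s\<close> of the required width.\<close>
  have "tower (Suc k) (C * m) < tower (Suc k) (2 ^ m)" by (rule tower_strict_mono[OF m(2)])
  also have "\<dots> = 2 ^ tower (Suc k) m" by (rule tower_pow2)
  also have "\<dots> \<le> 2 ^ s" unfolding s_def using tower_le_seg_len by (rule power_increasing) simp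
  finally obtain P where P: "P > 0" "\<And>c. c \<in> {1..tower (Suc k) (C * m)} \<Longrightarrow> c dvd P" "\<not> 2 ^ s dvd P"
    using common_multiple_not_dvd seg_len_pos[of m k] unfolding s_def by blast
  obtain T where T: "pumpable m P T f" using pump[OF m(1) P(1,2)] by blast
  define q where "q = seg_len m (Suc k)"
  have "q > 0" unfolding q_def by (rule seg_len_pos)
  \<comment> \<open>A multiple of \<open>q\<close> that leaves \<open>T\<close> columns on both
    sides of column \<open>T + 1\<close>.\<close>
  define n where "n = q * (2 * T + 1)"
  have n: "2 * T + 1 \<le> n" using mult_le_mono1[of 1 q "2 * T + 1"] \<open>q > 0\<close> by (simp add: n_def)
  then have "n \<ge> 1" by simp
  let ?a = "\<lambda>_. (1, 1) :: pos"
  have mem: "blank m n' \<in> language {} f \<longleftrightarrow> q dvd n'" if "n' \<ge> 1" for n'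
    using blank_in_language_iff[of "Divisible_Width k" m n' ?a, OF free_Divisible_Width(1) _ m(1) that]
      sat_Divisible_Width[OF m(1) that] free_Divisible_Width(2) eq by (simp add: q_def)
  \<comment> \<open>Inserting after column \<open>T + 1\<close> puts the pebbles, all parked in
    column 1, just outside the margin.\<close>
  have "sat (grid m n) ?a (\<lambda>_. {}) f \<longleftrightarrow> sat (grid m (n + P)) (shift (T + 1) P ?a) (\<lambda>_. {}) f"
    by (rule pumpableD[OF T]) (use n m in \<open>auto simp: grid_def\<close>)
  then have "blank m n \<in> language {} f \<longleftrightarrow> blank m (n + P) \<in> language {} f"
    using blank_in_language_iff[OF f(2,3) m(1)] n by simp
  then have "q dvd n + P" using mem n by (simp add: n_def)
  moreover have "q dvd n" by (simp add: n_def)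
  ultimately have "q dvd P" using dvd_add_right_iff[of q n P] by simp
  \<comment> \<open>By its recursion \<open>q\<close> is \<open>s * 2 ^ s\<close>, so divisibility
    by \<open>q\<close> contradicts the choice of \<open>P\<close>.\<close>
  then have "2 ^ s dvd P" unfolding q_def s_def using dvd_mult_right by fastforce
  with P(3) show False by blast
qed

theorem corollary2p11:
  fixes k :: nat
  assumes "k \<ge> 1"
  shows "(\<exists>J L. finite J \<and> L \<subseteq> pictures J \<and>
            definable (Sigma_mon (k + 1)) J L \<and> \<not> definable (FO_cl (Sigma_mon k)) J L) \<and>
         (\<exists>J L. finite J \<and> L \<subseteq> pictures J \<and>
            definable (FO_cl (Sigma_mon (k + 1))) J L \<and> \<not> definable (FO_cl (Sigma_mon k)) J L)"
proof -
  obtain k' where k: "k = Suc k'" using assms by (cases k) auto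
  define L where "L = language {} (Divisible_Width k')"
  have "definable (Sigma_mon (k + 1)) {} L"
    unfolding definable_def L_def using Divisible_Width_Sigma_mon[of k'] free_Divisible_Width[of k'] k by auto
  moreover from this have "definable (FO_cl (Sigma_mon (k + 1))) {} L"
    unfolding definable_def using FO_cl.base by blast
  moreover have "\<not> definable (FO_cl (Sigma_mon k)) {} L"
    unfolding L_def k by (rule Divisible_Width_not_definable)
  moreover have "L \<subseteq> pictures {}" by (auto simp: L_def language_def)
  ultimately show ?thesis by (meson finite.emptyI)
qed

end
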